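(* Let $(k_{s,t})_{(s,t)\in\Delta}$ be a family of transition kernels of a branching process on $[0,\infty]$. Then there exists a unique map $(s,x)\mapsto\mathbb{Q}^{(s,x)}$, assigning to each $s\ge0$ and $x\in[0,\infty]$ a probability measure $\mathbb{Q}^{(s,x)}$ on the measurable space $(D[0,\infty),\mathcal{G}_{[s,\infty)})$, such that $\big((X^{c}_t)_{t\ge0},D[0,\infty),\mathcal{G},(\mathcal{G}_I)_I,(\mathbb{Q}^{(s,x)})_{s\ge0,x\in[0,\infty]}\big)$ is a Markov family on $[0,\infty]$ (i.e. a branching process) with transition kernels $(k_{s,t})$.
   Context: $\Delta=\{(s,t):0\le s\le t<\infty\}$. Transition kernels and their composition $(k\star l)(x,B)=\int l(y,B)k(x,\mathrm dy)$ are as usual. A family of transition kernels of a branching process is a family $(k_{s,t})_{(s,t)\in\Delta}$ of transition kernels on the compact space $[0,\infty]$ satisfying: (K1) $k_{s,s}(x,\cdot)=\delta_x$; (K2) $k_{s,t}\star k_{t,u}=k_{s,u}$ for $s\le t\le u$; (K3) $\Delta\times[0,\infty)\ni(s,t,x)\mapsto k_{s,t}(x,\cdot)$ is weakly continuous into probability measures on $[0,\infty]$; (K4) $k_{s,t}(x,\cdot)\ast k_{s,t}(y,\cdot)=k_{s,t}(x+y,\cdot)$ for $x,y\in[0,\infty)$; (K5) $k_{s,t}(0,\cdot)=\delta_0$; (K6) $k_{s,t}(\infty,\cdot)=\delta_\infty$. A Markov family on $S$ with transition kernels $(k_{s,t})$ (satisfying K1, K2) is a process $(Z_t)_{t\ge0}$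 on a measurable space $(\Omega,\mathcal F)$ with sub-$\sigma$-fields $\mathcal F_I$ for each closed interval $I\subset[0,\infty)$ such that $I\subseteq J\Rightarrow\mathcal F_I\subseteq\mathcal F_J$, $Z_t$ is $\mathcal F_I$-measurable whenever $t\in I$, together with probability measures $\mathbb P^{(s,x)}$ on $(\Omega,\mathcal F_{[s,\infty)})$ ($s\ge0$, $x\in S$) with $\mathbb P^{(s,x)}[Z_s=x]=1$ and $\mathbb E^{(s,x)}[f(Z_u)\mid\mathcal F_{[s,t]}]=\int_S f(y)k_{t,u}(Z_t,\mathrm dy)$ $\mathbb P^{(s,x)}$-a.s. for all $0\le s\le t\le u$, $x\in S$ and bounded Borel $f$. For $s\ge0$, $D[s,\infty)$ is the set of càdlàg functions $\omega:[s,\infty)\to[0,\infty]$ such that if $r:=\omega(t)\in\{0,\infty\}$ for some $t\ge s$, or $r:=\omega(t-)\in\{0,\infty\}$ for some $t>s$, then $\omega(u)=r$ for all $u\ge t$. $X^c_t(\omega)=\omega(t)$ is the coordinate process on $D[0,\infty)$, $\mathcal G_I=\sigma(X^c_t:t\in I)$ for closed intervals $I$, and $\mathcal G=\mathcal G_{[0,\infty)}$. *)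

theory Defs
  imports "HOL-Probability.Probability"
begin

definition Delta :: "(real \<times> real) set" where
  "Delta = {(s,t). 0 \<le> s \<and> s \<le> t}"

definition transition_kernel :: "(ennreal \<Rightarrow> ennreal measure) \<Rightarrow> bool" where
  "transition_kernel k \<longleftrightarrow> k \<in> borel \<rightarrow>\<^sub>M prob_algebra borel"

definition kernel_comp ::
  "(ennreal \<Rightarrow> ennreal measure) \<Rightarrow> (ennreal \<Rightarrow> ennreal measure) \<Rightarrow> ennreal \<Rightarrow> ennreal measure" where
  "kernel_comp k l x = measure_of UNIV (sets borel) (\<lambda>B. \<integral>\<^sup>+ y. emeasure (l y) B \<partial>(k x))"

definition conv_ennreal :: "ennreal measure \<Rightarrow> ennreal measure \<Rightarrow> ennreal measure" where
  "conv_ennreal \<mu> \<nu> = distr (\<mu> \<Otimes>\<^sub>M \<nu>) borel (\<lambda>(a,b). a + b)"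

text \<open>Weak continuity of (s,t,x) \<mapsto> k s t x on \<Delta> \<times> [0,\<infinity>): the weak topology on probability
  measures is the initial topology of the maps \<mu> \<mapsto> \<integral> f d\<mu>, f bounded continuous
  (on the compact space [0,\<infinity>] every continuous real function is bounded).\<close>
definition weakly_continuous_kernels :: "(real \<Rightarrow> real \<Rightarrow> ennreal \<Rightarrow> ennreal measure) \<Rightarrow> bool" where
  "weakly_continuous_kernels k \<longleftrightarrow>
     (\<forall>f :: ennreal \<Rightarrow> real. continuous_on UNIV f \<longrightarrow>
        continuous_on {(s,t,x). (s,t) \<in> Delta \<and> x \<noteq> \<top>}
          (\<lambda>(s,t,x). \<integral> y. f y \<partial>(k s t x)))"

definition branching_kernels :: "(real \<Rightarrow> real \<Rightarrow> ennreal \<Rightarrow> ennreal measure) \<Rightarrow> bool" where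
  "branching_kernels k \<longleftrightarrow>
     (\<forall>(s,t) \<in> Delta. transition_kernel (k s t)) \<and>
     (\<forall>s \<ge> 0. \<forall>x. k s s x = return borel x) \<and>
     (\<forall>s t u. 0 \<le> s \<and> s \<le> t \<and> t \<le> u \<longrightarrow> kernel_comp (k s t) (k t u) = k s u) \<and>
     weakly_continuous_kernels k \<and>
     (\<forall>(s,t) \<in> Delta. \<forall>x y. x \<noteq> \<top> \<and> y \<noteq> \<top> \<longrightarrow>
        conv_ennreal (k s t x) (k s t y) = k s t (x + y)) \<and>
     (\<forall>(s,t) \<in> Delta. k s t 0 = return borel 0) \<and>
     (\<forall>(s,t) \<in> Delta. k s t \<top> = return borel \<top>)"

text \<open>D[0,\<infinity>): paths \<omega> : [0,\<infinity>) \<rightarrow> [0,\<infinity>], represented as functions real \<Rightarrow> ennreal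
  which are 0 (a dummy value) on negative times, cadlag on [0,\<infinity>), and absorbed at 0 and \<infinity>.\<close>
definition Dpaths :: "(real \<Rightarrow> ennreal) set" where
  "Dpaths = {\<omega>. (\<forall>t<0. \<omega> t = 0) \<and>
     (\<forall>t\<ge>0. (\<omega> \<longlongrightarrow> \<omega> t) (at_right t)) \<and>
     (\<forall>t>0. \<exists>l. (\<omega> \<longlongrightarrow> l) (at_left t)) \<and>
     (\<forall>t\<ge>0. \<omega> t \<in> {0, \<top>} \<longrightarrow> (\<forall>u\<ge>t. \<omega> u = \<omega> t)) \<and>
     (\<forall>t>0. \<forall>r\<in>{0, \<top>}. (\<omega> \<longlongrightarrow> r) (at_left t) \<longrightarrow> (\<forall>u\<ge>t. \<omega> u = r))}"

definition G :: "real set \<Rightarrow> (real \<Rightarrow> ennreal) measure" where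
  "G I = sigma Dpaths {{\<omega> \<in> Dpaths. \<omega> t \<in> B} | t B. t \<in> I \<and> B \<in> sets (borel :: ennreal measure)}"

definition coord_markov_family ::
  "(real \<Rightarrow> real \<Rightarrow> ennreal \<Rightarrow> ennreal measure) \<Rightarrow> (real \<Rightarrow> ennreal \<Rightarrow> (real \<Rightarrow> ennreal) measure) \<Rightarrow> bool" where
  "coord_markov_family k Q \<longleftrightarrow>
     (\<forall>s\<ge>0. \<forall>x.
        prob_space (Q s x) \<and> space (Q s x) = Dpaths \<and> sets (Q s x) = sets (G {s..}) \<and>
        emeasure (Q s x) {\<omega> \<in> Dpaths. \<omega> s = x} = 1 \<and>
        (\<forall>t u (f :: ennreal \<Rightarrow> real). s \<le> t \<and> t \<le> u \<and> f \<in> borel_measurable borel \<and>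
             (\<exists>B. \<forall>y. \<bar>f y\<bar> \<le> B) \<longrightarrow>
           (AE \<omega> in Q s x. real_cond_exp (Q s x) (G {s..t}) (\<lambda>\<omega>. f (\<omega> u)) \<omega>
                             = (\<integral> y. f y \<partial>(k t u (\<omega> t))))))"

end

theory Submission
  imports Defs
begin

text \<open>
  By the branching property the Laplace transform of \<open>k t T y\<close> at \<open>1\<close> is \<open>exp (- y * u)\<close> with
  \<open>u = u(t, T)\<close>, and continuity near the diagonal together with Chapman-Kolmogorov forces
  \<open>0 < u < \<infinity>\<close>, continuously in \<open>t\<close>. Hence for the process \<open>X\<close> obtained from Kolmogorov's extension
  theorem, \<open>M t = exp (- X t * u(t, T))\<close> is a martingale with values in \<open>[0, 1]\<close> from which \<open>X\<close> is
  recovered continuously. Its square-integrability bounds the expected number of oscillations of size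
  \<open>e\<close> along any finite set of times by \<open>1 / e\<^sup>2\<close>, so almost surely \<open>M\<close>, and thus \<open>X\<close>, has one-sided limits
  along the rationals. Both \<open>M\<close> and \<open>1 - M\<close> are nonnegative martingales, which cannot leave \<open>0\<close> after
  coming arbitrarily close to it: this is absorption at \<open>\<infinity>\<close> and at \<open>0\<close>. Weak continuity of the kernels
  identifies the right limit at each fixed time with \<open>X\<close>, so the law of the right limits is the
  required measure. It is unique because the Markov property determines all cylinder probabilities.
\<close>

section \<open>Kernels, cylinder expectations and the Kolmogorov extension\<close>

text \<open>Membership in \<open>Dpaths\<close> involves uncountably many times and is not an event
  of the product space. Regularity is therefore never asked of the Kolmogorov law itself: it is
  proved path by path from values at rational times, and the resulting path map pushes the law
  forward. K3 is silent at \<infinity>; K6 fills the gap in the Laplace formula and in the proof of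
  stochastic continuity. The martingale depends on its horizon: integer horizons yield the one-sided
  limits, while absorption is a statement about a terminal value and takes every rational q > s as
  horizon. Positivity of u is what allows the return from M to X, through the exponent 1/u. No
  stopping time is formalised: the martingale estimates are inductions along a finite list of times
  that disintegrate at the first one, and Fatou's lemma or continuity of measure carries them to the
  rationals. The constant 1 in the oscillation bound is a bound for the second moment of the
  terminal value about the initial reference value 0; each reset uses up at least
  \<open>e\<^sup>2\<close> of it.\<close>

definition expneg :: "ennreal \<Rightarrow> real" where
  "expneg y = (if y = \<top> then 0 else exp (- enn2real y))"

text \<open>Inverse of \<open>expneg\<close> on [0,1], extended continuously to all reals: it is
  \<top> for v \<le> 0, and for v > 1 the truncation of negative numbers by \<open>ennreal\<close>
  gives 0. The two maps identify [0,\<infinity>] with [0,1].\<close>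

definition neglog :: "real \<Rightarrow> ennreal" where
  "neglog v = (if v \<le> 0 then \<top> else ennreal (- ln v))"

lemma neglog_expneg [simp]: "neglog (expneg y) = y"
  by (auto simp: neglog_def expneg_def less_top[symmetric])

lemma expneg_top [simp]: "expneg \<top> = 0"
  and expneg_0 [simp]: "expneg 0 = 1"
  by (simp_all add: expneg_def)

lemma expneg_nonneg [simp]: "0 \<le> expneg y"
  and expneg_le_1 [simp]: "expneg y \<le> 1"
  by (simp_all add: expneg_def)

lemma expneg_eq_1_iff: "expneg y = 1 \<longleftrightarrow> y = 0"
  by (metis neglog_expneg expneg_0)

lemma expneg_add: "expneg (x + y) = expneg x * expneg y"
  by (cases x; cases y) (auto simp: expneg_def exp_add[symmetric] enn2real_plus ennreal_plus[symmetric] simp del: ennreal_plus)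

lemma expneg_neglog: "0 \<le> v \<Longrightarrow> v \<le> 1 \<Longrightarrow> expneg (neglog v) = v"
  by (auto simp: expneg_def neglog_def)

lemma continuous_on_expneg: "continuous_on UNIV expneg"
proof -
  have "(expneg \<longlongrightarrow> expneg y) (at y)" for y
  proof (cases "y = \<top>")
    case False
    then have "((\<lambda>y. exp (- enn2real y)) \<longlongrightarrow> exp (- enn2real y)) (at y)"
      by (intro tendsto_intros) (auto simp: less_top intro: tendsto_ident_at)
    moreover have "\<forall>\<^sub>F z in at y. z < \<top>"
      using False by (intro order_tendstoD[OF tendsto_ident_at]) (simp add: less_top)
    ultimately show ?thesis
      using False by (intro Lim_transform_eventually[where f="\<lambda>y. exp (- enn2real y)" and g=expneg]) (auto simp: expneg_def elim: eventually_mono)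
  next
    case True
    show ?thesis
    proof (rule order_tendstoI)
      fix a assume "expneg y < a"
      then have a: "0 < a" by (simp add: True)
      have "\<forall>\<^sub>F z in at y. ennreal (max 0 (- ln a)) < z"
        unfolding True by (intro order_tendstoD[OF tendsto_ident_at]) auto
      then show "\<forall>\<^sub>F z in at y. expneg z < a"
      proof eventually_elim
        case (elim z)
        show ?case
        proof (cases z)
          case (real r)
          have "- ln a < r"
          proof (rule ccontr)
            assume "\<not> - ln a < r"
            then have "ennreal r \<le> ennreal (max 0 (- ln a))" by (intro ennreal_leI) simp
            with elim real show False by simp
          qed
          then have "- r < ln a" by simp
          then have "exp (- r) < exp (ln a)" by (rule exp_less_mono)
          then show ?thesis using real a by (simp add: expneg_def)
        qed (use a in simp)
      qed
    next
      fix a assume "a < expneg y"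
      then show "\<forall>\<^sub>F z in at y. a < expneg z"
        by (intro always_eventually allI less_le_trans[OF _ expneg_nonneg]) (simp add: True)
    qed
  qed
  then show ?thesis by (simp add: continuous_on_def)
qed

lemma borel_measurable_expneg [measurable]: "expneg \<in> borel_measurable borel"
  by (rule borel_measurable_continuous_onI[OF continuous_on_expneg])

lemma continuous_on_neglog: "continuous_on UNIV neglog"
proof -
  have "(neglog \<longlongrightarrow> neglog v) (at v)" for v
  proof (cases "0 < v")
    case True
    then have "((\<lambda>v. ennreal (- ln v)) \<longlongrightarrow> ennreal (- ln v)) (at v)"
      by (intro tendsto_intros) auto
    moreover have "\<forall>\<^sub>F z in at v. 0 < z"
      using True by (intro order_tendstoD[OF tendsto_ident_at])
    ultimately show ?thesis
      using True by (intro Lim_transform_eventually[where f="\<lambda>v. ennreal (- ln v)" and g=neglog]) (auto simp: neglog_def elim: eventually_mono)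
  next
    case False
    show ?thesis
    proof (rule order_tendstoI)
      fix a assume "a < neglog v"
      then have "a < \<top>" using False by (simp add: neglog_def)
      then obtain r where r: "a = ennreal r" "0 \<le> r" by (cases a) auto
      have "\<forall>\<^sub>F z in at v. z < exp (- r)"
        using False by (intro order_tendstoD[OF tendsto_ident_at]) (smt (verit) exp_gt_zero)
      then show "\<forall>\<^sub>F z in at v. a < neglog z"
      proof eventually_elim
        case (elim z)
        show ?case
        proof (cases "z \<le> 0")
          case True
          then show ?thesis by (simp add: neglog_def r)
        next
          case False
          then have "ln z < - r" using elim by (metis exp_less_cancel_iff exp_ln not_le)
          then show ?thesis using False r by (simp add: neglog_def ennreal_less_iff)
        qed
      qed
    next
      fix a assume "neglog v < a"
      then show "\<forall>\<^sub>F z in at v. neglog z < a" using False by (simp add: neglog_def)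
    qed
  qed
  then show ?thesis by (simp add: continuous_on_def)
qed

lemma borel_measurable_neglog [measurable]: "neglog \<in> borel_measurable borel"
  by (rule borel_measurable_continuous_onI[OF continuous_on_neglog])

text \<open>The Markov part of the assumptions: it carries the finite-dimensional laws, their
  martingale estimates, and the link between the Markov property and cylinder expectations.
  Convolution and continuity enter in \<open>branching_family\<close>.\<close>

locale kernel_family =
  fixes k :: "real \<Rightarrow> real \<Rightarrow> ennreal \<Rightarrow> ennreal measure"
  assumes k_prob_algebra: "0 \<le> s \<Longrightarrow> s \<le> t \<Longrightarrow> k s t \<in> borel \<rightarrow>\<^sub>M prob_algebra borel"
    and k_refl: "0 \<le> s \<Longrightarrow> k s s x = return borel x"
    and k_comp: "0 \<le> s \<Longrightarrow> s \<le> t \<Longrightarrow> t \<le> u \<Longrightarrow> kernel_comp (k s t) (k t u) = k s u"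
begin

lemma k_subprob_algebra [measurable (raw)]:
  "0 \<le> s \<Longrightarrow> s \<le> t \<Longrightarrow> k s t \<in> borel \<rightarrow>\<^sub>M subprob_algebra borel"
  using k_prob_algebra by (rule measurable_prob_algebraD)

lemma k_in_space: "0 \<le> s \<Longrightarrow> s \<le> t \<Longrightarrow> k s t x \<in> space (prob_algebra borel)"
  using measurable_space[OF k_prob_algebra] by simp

lemma prob_space_k: "0 \<le> s \<Longrightarrow> s \<le> t \<Longrightarrow> prob_space (k s t x)"
  using k_in_space by (simp add: space_prob_algebra)

lemma sets_k: "0 \<le> s \<Longrightarrow> s \<le> t \<Longrightarrow> sets (k s t x) = sets borel"
  using k_in_space by (simp add: space_prob_algebra)

lemma measurable_k: "0 \<le> s \<Longrightarrow> s \<le> t \<Longrightarrow> measurable (k s t x) M = measurable borel M"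
  by (rule measurable_cong_sets[OF sets_k refl])

text \<open>\<open>kernel_comp\<close> is built with \<open>measure_of\<close>; its set function is
  that of the Giry bind, so the integration rules for \<open>bind\<close> become available.\<close>

lemma k_eq_bind:
  assumes "0 \<le> s" "s \<le> t" "t \<le> u"
  shows "k s u x = k s t x \<bind> k t u"
proof -
  have 1: "k s t x \<in> space (prob_algebra borel)" "k t u \<in> borel \<rightarrow>\<^sub>M prob_algebra borel"
    using assms k_in_space k_prob_algebra by auto
  have sets: "sets (k s t x \<bind> k t u) = sets borel" 
    using sets_bind'[OF 1] .
  then have sp: "space (k s t x \<bind> k t u) = UNIV"
    using sets_eq_imp_space_eq by fastforce
  have "k s u x = measure_of UNIV (sets borel) (\<lambda>B. \<integral>\<^sup>+ y. emeasure (k t u y) B \<partial>(k s t x))"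
    using k_comp[OF assms] by (auto simp: kernel_comp_def fun_eq_iff)
  also have "\<dots> = measure_of UNIV (sets borel) (emeasure (k s t x \<bind> k t u))"
    by (rule measure_of_eq)
       (auto simp: emeasure_bind_prob_algebra[OF 1] sets.sigma_sets_eq[of borel, simplified])
  also have "\<dots> = k s t x \<bind> k t u"
    using measure_of_of_measure[of "k s t x \<bind> k t u"] by (simp add: sets sp)
  finally show ?thesis .
qed

lemma nn_integral_k_comp:
  assumes "0 \<le> s" "s \<le> t" "t \<le> u" and f: "f \<in> borel_measurable borel"
  shows "(\<integral>\<^sup>+ z. f z \<partial>k s u x) = (\<integral>\<^sup>+ y. \<integral>\<^sup>+ z. f z \<partial>k t u y \<partial>k s t x)"
  using assms by (subst k_eq_bind[of s t u])
    (auto intro!: nn_integral_bind[OF f] simp: measurable_k k_subprob_algebra)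

lemma borel_measurable_nn_integral_k:
  assumes "0 \<le> s" "s \<le> t" "f \<in> borel_measurable borel"
  shows "(\<lambda>x. \<integral>\<^sup>+ y. f y \<partial>k s t x) \<in> borel_measurable borel"
  using assms by (intro measurable_compose[OF k_subprob_algebra nn_integral_measurable_subprob_algebra])

text \<open>The expectation of the product of \<open>\<phi> r (X r)\<close> over the listed times,
  for a process at \<open>y\<close> at time \<open>t\<close>. Factors are indexed by time rather
  than by position, so that they can also be multiplied over finite sets of times.\<close>

fun cyl :: "(real \<Rightarrow> ennreal \<Rightarrow> ennreal) \<Rightarrow> real \<Rightarrow> ennreal \<Rightarrow> real list \<Rightarrow> ennreal" where
  "cyl \<phi> t y [] = 1"
| "cyl \<phi> t y (r # ts) = (\<integral>\<^sup>+ z. \<phi> r z * cyl \<phi> r z ts \<partial>k t r y)"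

lemma borel_measurable_cyl:
  assumes "\<And>r. \<phi> r \<in> borel_measurable borel" "0 \<le> t" "sorted (t # ts)"
  shows "(\<lambda>y. cyl \<phi> t y ts) \<in> borel_measurable borel"
  using assms(2,3)
proof (induction ts arbitrary: t)
  case (Cons r ts)
  then have "(\<lambda>y. cyl \<phi> r y ts) \<in> borel_measurable borel" by auto
  then show ?case using Cons.prems assms(1)
    by (auto intro!: borel_measurable_nn_integral_k borel_measurable_times)
qed simp

lemma nn_integral_cyl:
  assumes \<phi>: "\<And>r. \<phi> r \<in> borel_measurable borel" and "0 \<le> t" "t \<le> r" "sorted (r # ts)"
  shows "(\<integral>\<^sup>+ z. cyl \<phi> r z ts \<partial>k t r y) = cyl \<phi> t y ts"
proof (cases ts)
  case Nil
  then show ?thesis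
    using prob_space.emeasure_space_1[OF prob_space_k[of t r y]] assms by simp
next
  case (Cons u us)
  have "(\<lambda>y. cyl \<phi> u y us) \<in> borel_measurable borel"
    using assms Cons by (intro borel_measurable_cyl \<phi>) auto
  then have "(\<lambda>y. \<phi> u y * cyl \<phi> u y us) \<in> borel_measurable borel"
    using \<phi> by measurable
  then show ?thesis
    using assms unfolding Cons by (simp add: nn_integral_k_comp[of t r u])
qed

text \<open>A time with factor 1 is integrated out by Chapman-Kolmogorov
  (\<open>nn_integral_cyl\<close>). This is what makes the finite-dimensional laws
  consistent.\<close>

lemma cyl_filter:
  assumes \<phi>: "\<And>r. \<phi> r \<in> borel_measurable borel" and "0 \<le> t" "sorted (t # ts)"
    and "\<And>r y. r \<in> set ts \<Longrightarrow> \<not> P r \<Longrightarrow> \<phi> r y = 1"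
  shows "cyl \<phi> t y ts = cyl \<phi> t y (filter P ts)"
  using assms(2-)
proof (induction ts arbitrary: t y)
  case (Cons r ts)
  have IH: "cyl \<phi> r z ts = cyl \<phi> r z (filter P ts)" for z
    using Cons.prems by (intro Cons.IH) auto
  show ?case
  proof (cases "P r")
    case True
    then show ?thesis by (simp add: IH)
  next
    case False
    have "cyl \<phi> t y (r # ts) = (\<integral>\<^sup>+ z. cyl \<phi> r z (filter P ts) \<partial>k t r y)"
      using False Cons.prems by (simp add: IH)
    also have "\<dots> = cyl \<phi> t y (filter P ts)"
      using Cons.prems by (intro nn_integral_cyl \<phi>) (auto intro: sorted_wrt_filter)
    finally show ?thesis using False by simp
  qed
qed simp

text \<open>The Markov property for cylinders: integrating out the last time \<open>u\<close> leaves
  a function of the value at \<open>r\<close>, which is merged into the factor at \<open>r\<close>.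
  It serves both to derive the Markov property and, conversely, to recover cylinder expectations
  from it.\<close>

lemma cyl_append:
  assumes "r \<notin> set ts" "u \<notin> set ts"
  shows "cyl \<phi> t y (ts @ [r, u]) = cyl (\<phi>(r := \<lambda>z. \<phi> r z * (\<integral>\<^sup>+ w. \<phi> u w \<partial>k r u z))) t y (ts @ [r])"
  using assms by (induction ts arbitrary: t y) auto

section \<open>Finite-dimensional laws and the extension theorem\<close>

abbreviation "path_space J \<equiv> PiM J (\<lambda>_::real. borel :: ennreal measure)"

text \<open>Values are stored in a function on the set of times, not in a list, because projective
  families live on \<open>PiM\<close>. The empty product has \<open>\<lambda>_. undefined\<close> as
  its only point.\<close>

fun path_law :: "real \<Rightarrow> ennreal \<Rightarrow> real list \<Rightarrow> (real \<Rightarrow> ennreal) measure" where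
  "path_law t y [] = return (path_space {}) (\<lambda>_. undefined)"
| "path_law t y (r # ts) =
     k t r y \<bind> (\<lambda>z. distr (path_law r z ts) (path_space (set (r # ts))) (\<lambda>\<omega>. fun_upd \<omega> r z))"

lemma measurable_path_update [measurable]:
  "(\<lambda>(z, \<omega>). fun_upd \<omega> r z) \<in> borel \<Otimes>\<^sub>M path_space J \<rightarrow>\<^sub>M path_space (insert r J)"
  unfolding case_prod_beta'
  by (rule measurable_fun_upd[where J=J]) auto

lemma path_law_prob_algebra:
  assumes "0 \<le> t" "sorted (t # ts)"
  shows "(\<lambda>y. path_law t y ts) \<in> borel \<rightarrow>\<^sub>M prob_algebra (path_space (set ts))"
  using assms
proof (induction ts arbitrary: t)
  case Nil
  show ?case by (auto intro!: measurable_const measurable_space[OF measurable_return_prob_space] simp: space_PiM)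
next
  case (Cons r ts)
  have "(\<lambda>z. distr (path_law r z ts) (path_space (set (r # ts))) (\<lambda>\<omega>. fun_upd \<omega> r z))
          \<in> borel \<rightarrow>\<^sub>M prob_algebra (path_space (set (r # ts)))"
    using Cons by (intro measurable_distr_prob_space2[where M="path_space (set ts)"]) auto
  moreover have "k t r \<in> borel \<rightarrow>\<^sub>M prob_algebra borel"
    using Cons.prems by (intro k_prob_algebra) auto
  ultimately show ?case
    unfolding path_law.simps by (intro measurable_bind_prob_space)
qed

lemma path_law_in_space:
  "0 \<le> t \<Longrightarrow> sorted (t # ts) \<Longrightarrow> path_law t y ts \<in> space (prob_algebra (path_space (set ts)))"
  using measurable_space[OF path_law_prob_algebra] by simp

lemma sets_path_law: "0 \<le> t \<Longrightarrow> sorted (t # ts) \<Longrightarrow> sets (path_law t y ts) = sets (path_space (set ts))"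
  and prob_space_path_law: "0 \<le> t \<Longrightarrow> sorted (t # ts) \<Longrightarrow> prob_space (path_law t y ts)"
  using path_law_in_space[of t ts y] by (simp_all add: space_prob_algebra)

lemma nn_integral_path_law_Cons:
  assumes "0 \<le> t" "sorted (t # r # ts)" and F: "F \<in> borel_measurable (path_space (set (r # ts)))"
  shows "(\<integral>\<^sup>+ \<omega>. F \<omega> \<partial>path_law t y (r # ts)) = (\<integral>\<^sup>+ z. \<integral>\<^sup>+ \<omega>. F (fun_upd \<omega> r z) \<partial>path_law r z ts \<partial>k t r y)"
proof -
  have 1: "(\<lambda>z. distr (path_law r z ts) (path_space (set (r # ts))) (\<lambda>\<omega>. fun_upd \<omega> r z))
          \<in> borel \<rightarrow>\<^sub>M prob_algebra (path_space (set (r # ts)))"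
    using assms path_law_prob_algebra[of r ts]
    by (intro measurable_distr_prob_space2[where M="path_space (set ts)"]) auto
  have 2: "(\<lambda>\<omega>. fun_upd \<omega> r z) \<in> path_space (set ts) \<rightarrow>\<^sub>M path_space (set (r # ts))" for z
    using measurable_compose[OF measurable_Pair1' measurable_path_update[of r "set ts"], of z] by simp
  have "(\<integral>\<^sup>+ \<omega>. F \<omega> \<partial>path_law t y (r # ts)) =
     (\<integral>\<^sup>+ z. \<integral>\<^sup>+ \<omega>. F \<omega> \<partial>distr (path_law r z ts) (path_space (set (r # ts))) (\<lambda>\<omega>. fun_upd \<omega> r z) \<partial>k t r y)"
    unfolding path_law.simps using assms
    by (intro nn_integral_bind[OF F]) (auto simp: measurable_k intro!: measurable_prob_algebraD 1[simplified])
  also have "\<dots> = (\<integral>\<^sup>+ z. \<integral>\<^sup>+ \<omega>. F (fun_upd \<omega> r z) \<partial>path_law r z ts \<partial>k t r y)"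
    using 2 F assms by (intro nn_integral_cong nn_integral_distr)
      (auto simp: measurable_cong_sets[OF sets_path_law refl])
  finally show ?thesis .
qed

text \<open>Peels off the first time. Distinctness matters: at a repeated time
  \<open>fun_upd\<close> would overwrite the value drawn later in the list.\<close>

lemma nn_integral_path_law_prod:
  assumes \<phi>: "\<And>r. \<phi> r \<in> borel_measurable borel" and "0 \<le> t" "sorted (t # ts)" "distinct ts"
  shows "(\<integral>\<^sup>+ \<omega>. (\<Prod>r\<in>set ts. \<phi> r (\<omega> r)) \<partial>path_law t y ts) = cyl \<phi> t y ts"
  using assms(2-)
proof (induction ts arbitrary: t y)
  case Nil
  interpret prob_space "path_law t y []" using Nil by (intro prob_space_path_law) auto
  show ?case using emeasure_space_1 by simp
next
  case (Cons r ts)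
  have [measurable]: "(\<lambda>\<omega>. \<Prod>r\<in>J. \<phi> r (\<omega> r)) \<in> borel_measurable (path_space J)" for J
    by (intro borel_measurable_prod_ennreal measurable_compose[OF measurable_component_singleton[where M="\<lambda>_. borel"]] \<phi>)
  have eq: "(\<Prod>q\<in>set (r # ts). \<phi> q (fun_upd \<omega> r z q)) = \<phi> r z * (\<Prod>q\<in>set ts. \<phi> q (\<omega> q))" for \<omega> z
    using Cons.prems by (auto intro!: arg_cong2[where f="(*)"] prod.cong)
  have "(\<integral>\<^sup>+ \<omega>. (\<Prod>q\<in>set (r # ts). \<phi> q (\<omega> q)) \<partial>path_law t y (r # ts)) =
     (\<integral>\<^sup>+ z. \<integral>\<^sup>+ \<omega>. \<phi> r z * (\<Prod>q\<in>set ts. \<phi> q (\<omega> q)) \<partial>path_law r z ts \<partial>k t r y)"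
    using Cons.prems by (subst nn_integral_path_law_Cons) (simp_all only: eq, measurable)
  also have "\<dots> = (\<integral>\<^sup>+ z. \<phi> r z * cyl \<phi> r z ts \<partial>k t r y)"
  proof (intro nn_integral_cong)
    fix z
    have "(\<integral>\<^sup>+ \<omega>. \<phi> r z * (\<Prod>q\<in>set ts. \<phi> q (\<omega> q)) \<partial>path_law r z ts)
       = \<phi> r z * (\<integral>\<^sup>+ \<omega>. (\<Prod>q\<in>set ts. \<phi> q (\<omega> q)) \<partial>path_law r z ts)"
      using Cons.prems by (intro nn_integral_cmult) (auto simp: measurable_cong_sets[OF sets_path_law refl])
    then show "(\<integral>\<^sup>+ \<omega>. \<phi> r z * (\<Prod>q\<in>set ts. \<phi> q (\<omega> q)) \<partial>path_law r z ts) = \<phi> r z * cyl \<phi> r z ts"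
      using Cons by auto
  qed
  finally show ?case by simp
qed

lemma emeasure_path_law_box:
  assumes A: "\<And>r. A r \<in> sets borel" and "0 \<le> t" "sorted (t # ts)" "distinct ts"
  shows "emeasure (path_law t y ts) (Pi\<^sub>E (set ts) A) = cyl (\<lambda>r. indicator (A r)) t y ts"
proof -
  have sp: "space (path_law t y ts) = space (path_space (set ts))"
    using assms by (intro sets_eq_imp_space_eq sets_path_law)
  have "emeasure (path_law t y ts) (Pi\<^sub>E (set ts) A) = (\<integral>\<^sup>+ \<omega>. indicator (Pi\<^sub>E (set ts) A) \<omega> \<partial>path_law t y ts)"
    using assms by (intro nn_integral_indicator[symmetric]) (auto simp: sets_path_law intro!: sets_PiM_I_finite)
  also have "\<dots> = (\<integral>\<^sup>+ \<omega>. (\<Prod>r\<in>set ts. indicator (A r) (\<omega> r)) \<partial>path_law t y ts)"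
  proof (intro nn_integral_cong)
    fix \<omega> assume "\<omega> \<in> space (path_law t y ts)"
    then have "\<omega> \<in> extensional (set ts)" by (simp add: sp space_PiM PiE_def)
    then have "\<omega> \<in> Pi\<^sub>E (set ts) A \<longleftrightarrow> (\<forall>r\<in>set ts. \<omega> r \<in> A r)" by (simp add: PiE_iff)
    then show "indicator (Pi\<^sub>E (set ts) A) \<omega> = (\<Prod>r\<in>set ts. indicator (A r) (\<omega> r) :: ennreal)"
      by (cases "\<forall>r\<in>set ts. \<omega> r \<in> A r") (simp, simp add: prod_zero_iff, metis indicator_simps(2))
  qed
  also have "\<dots> = cyl (\<lambda>r. indicator (A r)) t y ts"
    using assms by (intro nn_integral_path_law_prod) auto
  finally show ?thesis .
qed

text \<open>Boxes determine a law on a finite product. A box over \<open>J\<close> pulls back to a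
  box over \<open>H\<close> with \<open>UNIV\<close> at the new times, and \<open>cyl_filter\<close>
  drops those times.\<close>

lemma path_law_restrict:
  assumes s: "0 \<le> s" and J: "J \<subseteq> H" "finite H" "H \<subseteq> {s..}"
  shows "path_law s x (sorted_list_of_set J) =
    distr (path_law s x (sorted_list_of_set H)) (path_space J) (\<lambda>\<omega>. restrict \<omega> J)"
proof -
  have fin: "finite J" using J finite_subset by auto
  have so: "sorted (s # sorted_list_of_set H)" "sorted (s # sorted_list_of_set J)"
    using J fin by auto
  note sH = sets_path_law[OF s so(1)] and sJ = sets_path_law[OF s so(2)]
  have [simp]: "set (sorted_list_of_set H) = H" "set (sorted_list_of_set J) = J"
    using J fin by auto
  have rm: "(\<lambda>\<omega>. restrict \<omega> J) \<in> path_law s x (sorted_list_of_set H) \<rightarrow>\<^sub>M path_space J"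
    using measurable_restrict_subset[OF J(1)] by (simp add: measurable_cong_sets[OF sH refl])
  have filt: "filter (\<lambda>r. r \<in> J) (sorted_list_of_set H) = sorted_list_of_set J"
    using J fin by (intro sorted_distinct_set_unique) (auto intro: sorted_wrt_filter)
  show ?thesis
  proof (rule measure_eqI_PiM_finite[OF fin])
    show "sets (path_law s x (sorted_list_of_set J)) = sets (path_space J)" using sJ by simp
    show "range (\<lambda>_::nat. space (path_space J)) \<subseteq> prod_algebra J (\<lambda>_. borel)"
      by (auto simp: space_PiM prod_algebra_eq_finite[OF fin] intro!: exI[of _ "\<lambda>_. UNIV"])
    show "(\<Union>i::nat. space (path_space J)) = space (path_space J)" by simp
    interpret prob_space "path_law s x (sorted_list_of_set J)" using s so by (intro prob_space_path_law)
    show "emeasure (path_law s x (sorted_list_of_set J)) (space (path_space J)) \<noteq> \<infinity>" by simp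
    fix A :: "real \<Rightarrow> ennreal set" assume A: "\<And>i. i \<in> J \<Longrightarrow> A i \<in> sets borel"
    define B where "B r = (if r \<in> J then A r else UNIV)" for r
    have B: "B r \<in> sets borel" for r using A by (auto simp: B_def)
    have "emeasure (distr (path_law s x (sorted_list_of_set H)) (path_space J) (\<lambda>\<omega>. restrict \<omega> J)) (Pi\<^sub>E J A)
       = emeasure (path_law s x (sorted_list_of_set H))
          ((\<lambda>\<omega>. restrict \<omega> J) -` (Pi\<^sub>E J A) \<inter> space (path_law s x (sorted_list_of_set H)))"
      using A fin by (intro emeasure_distr rm sets_PiM_I_finite) auto
    also have "(\<lambda>\<omega>. restrict \<omega> J) -` (Pi\<^sub>E J A) \<inter> space (path_law s x (sorted_list_of_set H)) = Pi\<^sub>E H B"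
      using J by (auto simp: sets_eq_imp_space_eq[OF sH] space_PiM B_def PiE_iff subset_eq split: if_splits)
    also have "emeasure (path_law s x (sorted_list_of_set H)) (Pi\<^sub>E H B)
       = cyl (\<lambda>r. indicator (B r)) s x (sorted_list_of_set H)"
      using emeasure_path_law_box[OF B s so(1)] J by simp
    also have "\<dots> = cyl (\<lambda>r. indicator (B r)) s x (sorted_list_of_set J)"
      using s so B by (subst cyl_filter[where P="\<lambda>r. r \<in> J"]) (auto simp: filt B_def)
    also have "\<dots> = emeasure (path_law s x (sorted_list_of_set J)) (Pi\<^sub>E J B)"
      using emeasure_path_law_box[OF B s so(2)] fin by simp
    also have "Pi\<^sub>E J B = Pi\<^sub>E J A" by (auto simp: B_def PiE_iff)
    finally show "emeasure (path_law s x (sorted_list_of_set J)) (Pi\<^sub>E J A) =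
      emeasure (distr (path_law s x (sorted_list_of_set H)) (path_space J) (\<lambda>\<omega>. restrict \<omega> J)) (Pi\<^sub>E J A)" ..
  qed simp
qed

text \<open>
  The extension theorem needs a Polish state space, hence the detour through real-valued paths.
\<close>

lemma kolmogorov_process:
  assumes s: "0 \<le> s"
  obtains N :: "(real \<Rightarrow> real) measure" and X where
    "prob_space N" "\<And>t. s \<le> t \<Longrightarrow> X t \<in> borel_measurable N"
    "\<And>J. finite J \<Longrightarrow> J \<subseteq> {s..} \<Longrightarrow>
       distr N (path_space J) (\<lambda>\<omega>. \<lambda>j\<in>J. X j \<omega>) = path_law s x (sorted_list_of_set J)"
proof -
  let ?R = "\<lambda>J. PiM J (\<lambda>_::real. borel :: real measure)"
  define enc :: "real set \<Rightarrow> (real \<Rightarrow> ennreal) \<Rightarrow> real \<Rightarrow> real" where "enc J \<omega> = (\<lambda>j\<in>J. expneg (\<omega> j))" for J \<omega>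
  define dec :: "real set \<Rightarrow> (real \<Rightarrow> real) \<Rightarrow> real \<Rightarrow> ennreal" where "dec J \<omega> = (\<lambda>j\<in>J. neglog (\<omega> j))" for J \<omega>
  have enc [measurable]: "enc J \<in> path_space J \<rightarrow>\<^sub>M ?R J" for J
    unfolding enc_def by (intro measurable_restrict) measurable
  have dec [measurable]: "dec J \<in> ?R J \<rightarrow>\<^sub>M path_space J" for J
    unfolding dec_def by (intro measurable_restrict) measurable
  define P where "P J = distr (path_law s x (sorted_list_of_set J)) (?R J) (enc J)" for J
  have sets_law: "sets (path_law s x (sorted_list_of_set J)) = sets (path_space J)"
    and prob_law: "prob_space (path_law s x (sorted_list_of_set J))"
    if "finite J" "J \<subseteq> {s..}" for J
    using sets_path_law[of s "sorted_list_of_set J"] prob_space_path_law[of s "sorted_list_of_set J"] that s by auto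
  interpret polish_projective "{s..}" P
  proof (rule polish_projective.intro, rule projective_family.intro)
    show "prob_space (P J)" if "finite J" "J \<subseteq> {s..}" for J
      unfolding P_def using that
      by (intro prob_space.prob_space_distr prob_law) (simp_all add: measurable_cong_sets[OF sets_law refl])
    show "P J = distr (P H) (?R J) (\<lambda>f. restrict f J)" if "J \<subseteq> H" "finite H" "H \<subseteq> {s..}" for J H
    proof -
      have J: "finite J" "J \<subseteq> {s..}" using that finite_subset by auto
      have m: "(\<lambda>\<omega>. restrict \<omega> J) \<in> path_space H \<rightarrow>\<^sub>M path_space J" "(\<lambda>\<omega>. restrict \<omega> J) \<in> ?R H \<rightarrow>\<^sub>M ?R J"
        using that by (auto intro!: measurable_restrict_subset)
      have "P J = distr (path_law s x (sorted_list_of_set H)) (?R J) (enc J \<circ> (\<lambda>\<omega>. restrict \<omega> J))"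
        unfolding P_def path_law_restrict[OF s that] using that m
        by (intro distr_distr enc) (simp_all add: measurable_cong_sets[OF sets_law refl])
      also have "enc J \<circ> (\<lambda>\<omega>. restrict \<omega> J) = (\<lambda>f. restrict f J) \<circ> enc H"
        using that by (auto simp: enc_def fun_eq_iff)
      also have "distr (path_law s x (sorted_list_of_set H)) (?R J) ((\<lambda>f. restrict f J) \<circ> enc H)
          = distr (P H) (?R J) (\<lambda>f. restrict f J)"
        unfolding P_def using that m
        by (intro distr_distr[symmetric]) (simp_all add: measurable_cong_sets[OF sets_law refl])
      finally show ?thesis .
    qed
  qed
  show thesis
  proof (rule that)
    show "prob_space lim" by (rule P.prob_space_axioms)
    show "(\<lambda>\<omega>. neglog (\<omega> t)) \<in> borel_measurable lim" if "s \<le> t" for t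
      using that by (intro measurable_compose[OF _ borel_measurable_neglog])
        (simp add: measurable_cong_sets[OF sets_lim refl])
    fix J assume J: "finite J" "J \<subseteq> {s..}"
    have m: "(\<lambda>\<omega>. restrict \<omega> J) \<in> lim \<rightarrow>\<^sub>M ?R J"
      using measurable_restrict_subset[OF J(2)] by (simp add: measurable_cong_sets[OF sets_lim refl])
    have lim_J: "distr lim (?R J) (\<lambda>\<omega>. restrict \<omega> J) = P J"
    proof (rule measure_eqI)
      show "sets (distr lim (?R J) (\<lambda>\<omega>. restrict \<omega> J)) = sets (P J)" using J by (simp add: sets_P)
      fix A assume "A \<in> sets (distr lim (?R J) (\<lambda>\<omega>. restrict \<omega> J))"
      then have A: "A \<in> sets (?R J)" by simp
      show "emeasure (distr lim (?R J) (\<lambda>\<omega>. restrict \<omega> J)) A = emeasure (P J) A"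
        using emeasure_lim_emb[OF J(2,1) A] A
        by (simp add: emeasure_distr[OF m] prod_emb_def space_PiM vimage_def Int_def)
    qed
    have "distr lim (path_space J) (\<lambda>\<omega>. \<lambda>j\<in>J. neglog (\<omega> j)) = distr lim (path_space J) (dec J \<circ> (\<lambda>\<omega>. restrict \<omega> J))"
      by (intro arg_cong2[where f="distr lim"]) (auto simp: dec_def fun_eq_iff)
    also have "\<dots> = distr (P J) (path_space J) (dec J)"
      unfolding lim_J[symmetric] by (intro distr_distr[symmetric] dec m)
    also have "\<dots> = distr (path_law s x (sorted_list_of_set J)) (path_space J) (dec J \<circ> enc J)"
      unfolding P_def using J by (intro distr_distr dec) (simp_all add: measurable_cong_sets[OF sets_law refl])
    also have "\<dots> = distr (path_law s x (sorted_list_of_set J)) (path_space J) (\<lambda>\<omega>. \<omega>)"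
    proof (rule distr_cong)
      fix \<omega> assume "\<omega> \<in> space (path_law s x (sorted_list_of_set J))"
      then have "\<omega> \<in> extensional J"
        by (simp add: sets_eq_imp_space_eq[OF sets_law[OF J]] space_PiM PiE_def)
      then show "(dec J \<circ> enc J) \<omega> = \<omega>" by (auto simp: dec_def enc_def fun_eq_iff extensional_def)
    qed simp_all
    also have "\<dots> = path_law s x (sorted_list_of_set J)"
      by (rule distr_id2) (simp add: sets_law[OF J])
    finally show "distr lim (path_space J) (\<lambda>\<omega>. \<lambda>j\<in>J. neglog (\<omega> j)) = path_law s x (sorted_list_of_set J)" .
  qed
qed

end

section \<open>The cumulant of a branching kernel\<close>

text \<open>Cauchy's functional equation in multiplicative form. Since
  \<open>h (1/n) ^ n = h 1\<close>, the value \<open>h 1 = 0\<close> would make \<open>h\<close>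
  vanish at all \<open>1/n\<close>, against continuity and \<open>h 0 = 1\<close>. The formula then
  holds at nonnegative rationals and extends by continuity.\<close>

lemma continuous_exponential_equation:
  fixes h :: "real \<Rightarrow> real"
  assumes cont: "continuous_on {0..} h" and h0: "h 0 = 1" and nonneg: "\<And>a. 0 \<le> a \<Longrightarrow> 0 \<le> h a"
    and add: "\<And>a b. 0 \<le> a \<Longrightarrow> 0 \<le> b \<Longrightarrow> h (a + b) = h a * h b"
  shows "0 < h 1" and "0 \<le> a \<Longrightarrow> h a = h 1 powr a"
proof -
  have mult: "h (real n * a) = h a ^ n" if "0 \<le> a" for n a
    using that by (induction n) (auto simp: h0 distrib_right add)
  have lim: "(\<lambda>n. h (X n)) \<longlonglongrightarrow> h a" if "X \<longlonglongrightarrow> a" "0 \<le> a" "\<And>n. 0 \<le> X n" for X a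
    using continuous_on_tendsto_compose[OF cont that(1)] that by auto
  have nth: "h (1 / real (Suc n)) ^ Suc n = h 1" for n
    using mult[of "1 / real (Suc n)" "Suc n"] by simp
  show pos: "0 < h 1"
  proof (rule ccontr)
    assume "\<not> 0 < h 1"
    then have "h 1 = 0" using nonneg[of 1] by simp
    then have "h (1 / real (Suc n)) = 0" for n using nth[of n] by auto
    moreover have "(\<lambda>n. h (1 / real (Suc n))) \<longlonglongrightarrow> h 0"
      by (rule lim[OF LIMSEQ_Suc[OF lim_1_over_n]]) auto
    ultimately show False using h0 by (simp add: LIMSEQ_const_iff)
  qed
  assume a: "0 \<le> a"
  have frac: "h (real m / real (Suc n)) = h 1 powr (real m / real (Suc n))" for m n
  proof -
    have "h (1 / real (Suc n)) = h 1 powr (1 / real (Suc n))"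
      using nth[of n] nonneg[of "1 / real (Suc n)"] pos real_root_power_cancel[of "Suc n" "h (1 / real (Suc n))"]
        root_powr_inverse[of "Suc n" "h 1"] by simp
    moreover have "h (real m / real (Suc n)) = h (1 / real (Suc n)) ^ m"
      using mult[of "1 / real (Suc n)" m] by simp
    ultimately show ?thesis
      using pos by (simp add: powr_powr powr_realpow[symmetric] del: of_nat_Suc)
  qed
  \<comment> \<open>Nonnegative rationals approaching \<open>a\<close> from below, at distance at
    most \<open>1 / Suc n\<close>.\<close>
  define X where "X n = real (nat \<lfloor>a * real (Suc n)\<rfloor>) / real (Suc n)" for n
  have X: "X \<longlonglongrightarrow> a"
  proof (rule tendsto_sandwich)
    show "\<forall>\<^sub>F n in sequentially. a - 1 / real (Suc n) \<le> X n"
    proof (intro always_eventually allI)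
      fix n
      have "a * real (Suc n) - 1 \<le> real (nat \<lfloor>a * real (Suc n)\<rfloor>)" by linarith
      then have "(a * real (Suc n) - 1) / real (Suc n) \<le> X n"
        unfolding X_def by (intro divide_right_mono) simp_all
      then show "a - 1 / real (Suc n) \<le> X n"
        by (simp add: diff_divide_distrib del: of_nat_Suc)
    qed
    show "\<forall>\<^sub>F n in sequentially. X n \<le> a"
    proof (intro always_eventually allI)
      fix n
      have "0 \<le> a * real (Suc n)" using a by simp
      then have "real (nat \<lfloor>a * real (Suc n)\<rfloor>) \<le> a * real (Suc n)" by linarith
      then show "X n \<le> a" unfolding X_def by (simp add: field_simps del: of_nat_Suc)
    qed
    show "(\<lambda>n. a - 1 / real (Suc n)) \<longlonglongrightarrow> a"
      using tendsto_diff[OF tendsto_const LIMSEQ_Suc[OF lim_1_over_n], of a] by simp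
  qed simp
  have "(\<lambda>n. h (X n)) \<longlonglongrightarrow> h a" by (rule lim[OF X a]) (simp add: X_def)
  moreover have "(\<lambda>n. h 1 powr X n) \<longlonglongrightarrow> h 1 powr a"
    using pos by (intro tendsto_intros X) auto
  moreover have "h (X n) = h 1 powr X n" for n unfolding X_def by (rule frac)
  ultimately show "h a = h 1 powr a" using LIMSEQ_unique by auto
qed

context kernel_family
begin

lemma integrable_k:
  fixes f :: "ennreal \<Rightarrow> real"
  assumes "0 \<le> s" "s \<le> t" "f \<in> borel_measurable borel" "\<And>y. \<bar>f y\<bar> \<le> B"
  shows "integrable (k s t x) f"
proof -
  interpret prob_space "k s t x" using assms by (intro prob_space_k)
  show ?thesis using assms by (intro integrable_const_bound[where B=B]) (auto simp: measurable_k)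
qed

lemma integral_k_bound:
  fixes f :: "ennreal \<Rightarrow> real"
  assumes "0 \<le> s" "s \<le> t" "f \<in> borel_measurable borel" "\<And>y. \<bar>f y\<bar> \<le> B"
  shows "\<bar>\<integral>y. f y \<partial>k s t x\<bar> \<le> B"
proof -
  interpret prob_space "k s t x" using assms by (intro prob_space_k)
  have "0 \<le> B" using abs_ge_zero assms(4) order_trans by blast
  have "\<bar>\<integral>y. f y \<partial>k s t x\<bar> \<le> (\<integral>y. \<bar>f y\<bar> \<partial>k s t x)" by (rule integral_abs_bound)
  also have "\<dots> \<le> (\<integral>y. B \<partial>k s t x)"
    using assms by (intro integral_mono integrable_abs integrable_k[where B=B]) (simp_all add: \<open>0 \<le> B\<close>)
  finally show ?thesis by (simp add: prob_space)
qed

lemma borel_measurable_integral_k: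
  fixes f :: "ennreal \<Rightarrow> real"
  assumes "0 \<le> s" "s \<le> t" "f \<in> borel_measurable borel"
  shows "(\<lambda>x. \<integral>y. f y \<partial>k s t x) \<in> borel_measurable borel"
  using assms by (intro measurable_compose[OF k_subprob_algebra integral_measurable_subprob_algebra])

lemma integral_k_comp:
  fixes f :: "ennreal \<Rightarrow> real"
  assumes "0 \<le> s" "s \<le> t" "t \<le> u" and f: "f \<in> borel_measurable borel" "\<And>y. \<bar>f y\<bar> \<le> B"
  shows "(\<integral>z. f z \<partial>k s u x) = (\<integral>y. \<integral>z. f z \<partial>k t u y \<partial>k s t x)"
  unfolding k_eq_bind[OF assms(1-3)]
proof (rule integral_bind[where K=borel and B=B and B'=1])
  interpret prob_space "k s t x" using assms by (intro prob_space_k)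
  show "finite_measure (k s t x)" by unfold_locales
  show "k t u \<in> k s t x \<rightarrow>\<^sub>M subprob_algebra borel"
    using assms by (simp add: measurable_k k_subprob_algebra)
  show "AE y in k s t x. emeasure (k t u y) (space (k t u y)) \<le> ennreal 1"
    using prob_space.emeasure_space_1[OF prob_space_k[of t u]] assms by auto
qed (use f in auto)

lemma nn_integral_k_eq_integral:
  fixes f :: "ennreal \<Rightarrow> real"
  assumes "0 \<le> s" "s \<le> t" "f \<in> borel_measurable borel" "\<And>y. 0 \<le> f y" "\<And>y. f y \<le> B"
  shows "(\<integral>\<^sup>+y. ennreal (f y) \<partial>k s t x) = ennreal (\<integral>y. f y \<partial>k s t x)"
  using assms by (intro nn_integral_eq_integral integrable_k[where B=B]) auto

lemma integral_k_refl:
  fixes f :: "ennreal \<Rightarrow> real"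
  assumes "0 \<le> s" "f \<in> borel_measurable borel"
  shows "(\<integral>y. f y \<partial>k s s x) = f x"
  using assms by (simp add: k_refl integral_return)

end

locale branching_family =
  fixes k :: "real \<Rightarrow> real \<Rightarrow> ennreal \<Rightarrow> ennreal measure"
  assumes branching: "branching_kernels k"

sublocale branching_family \<subseteq> kernel_family k
  by unfold_locales (use branching in \<open>auto simp: branching_kernels_def transition_kernel_def Delta_def\<close>)

context branching_family
begin

lemma k_conv: "0 \<le> s \<Longrightarrow> s \<le> t \<Longrightarrow> x \<noteq> \<top> \<Longrightarrow> y \<noteq> \<top> \<Longrightarrow> conv_ennreal (k s t x) (k s t y) = k s t (x + y)"
  using branching unfolding branching_kernels_def Delta_def by auto

lemma k_zero: "0 \<le> s \<Longrightarrow> s \<le> t \<Longrightarrow> k s t 0 = return borel 0"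
  and k_top: "0 \<le> s \<Longrightarrow> s \<le> t \<Longrightarrow> k s t \<top> = return borel \<top>"
  using branching by (auto simp: branching_kernels_def Delta_def)

text \<open>K3 in a form that can be composed with curves of parameters; the third curve must avoid
  \<top>, where K3 gives nothing.\<close>

lemma continuous_on_integral_k:
  fixes f :: "ennreal \<Rightarrow> real"
  assumes f: "continuous_on UNIV f"
    and g: "continuous_on S g\<^sub>1" "continuous_on S g\<^sub>2" "continuous_on S g\<^sub>3"
    and "\<And>a. a \<in> S \<Longrightarrow> 0 \<le> g\<^sub>1 a \<and> g\<^sub>1 a \<le> g\<^sub>2 a \<and> g\<^sub>3 a \<noteq> \<top>"
  shows "continuous_on S (\<lambda>a. \<integral>y. f y \<partial>k (g\<^sub>1 a) (g\<^sub>2 a) (g\<^sub>3 a))"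
proof -
  have "continuous_on {(s,t,x). (s,t) \<in> Delta \<and> x \<noteq> \<top>} (\<lambda>(s,t,x). \<integral> y. f y \<partial>(k s t x))"
    using branching f by (auto simp: branching_kernels_def weakly_continuous_kernels_def)
  from continuous_on_compose2[OF this, of S "\<lambda>a. (g\<^sub>1 a, g\<^sub>2 a, g\<^sub>3 a)"] show ?thesis
    using assms by (force intro!: continuous_intros simp: Delta_def)
qed

definition laplace :: "real \<Rightarrow> real \<Rightarrow> ennreal \<Rightarrow> real" where
  "laplace s t x = (\<integral>y. expneg y \<partial>k s t x)"

text \<open>The \<open>u\<close> of the overview: the log-Laplace exponent at argument 1 of the law
  started from 1.\<close>

definition cumulant :: "real \<Rightarrow> real \<Rightarrow> real" where
  "cumulant s t = - ln (laplace s t 1)"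

lemma laplace_nonneg: "0 \<le> laplace s t x"
  unfolding laplace_def by (intro integral_nonneg_AE) auto

lemma laplace_le_1: "0 \<le> s \<Longrightarrow> s \<le> t \<Longrightarrow> laplace s t x \<le> 1"
  unfolding laplace_def using integral_k_bound[of s t expneg 1 x] by auto

text \<open>K4 becomes multiplicativity because \<open>expneg\<close> turns sums into products, also
  at \<top>; Tonelli does the rest.\<close>

lemma laplace_add:
  assumes "0 \<le> s" "s \<le> t" "x \<noteq> \<top>" "y \<noteq> \<top>"
  shows "laplace s t (x + y) = laplace s t x * laplace s t y"
proof -
  interpret X: prob_space "k s t x" using assms by (intro prob_space_k)
  interpret Y: prob_space "k s t y" using assms by (intro prob_space_k)
  have pair: "sets (k s t x \<Otimes>\<^sub>M k s t y) = sets (borel \<Otimes>\<^sub>M borel)"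
    using assms by (intro sets_pair_measure_cong sets_k)
  have nn: "(\<integral>\<^sup>+ z. ennreal (expneg z) \<partial>k s t x) = ennreal (laplace s t x)" for x
    unfolding laplace_def using assms by (intro nn_integral_k_eq_integral[where B=1]) auto
  have "ennreal (laplace s t (x + y)) = (\<integral>\<^sup>+ z. ennreal (expneg z) \<partial>conv_ennreal (k s t x) (k s t y))"
    using assms nn by (simp add: k_conv)
  also have "\<dots> = (\<integral>\<^sup>+ p. ennreal (expneg (fst p)) * ennreal (expneg (snd p)) \<partial>(k s t x \<Otimes>\<^sub>M k s t y))"
    unfolding conv_ennreal_def
    by (subst nn_integral_distr)
       (auto simp: measurable_cong_sets[OF pair refl] expneg_add ennreal_mult case_prod_beta')
  also have "\<dots> = (\<integral>\<^sup>+ a. \<integral>\<^sup>+ b. ennreal (expneg a) * ennreal (expneg b) \<partial>k s t y \<partial>k s t x)"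
    by (subst Y.nn_integral_fst[symmetric]) (auto simp: measurable_cong_sets[OF pair refl])
  also have "\<dots> = (\<integral>\<^sup>+ a. ennreal (expneg a) * ennreal (laplace s t y) \<partial>k s t x)"
    using assms by (intro nn_integral_cong, subst nn_integral_cmult) (auto simp: nn measurable_k)
  also have "\<dots> = ennreal (laplace s t x) * ennreal (laplace s t y)"
    using assms by (subst nn_integral_multc) (auto simp: nn measurable_k)
  finally show ?thesis
    by (simp add: ennreal_mult[symmetric] laplace_nonneg)
qed

text \<open>On finite initial values the transform is continuous by K3, multiplicative by K4 and 1
  at 0 by K5, hence exponential. At \<top> K6 makes both sides 0, as
  \<open>0 powr c = 0\<close>.\<close>

lemma laplace_1_pos: "0 \<le> s \<Longrightarrow> s \<le> t \<Longrightarrow> 0 < laplace s t 1"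
  and laplace_eq: "0 \<le> s \<Longrightarrow> s \<le> t \<Longrightarrow> laplace s t x = expneg x powr cumulant s t"
proof -
  assume st: "0 \<le> s" "s \<le> t"
  have "continuous_on {0..} (\<lambda>a. laplace s t (ennreal a))"
    unfolding laplace_def using st
    by (intro continuous_on_integral_k continuous_on_expneg continuous_on_ennreal continuous_intros) auto
  moreover have z: "laplace s t (ennreal 0) = 1"
    using st by (simp add: laplace_def k_zero integral_return)
  moreover have "laplace s t (ennreal (a + b)) = laplace s t (ennreal a) * laplace s t (ennreal b)"
    if "0 \<le> a" "0 \<le> b" for a b
    using that st by (simp add: laplace_add)
  ultimately have L: "0 < laplace s t (ennreal 1)"
    "\<And>a. 0 \<le> a \<Longrightarrow> laplace s t (ennreal a) = laplace s t (ennreal 1) powr a"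
    using continuous_exponential_equation[of "\<lambda>a. laplace s t (ennreal a)"] laplace_nonneg by blast+
  then show pos: "0 < laplace s t 1" by simp
  show "laplace s t x = expneg x powr cumulant s t"
  proof (cases x)
    case top
    then show ?thesis using st by (simp add: laplace_def k_top integral_return)
  next
    case (real a)
    then have "laplace s t x = laplace s t 1 powr a" using L(2)[of a] by simp
    also have "\<dots> = exp (- a) powr cumulant s t"
      using pos by (simp add: powr_def cumulant_def)
    finally show ?thesis using real by (simp add: expneg_def)
  qed
qed

text \<open>
  Otherwise there is a first time \<open>r\<close> at which the law started from \<open>1\<close> is concentrated at \<open>0\<close>. For \<open>q < r\<close>
  close to \<open>r\<close> the kernel \<open>k q r\<close> is close to the identity and keeps positive mass away from \<open>0\<close>.
\<close>

lemma laplace_1_less_1: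
  assumes st: "0 \<le> s" "s \<le> t"
  shows "laplace s t 1 < 1"
proof (rule ccontr)
  assume "\<not> laplace s t 1 < 1"
  then have one: "laplace s t 1 = 1" using laplace_le_1[OF st, of 1] by simp
  define A where "A = {r \<in> {s..t}. laplace s r 1 = 1}"
  \<comment> \<open>Continuity in the terminal time makes \<open>A\<close> closed, so that a first
    such time exists.\<close>
  have "continuous_on {s..t} (\<lambda>r. laplace s r 1)"
    unfolding laplace_def using st
    by (intro continuous_on_integral_k continuous_on_expneg continuous_intros) auto
  then have "closed A"
    unfolding A_def by (intro continuous_closed_preimage_constant) auto
  moreover have A_ne: "t \<in> A" using st one by (simp add: A_def)
  moreover have bdd: "bdd_below A" by (auto simp: A_def)
  ultimately have Inf_A: "Inf A \<in> A" by (intro closed_contains_Inf) auto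
  define r where "r = Inf A"
  have r: "s \<le> r" "laplace s r 1 = 1" using Inf_A by (auto simp: A_def r_def)
  have diag: "laplace q q 1 < 1" if "0 \<le> q" for q
    using that expneg_eq_1_iff[of 1] expneg_le_1[of 1]
    by (simp add: laplace_def integral_k_refl less_le del: expneg_le_1)
  have "r \<noteq> s" using r diag[of s] st by auto
  then have "s < r" using r by simp
  have "continuous_on {s..r} (\<lambda>q. laplace q r 1)"
    unfolding laplace_def using st
    by (intro continuous_on_integral_k continuous_on_expneg continuous_intros) auto
  then have "((\<lambda>q. laplace q r 1) \<longlongrightarrow> laplace r r 1) (at r within {s..r})"
    using r by (auto simp: continuous_on_def)
  then have "((\<lambda>q. laplace q r 1) \<longlongrightarrow> laplace r r 1) (at_left r)"
    using \<open>s < r\<close> by (simp add: at_within_Icc_at_left)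
  then have "\<forall>\<^sub>F q in at_left r. laplace q r 1 < 1"
    using diag[of r] st r by (intro order_tendstoD) auto
  moreover have "\<forall>\<^sub>F q in at_left r. q \<in> {s<..<r}"
    using \<open>s < r\<close> by (rule eventually_at_leftI[rotated]) 
  ultimately obtain q where q: "laplace q r 1 < 1" "s < q" "q < r"
    using eventually_happens'[OF trivial_limit_at_left_real, OF eventually_conj] by fastforce
  have "q \<notin> A" using cInf_lower[OF _ bdd, of q] q by (auto simp: r_def)
  then have sq: "laplace s q 1 \<noteq> 1"
    using q r Inf_A by (auto simp: A_def r_def)
  have "cumulant q r \<noteq> 0"
    using q st laplace_1_pos[of q r] by (simp add: cumulant_def)
  \<comment> \<open>With a nonzero exponent a transform equal to 1 at \<open>y\<close> means
    \<open>y = 0\<close>; the value \<open>expneg y = 0\<close> is excluded because its power is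
    0.\<close>
  then have powr_1: "expneg y powr cumulant q r = 1 \<Longrightarrow> expneg y = 1" for y
    by (cases "expneg y = 0") (auto simp: powr_def ln_eq_zero_iff less_le)
  interpret prob_space "k s q 1" using st q by (intro prob_space_k) auto
  have L: "(\<lambda>y. laplace q r y) \<in> borel_measurable borel"
    unfolding laplace_def using q st by (intro borel_measurable_integral_k) auto
  have int: "integrable (k s q 1) (\<lambda>y. laplace q r y)"
    using q st laplace_le_1[of q r] laplace_nonneg by (intro integrable_k[where B=1] L) auto
  \<comment> \<open>Chapman-Kolmogorov writes \<open>laplace s r 1 = 1\<close> as the mean of
    \<open>laplace q r y\<close>, which is at most 1. So it is 1 almost surely and the law at time
    \<open>q\<close> already sits at 0, although \<open>q < r\<close>.\<close>
  have "(\<integral>y. laplace q r y \<partial>k s q 1) = laplace s r 1"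
    unfolding laplace_def using q st
    by (intro integral_k_comp[symmetric, where B=1]) auto
  then have "(\<integral>y. 1 - laplace q r y \<partial>k s q 1) = 0"
    using r int prob_space by simp
  then have "AE y in k s q 1. 1 - laplace q r y = 0"
    using q st laplace_le_1[of q r] int by (subst (asm) integral_nonneg_eq_0_iff_AE) auto
  then have "AE y in k s q 1. expneg y = 1"
    using q st by (auto simp: laplace_eq intro: powr_1)
  then have "laplace s q 1 = (\<integral>y. 1 \<partial>k s q 1)"
    unfolding laplace_def using q st by (intro integral_cong_AE) (auto simp: measurable_k)
  with sq show False using prob_space by simp
qed

lemma cumulant_pos: "0 \<le> s \<Longrightarrow> s \<le> t \<Longrightarrow> 0 < cumulant s t"
  using laplace_1_less_1[of s t] laplace_1_pos[of s t] by (simp add: cumulant_def)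

text \<open>The horizon is fixed and the starting time varies: this is the continuity that turns
  one-sided limits of the martingale into limits of the process.\<close>

lemma continuous_on_cumulant: "continuous_on {0..t} (\<lambda>s. cumulant s t)"
proof -
  have "continuous_on {0..t} (\<lambda>s. laplace s t 1)"
    unfolding laplace_def
    by (intro continuous_on_integral_k continuous_on_expneg continuous_intros) auto
  moreover have "laplace s t 1 \<noteq> 0" if "s \<in> {0..t}" for s
    using laplace_1_pos[of s t] that by auto
  ultimately show ?thesis
    unfolding cumulant_def by (intro continuous_intros) auto
qed

end

section \<open>Oscillations and one-sided limits along the rationals\<close>

text \<open>
  The reference value \<open>a\<close> is reset whenever the path is at distance at least \<open>e\<close> from it. Two values
  \<open>2 * e\<close> apart force a reset in between, whatever the reference value is.
\<close>

fun osc :: "real \<Rightarrow> real \<Rightarrow> real list \<Rightarrow> nat" where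
  "osc e a [] = 0"
| "osc e a (y # ys) = (if e \<le> \<bar>y - a\<bar> then Suc (osc e y ys) else osc e a ys)"

text \<open>\<open>b\<close> is the reference value left over after \<open>xs\<close>; it does not
  depend on \<open>ys\<close>. Later arguments cannot control it, which is why their lower bounds
  are stated for every reference value.\<close>

lemma osc_append: "\<exists>b. \<forall>ys. osc e a (xs @ ys) = osc e a xs + osc e b ys"
proof (induction xs arbitrary: a)
  case Nil
  show ?case by auto
next
  case (Cons x xs)
  then obtain b where "\<forall>ys. osc e (if e \<le> \<bar>x - a\<bar> then x else a) (xs @ ys)
      = osc e (if e \<le> \<bar>x - a\<bar> then x else a) xs + osc e b ys" by blast
  then show ?case by (intro exI[of _ b]) auto
qed

lemma osc_eq_0D: "osc e a xs = 0 \<Longrightarrow> y \<in> set xs \<Longrightarrow> \<bar>y - a\<bar> < e"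
  by (induction xs) (auto split: if_splits)

lemma osc_pos:
  assumes "y \<in> set xs" "z \<in> set xs" "2 * e \<le> \<bar>y - z\<bar>"
  shows "0 < osc e a xs"
  using osc_eq_0D[of e a xs y] osc_eq_0D[of e a xs z] assms by (cases "osc e a xs = 0") auto

lemma sorted_list_of_set_Un_less:
  fixes A B :: "'a::linorder set"
  assumes "finite A" "finite B" "\<And>x y. x \<in> A \<Longrightarrow> y \<in> B \<Longrightarrow> x < y"
  shows "sorted_list_of_set (A \<union> B) = sorted_list_of_set A @ sorted_list_of_set B"
  using assms by (intro sorted_distinct_set_unique) (auto simp: sorted_append less_imp_le dest: assms(3))

abbreviation osc_set :: "real \<Rightarrow> real \<Rightarrow> (real \<Rightarrow> real) \<Rightarrow> real set \<Rightarrow> nat" where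
  "osc_set e a f F \<equiv> osc e a (map f (sorted_list_of_set F))"

lemma osc_set_Un:
  assumes "finite A" "finite B" "\<And>x y. x \<in> A \<Longrightarrow> y \<in> B \<Longrightarrow> x < y"
  shows "\<exists>b. osc_set e a f (A \<union> B) = osc_set e a f A + osc_set e b f B"
  using osc_append[of e a "map f (sorted_list_of_set A)"] sorted_list_of_set_Un_less[OF assms] by auto

text \<open>Splitting at \<open>p\<close> and at \<open>q\<close> writes the whole count as a sum of
  three, of which the middle one starts from some uncontrolled reference value.\<close>

lemma osc_set_middle:
  assumes "finite F"
  shows "\<exists>b. osc_set e b f (F \<inter> {p<..<q}) \<le> osc_set e a f F"
proof -
  obtain b where b: "osc_set e a f ((F \<inter> {..p}) \<union> (F \<inter> {p<..})) = osc_set e a f (F \<inter> {..p}) + osc_set e b f (F \<inter> {p<..})"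
    using osc_set_Un[of "F \<inter> {..p}" "F \<inter> {p<..}" e a f] assms by auto
  obtain c where c: "osc_set e b f ((F \<inter> {p<..<q}) \<union> (F \<inter> {p<..} \<inter> {q..}))
      = osc_set e b f (F \<inter> {p<..<q}) + osc_set e c f (F \<inter> {p<..} \<inter> {q..})"
    using osc_set_Un[of "F \<inter> {p<..<q}" "F \<inter> {p<..} \<inter> {q..}" e b f] assms by auto
  have "(F \<inter> {..p}) \<union> (F \<inter> {p<..}) = F" "(F \<inter> {p<..<q}) \<union> (F \<inter> {p<..} \<inter> {q..}) = F \<inter> {p<..}" by auto
  with b c show ?thesis by (intro exI[of _ b]) simp
qed

locale exhaustion =
  fixes F :: "nat \<Rightarrow> real set" and Q :: "real set"
  assumes F: "incseq F" "\<And>n. finite (F n)" "(\<Union>n. F n) = Q"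
begin

lemma in_F: "q \<in> Q \<Longrightarrow> \<exists>n0. \<forall>n\<ge>n0. q \<in> F n"
  using F unfolding incseq_def by blast

lemma in_F2:
  assumes "q \<in> Q" "q' \<in> Q" obtains n0 where "\<And>n. n0 \<le> n \<Longrightarrow> q \<in> F n \<and> q' \<in> F n"
proof -
  obtain n1 n2 where "\<forall>n\<ge>n1. q \<in> F n" "\<forall>n\<ge>n2. q' \<in> F n" using in_F assms by metis
  then show thesis by (intro that[of "max n1 n2"]) auto
qed

text \<open>Each window to the left of \<open>t\<close> contains two values \<open>2 * e\<close>
  apart. Behind such a pair the search starts again in a smaller window, so resets accumulate
  without bound once \<open>F n\<close> contains all the pairs used.\<close>

lemma many_osc_left:
  assumes H: "\<And>p. p < t \<Longrightarrow> \<exists>q\<in>Q \<inter> {p<..<t}. \<exists>q'\<in>Q \<inter> {p<..<t}. 2 * e \<le> \<bar>f q - f q'\<bar>"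
  shows "p < t \<Longrightarrow> \<exists>n0. \<forall>n\<ge>n0. \<forall>a. j \<le> osc_set e a f (F n \<inter> {p<..<t})"
proof (induction j arbitrary: p)
  case (Suc j)
  obtain q q' where q: "q \<in> Q" "q' \<in> Q" "q \<in> {p<..<t}" "q' \<in> {p<..<t}" "2 * e \<le> \<bar>f q - f q'\<bar>"
    using H[OF Suc.prems] by blast
  \<comment> \<open>The next window starts after both times of the pair, which keeps the two blocks
    of times separate.\<close>
  define m where "m = max q q'"
  have "p < m" "m < t" using q by (auto simp: m_def)
  obtain n1 where n1: "\<forall>n\<ge>n1. \<forall>a. j \<le> osc_set e a f (F n \<inter> {m<..<t})" using Suc.IH[OF \<open>m < t\<close>] by blast
  obtain n2 where n2: "\<And>n. n2 \<le> n \<Longrightarrow> q \<in> F n \<and> q' \<in> F n" using q by (auto intro: in_F2)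
  show ?case
  proof (intro exI allI impI)
    fix n a assume n: "max n1 n2 \<le> n"
    obtain b where b: "osc_set e a f ((F n \<inter> {p<..m}) \<union> (F n \<inter> {m<..<t}))
       = osc_set e a f (F n \<inter> {p<..m}) + osc_set e b f (F n \<inter> {m<..<t})"
      using osc_set_Un[of "F n \<inter> {p<..m}" "F n \<inter> {m<..<t}" e a f] F by auto
    have "0 < osc_set e a f (F n \<inter> {p<..m})"
      using q n n2[of n] F(2) by (intro osc_pos[of "f q" _ "f q'"]) (auto simp: m_def)
    moreover have "j \<le> osc_set e b f (F n \<inter> {m<..<t})" using n n1 by simp
    moreover have "(F n \<inter> {p<..m}) \<union> (F n \<inter> {m<..<t}) = F n \<inter> {p<..<t}"
      using \<open>p < m\<close> \<open>m < t\<close> by auto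
    ultimately show "Suc j \<le> osc_set e a f (F n \<inter> {p<..<t})" using b by simp
  qed
qed simp

text \<open>Mirror image: the windows shrink towards \<open>t\<close> from the right, so the block
  with the new pair is now the later one.\<close>

lemma many_osc_right:
  assumes H: "\<And>p. t < p \<Longrightarrow> \<exists>q\<in>Q \<inter> {t<..<p}. \<exists>q'\<in>Q \<inter> {t<..<p}. 2 * e \<le> \<bar>f q - f q'\<bar>"
  shows "t < p \<Longrightarrow> \<exists>n0. \<forall>n\<ge>n0. \<forall>a. j \<le> osc_set e a f (F n \<inter> {t<..<p})"
proof (induction j arbitrary: p)
  case (Suc j)
  obtain q q' where q: "q \<in> Q" "q' \<in> Q" "q \<in> {t<..<p}" "q' \<in> {t<..<p}" "2 * e \<le> \<bar>f q - f q'\<bar>"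
    using H[OF Suc.prems] by blast
  define m where "m = min q q'"
  have "t < m" "m < p" using q by (auto simp: m_def)
  obtain n1 where n1: "\<forall>n\<ge>n1. \<forall>a. j \<le> osc_set e a f (F n \<inter> {t<..<m})" using Suc.IH[OF \<open>t < m\<close>] by blast
  obtain n2 where n2: "\<And>n. n2 \<le> n \<Longrightarrow> q \<in> F n \<and> q' \<in> F n" using q by (auto intro: in_F2)
  show ?case
  proof (intro exI allI impI)
    fix n a assume n: "max n1 n2 \<le> n"
    obtain b where b: "osc_set e a f ((F n \<inter> {t<..<m}) \<union> (F n \<inter> {m..<p}))
       = osc_set e a f (F n \<inter> {t<..<m}) + osc_set e b f (F n \<inter> {m..<p})"
      using osc_set_Un[of "F n \<inter> {t<..<m}" "F n \<inter> {m..<p}" e a f] F by auto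
    have "0 < osc_set e b f (F n \<inter> {m..<p})"
      using q n n2[of n] F(2) by (intro osc_pos[of "f q" _ "f q'"]) (auto simp: m_def)
    moreover have "j \<le> osc_set e a f (F n \<inter> {t<..<m})" using n n1 by simp
    moreover have "(F n \<inter> {t<..<m}) \<union> (F n \<inter> {m..<p}) = F n \<inter> {t<..<p}"
      using \<open>t < m\<close> \<open>m < p\<close> by auto
    ultimately show "Suc j \<le> osc_set e a f (F n \<inter> {t<..<p})" using b by simp
  qed
qed simp

text \<open>Otherwise every window at \<open>t\<close> contains a large difference and the counts
  eventually exceed \<open>K\<close>. A bound for infinitely many \<open>n\<close> suffices because
  that excess holds for all large \<open>n\<close>.\<close>

lemma small_osc_one_sided:
  assumes K: "\<exists>\<^sub>F n in sequentially. osc_set e a f (F n) \<le> K"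
  shows "\<exists>p<t. \<forall>q\<in>Q \<inter> {p<..<t}. \<forall>q'\<in>Q \<inter> {p<..<t}. \<bar>f q - f q'\<bar> < 2 * e"
    and "\<exists>p>t. \<forall>q\<in>Q \<inter> {t<..<p}. \<forall>q'\<in>Q \<inter> {t<..<p}. \<bar>f q - f q'\<bar> < 2 * e"
proof -
  have no: False if "\<exists>n0. \<forall>n\<ge>n0. \<forall>a. Suc K \<le> osc_set e a f (F n \<inter> {p<..<q})" for p q
  proof -
    from that obtain n0 where n0: "\<And>n a. n0 \<le> n \<Longrightarrow> Suc K \<le> osc_set e a f (F n \<inter> {p<..<q})" by blast
    from K obtain n where n: "n0 \<le> n" "osc_set e a f (F n) \<le> K"
      unfolding frequently_sequentially by blast
    obtain b where "osc_set e b f (F n \<inter> {p<..<q}) \<le> osc_set e a f (F n)"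
      using osc_set_middle[OF F(2)] by blast
    with n n0[of n b] show False by simp
  qed
  show "\<exists>p<t. \<forall>q\<in>Q \<inter> {p<..<t}. \<forall>q'\<in>Q \<inter> {p<..<t}. \<bar>f q - f q'\<bar> < 2 * e"
  proof (rule ccontr)
    assume neg: "\<not> ?thesis"
    have "\<exists>q\<in>Q \<inter> {p<..<t}. \<exists>q'\<in>Q \<inter> {p<..<t}. 2 * e \<le> \<bar>f q - f q'\<bar>" if "p < t" for p
      using neg that by (meson not_less)
    from many_osc_left[OF this, of "t - 1" "Suc K"] show False by (auto intro: no)
  qed
  show "\<exists>p>t. \<forall>q\<in>Q \<inter> {t<..<p}. \<forall>q'\<in>Q \<inter> {t<..<p}. \<bar>f q - f q'\<bar> < 2 * e"
  proof (rule ccontr)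
    assume neg: "\<not> ?thesis"
    have "\<exists>q\<in>Q \<inter> {t<..<p}. \<exists>q'\<in>Q \<inter> {t<..<p}. 2 * e \<le> \<bar>f q - f q'\<bar>" if "t < p" for p
      using neg that by (meson not_less)
    from many_osc_right[OF this, of "t + 1" "Suc K"] show False by (auto intro: no)
  qed
qed

text \<open>Bounded counts at every scale \<open>1 / Suc m\<close> make the image filter Cauchy, and
  the reals are complete. The filter is trivial when \<open>Q\<close> does not accumulate at
  \<open>t\<close> from that side.\<close>

lemma one_sided_limits:
  assumes K: "\<And>m. \<exists>K. \<exists>\<^sub>F n in sequentially. osc_set (1 / real (Suc m)) a f (F n) \<le> K"
  shows "\<exists>l. (f \<longlongrightarrow> l) (at t within (Q \<inter> {..<t}))"
    and "\<exists>l. (f \<longlongrightarrow> l) (at t within (Q \<inter> {t<..}))"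
proof -
  have conv: "\<exists>l. (f \<longlongrightarrow> l) G"
    if C: "\<And>m. \<exists>P. eventually P G \<and> (\<forall>q q'. P q \<and> P q' \<longrightarrow> \<bar>f q - f q'\<bar> < 2 * (1 / real (Suc m)))" for G :: "real filter"
  proof (cases "G = bot")
    case True
    then show ?thesis by simp
  next
    case False
    have "cauchy_filter (filtermap f G)"
      unfolding cauchy_filter_metric_filtermap
    proof (intro allI impI)
      fix e :: real assume "0 < e"
      then obtain m where m: "1 / real (Suc m) < e / 2"
        using nat_approx_posE[of "e / 2"] by auto
      obtain P where P: "eventually P G" "\<And>q q'. P q \<Longrightarrow> P q' \<Longrightarrow> \<bar>f q - f q'\<bar> < 2 * (1 / real (Suc m))"
        using C[of m] by blast
      show "\<exists>P. eventually P G \<and> (\<forall>x y. P x \<and> P y \<longrightarrow> dist (f x) (f y) < e)"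
      proof (intro exI[of _ P] conjI allI impI)
        fix x y assume "P x \<and> P y"
        then show "dist (f x) (f y) < e" using P(2)[of x y] m unfolding dist_real_def by linarith
      qed (rule P(1))
    qed
    moreover have "filtermap f G \<noteq> bot" using False by (simp add: filtermap_bot_iff)
    ultimately obtain l where "filtermap f G \<le> nhds l"
      using complete_UNIV[where 'a=real, unfolded complete_uniform] by auto
    then show ?thesis by (auto simp: filterlim_def)
  qed
  show "\<exists>l. (f \<longlongrightarrow> l) (at t within (Q \<inter> {..<t}))"
  proof (rule conv)
    fix m
    obtain K where "\<exists>\<^sub>F n in sequentially. osc_set (1 / real (Suc m)) a f (F n) \<le> K" using K by blast
    from small_osc_one_sided(1)[OF this, of t] obtain p where
      p: "p < t" "\<forall>q\<in>Q \<inter> {p<..<t}. \<forall>q'\<in>Q \<inter> {p<..<t}. \<bar>f q - f q'\<bar> < 2 * (1 / real (Suc m))" by blast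
    have "\<forall>\<^sub>F q in at t within (Q \<inter> {..<t}). q \<in> Q \<inter> {p<..<t}"
      unfolding eventually_at_topological using p(1) by (intro exI[of _ "{p<..}"]) auto
    with p(2) show "\<exists>P. eventually P (at t within (Q \<inter> {..<t})) \<and> (\<forall>q q'. P q \<and> P q' \<longrightarrow> \<bar>f q - f q'\<bar> < 2 * (1 / real (Suc m)))"
      by (intro exI[of _ "\<lambda>q. q \<in> Q \<inter> {p<..<t}"]) blast
  qed
  show "\<exists>l. (f \<longlongrightarrow> l) (at t within (Q \<inter> {t<..}))"
  proof (rule conv)
    fix m
    obtain K where "\<exists>\<^sub>F n in sequentially. osc_set (1 / real (Suc m)) a f (F n) \<le> K" using K by blast
    from small_osc_one_sided(2)[OF this, of t] obtain p where
      p: "t < p" "\<forall>q\<in>Q \<inter> {t<..<p}. \<forall>q'\<in>Q \<inter> {t<..<p}. \<bar>f q - f q'\<bar> < 2 * (1 / real (Suc m))" by blast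
    have "\<forall>\<^sub>F q in at t within (Q \<inter> {t<..}). q \<in> Q \<inter> {t<..<p}"
      unfolding eventually_at_topological using p(1) by (intro exI[of _ "{..<p}"]) auto
    with p(2) show "\<exists>P. eventually P (at t within (Q \<inter> {t<..})) \<and> (\<forall>q q'. P q \<and> P q' \<longrightarrow> \<bar>f q - f q'\<bar> < 2 * (1 / real (Suc m)))"
      by (intro exI[of _ "\<lambda>q. q \<in> Q \<inter> {t<..<p}"]) blast
  qed
qed

end

lemma countable_exhaustion:
  assumes "countable Q"
  obtains F where "exhaustion F Q"
proof (cases "Q = {}")
  case True
  then show thesis by (intro that[of "\<lambda>_. {}"]) (auto simp: exhaustion_def incseq_def)
next
  case False
  define F where "F n = from_nat_into Q ` {..n}" for n
  have "exhaustion F Q"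
  proof
    show "incseq F" unfolding incseq_def F_def by (meson atMost_subset_iff image_mono)
    have "(\<Union>n. F n) = range (from_nat_into Q)" unfolding F_def by blast
    then show "(\<Union>n. F n) = Q" using False assms by (simp add: range_from_nat_into)
  qed (simp add: F_def)
  then show thesis by (rule that)
qed

lemma measurable_osc [measurable (raw)]:
  assumes "a \<in> borel_measurable M" "\<And>r. r \<in> set ts \<Longrightarrow> g r \<in> borel_measurable M"
  shows "(\<lambda>\<omega>. osc e (a \<omega>) (map (\<lambda>r. g r \<omega>) ts)) \<in> M \<rightarrow>\<^sub>M count_space UNIV"
  using assms
proof (induction ts arbitrary: a)
  case (Cons r ts)
  have [measurable]: "a \<in> borel_measurable M" "g r \<in> borel_measurable M" using Cons.prems by auto
  have [measurable]: "(\<lambda>\<omega>. osc e (b \<omega>) (map (\<lambda>r. g r \<omega>) ts)) \<in> M \<rightarrow>\<^sub>M count_space UNIV"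
    if "b \<in> borel_measurable M" for b using Cons that by auto
  show ?case by simp
qed simp

section \<open>Right limits along the rationals\<close>

abbreviation rat_right :: "real \<Rightarrow> real filter" where
  "rat_right t \<equiv> at t within (\<rat> \<inter> {t<..})"

abbreviation rat_left :: "real \<Rightarrow> real filter" where
  "rat_left t \<equiv> at t within (\<rat> \<inter> {..<t})"

lemma rat_right_ne_bot: "rat_right t \<noteq> bot"
proof -
  have "\<exists>q\<in>\<rat> \<inter> {t<..}. q \<noteq> t \<and> dist q t < e" if "0 < e" for e
    using Rats_dense_in_real[of t "t + e"] that by (force simp: dist_real_def)
  then show ?thesis by (simp add: trivial_limit_within islimpt_approachable)
qed

lemma rat_left_ne_bot: "rat_left t \<noteq> bot"
proof -
  have "\<exists>q\<in>\<rat> \<inter> {..<t}. q \<noteq> t \<and> dist q t < e" if "0 < e" for e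
    using Rats_dense_in_real[of "t - e" t] that by (force simp: dist_real_def)
  then show ?thesis by (simp add: trivial_limit_within islimpt_approachable)
qed

definition rlim :: "(real \<Rightarrow> real) \<Rightarrow> real \<Rightarrow> real" where
  "rlim f t = Lim (rat_right t) f"

lemma rlim_eq: "(f \<longlongrightarrow> l) (rat_right t) \<Longrightarrow> rlim f t = l"
  unfolding rlim_def by (rule tendsto_Lim[OF rat_right_ne_bot])

lemma tendsto_rlim: "\<exists>l. (f \<longlongrightarrow> l) (rat_right t) \<Longrightarrow> (f \<longlongrightarrow> rlim f t) (rat_right t)"
  using rlim_eq by auto

lemma dist_rlim_le:
  assumes lim: "\<exists>l. (f \<longlongrightarrow> l) (rat_right r)" and "r < p"
    and "\<And>q. q \<in> \<rat> \<Longrightarrow> r < q \<Longrightarrow> q < p \<Longrightarrow> dist (f q) L \<le> e"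
  shows "dist (rlim f r) L \<le> e"
proof -
  have "\<forall>\<^sub>F q in rat_right r. dist (f q) L \<le> e"
    unfolding eventually_at_topological using assms by (intro exI[of _ "{..<p}"]) auto
  then show ?thesis
    using Lim_dist_ubound[OF rat_right_ne_bot tendsto_rlim[OF lim], of L e] by (simp add: dist_commute)
qed

text \<open>A bound for \<open>f\<close> at the rationals in (t, t + d) passes to
  \<open>rlim f r\<close> for every real \<open>r\<close> in that interval. The margin
  \<open>e / 2\<close> absorbs the loss of strictness in the limit.\<close>

lemma rlim_right_continuous:
  assumes lim: "\<And>r. t \<le> r \<Longrightarrow> \<exists>l. (f \<longlongrightarrow> l) (rat_right r)"
  shows "(rlim f \<longlongrightarrow> rlim f t) (at_right t)"
proof (rule tendstoI)
  fix e :: real assume "0 < e"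
  then have "\<forall>\<^sub>F q in rat_right t. dist (f q) (rlim f t) < e / 2"
    by (intro tendstoD tendsto_rlim lim) auto
  then obtain d where d: "0 < d" "\<And>q. q \<in> \<rat> \<Longrightarrow> t < q \<Longrightarrow> dist q t < d \<Longrightarrow> dist (f q) (rlim f t) < e / 2"
    unfolding eventually_at by auto
  have "dist (rlim f r) (rlim f t) < e" if "t < r" "r < t + d" for r
  proof -
    have "dist (rlim f r) (rlim f t) \<le> e / 2"
    proof (rule dist_rlim_le)
      show "r < t + d" by fact
      fix q assume "q \<in> \<rat>" "r < q" "q < t + d"
      then show "dist (f q) (rlim f t) \<le> e / 2" using d(2)[of q] that by (auto simp: dist_real_def)
    qed (use that lim in auto)
    with \<open>0 < e\<close> show ?thesis by simp
  qed
  then show "\<forall>\<^sub>F r in at_right t. dist (rlim f r) (rlim f t) < e"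
    using d(1) by (intro eventually_at_rightI[of t "t + d"]) auto
qed

text \<open>The same transfer on a left neighbourhood, cut off at \<open>s\<close> because right
  limits are only assumed from \<open>s\<close> on.\<close>

lemma rlim_left_limit:
  assumes lim: "\<And>r. s \<le> r \<Longrightarrow> \<exists>l. (f \<longlongrightarrow> l) (rat_right r)"
    and l: "(f \<longlongrightarrow> l) (rat_left t)" and "s < t"
  shows "(rlim f \<longlongrightarrow> l) (at_left t)"
proof (rule tendstoI)
  fix e :: real assume "0 < e"
  then have "\<forall>\<^sub>F q in rat_left t. dist (f q) l < e / 2"
    by (intro tendstoD l) auto
  then obtain d where d: "0 < d" "\<And>q. q \<in> \<rat> \<Longrightarrow> q < t \<Longrightarrow> dist q t < d \<Longrightarrow> dist (f q) l < e / 2"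
    unfolding eventually_at by auto
  have "dist (rlim f r) l < e" if "max s (t - d) < r" "r < t" for r
  proof -
    have "dist (rlim f r) l \<le> e / 2"
    proof (rule dist_rlim_le)
      show "r < t" by fact
      fix q assume "q \<in> \<rat>" "r < q" "q < t"
      then show "dist (f q) l \<le> e / 2" using d(2)[of q] that by (auto simp: dist_real_def)
    qed (use that lim in auto)
    with \<open>0 < e\<close> show ?thesis by simp
  qed
  then show "\<forall>\<^sub>F r in at_left t. dist (rlim f r) l < e"
    using d(1) \<open>s < t\<close> by (intro eventually_at_leftI[of "max s (t - d)"]) auto
qed

section \<open>Oscillation and absorption bounds for finite-dimensional laws\<close>

context kernel_family
begin

lemma measurable_path_coord:
  "r \<in> J \<Longrightarrow> f \<in> borel_measurable borel \<Longrightarrow> (\<lambda>\<omega>. f (\<omega> r)) \<in> borel_measurable (path_space J)"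
  by (rule measurable_compose[OF measurable_component_singleton[where M="\<lambda>_. borel"]])

text \<open>Variance plus squared bias; it plays the part of the orthogonality of martingale
  increments.\<close>

lemma integral_k_square_decomp:
  fixes \<psi> :: "ennreal \<Rightarrow> real" and y :: ennreal
  assumes st: "0 \<le> s" "s \<le> t" and \<psi>: "\<psi> \<in> borel_measurable borel" "\<And>y. \<bar>\<psi> y\<bar> \<le> B"
  defines "m \<equiv> \<integral>z. \<psi> z \<partial>k s t y"
  shows "(\<integral>z. (\<psi> z - a)\<^sup>2 \<partial>k s t y) = (\<integral>z. (\<psi> z - m)\<^sup>2 \<partial>k s t y) + (m - a)\<^sup>2"
proof -
  interpret prob_space "k s t y" using st by (rule prob_space_k)
  have i1: "integrable (k s t y) \<psi>" using st \<psi> by (rule integrable_k)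
  have "\<bar>(\<psi> z)\<^sup>2\<bar> \<le> B\<^sup>2" for z
    using power_mono[OF \<psi>(2)[of z] abs_ge_zero, of 2] by simp
  then have i2: "integrable (k s t y) (\<lambda>z. (\<psi> z)\<^sup>2)" using st \<psi> by (intro integrable_k) auto
  have eq: "(\<integral>z. (\<psi> z - b)\<^sup>2 \<partial>k s t y) = (\<integral>z. (\<psi> z)\<^sup>2 \<partial>k s t y) - 2 * b * m + b\<^sup>2" for b
    using i1 i2 unfolding m_def by (simp add: power2_diff prob_space algebra_simps)
  show ?thesis unfolding eq by (simp add: power2_eq_square algebra_simps)
qed

text \<open>
  At a reset the second moment of \<open>\<psi> - a\<close> splits into the one around the conditional mean \<open>m\<close>, which
  pays for the remaining resets, and \<open>(m - a)\<^sup>2 \<ge> e\<^sup>2\<close>, which pays for the present one.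
\<close>

lemma nn_integral_osc_path_law:
  fixes \<psi> :: "ennreal \<Rightarrow> real" and T :: real
  assumes \<psi>: "\<psi> \<in> borel_measurable borel" "\<And>y. \<bar>\<psi> y\<bar> \<le> B" and e: "0 < e"
  defines "m \<equiv> \<lambda>r y. \<integral>z. \<psi> z \<partial>k r T y"
  assumes "0 \<le> t" "sorted (t # ts)" "distinct ts" "t \<le> T" "\<And>r. r \<in> set ts \<Longrightarrow> r \<le> T"
  shows "(\<integral>\<^sup>+ \<omega>. ennreal (e\<^sup>2 * real (osc e a (map (\<lambda>r. m r (\<omega> r)) ts))) \<partial>path_law t y ts)
     \<le> ennreal (\<integral>z. (\<psi> z - a)\<^sup>2 \<partial>k t T y)"
  using assms(5-)
proof (induction ts arbitrary: t y a)
  case (Cons r ts)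
  have r: "0 \<le> t" "t \<le> r" "r \<le> T" "sorted (r # ts)" "distinct ts" "r \<notin> set ts" using Cons.prems by auto
  have m_meas: "m q \<in> borel_measurable borel" if "q \<in> set (r # ts)" for q
    unfolding m_def using that Cons.prems \<psi> by (intro borel_measurable_integral_k) auto
  have F: "(\<lambda>\<omega>. ennreal (e\<^sup>2 * real (osc e a (map (\<lambda>q. m q (\<omega> q)) qs)))) \<in> borel_measurable (path_space J)"
    if "set qs \<subseteq> J" "set qs \<subseteq> set (r # ts)" for a qs J
  proof -
    have [measurable]: "(\<lambda>\<omega>. osc e a (map (\<lambda>q. m q (\<omega> q)) qs)) \<in> path_space J \<rightarrow>\<^sub>M count_space UNIV"
    proof (rule measurable_osc)
      fix q assume "q \<in> set qs"
      then show "(\<lambda>\<omega>. m q (\<omega> q)) \<in> borel_measurable (path_space J)"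
        using that m_meas[of q] by (intro measurable_path_coord[of q J "m q"]) auto
    qed simp
    show ?thesis by measurable
  qed
  have upd: "map (\<lambda>q. m q (fun_upd \<omega> r z q)) (r # ts) = m r z # map (\<lambda>q. m q (\<omega> q)) ts" for \<omega> z
    using r by auto
  have "(\<integral>\<^sup>+ \<omega>. ennreal (e\<^sup>2 * real (osc e a (map (\<lambda>q. m q (\<omega> q)) (r # ts)))) \<partial>path_law t y (r # ts))
     = (\<integral>\<^sup>+ z. \<integral>\<^sup>+ \<omega>. ennreal (e\<^sup>2 * real (osc e a (m r z # map (\<lambda>q. m q (\<omega> q)) ts))) \<partial>path_law r z ts \<partial>k t r y)"
    using Cons.prems by (subst nn_integral_path_law_Cons[OF _ _ F]) (simp_all only: upd order.refl)
  also have "\<dots> \<le> (\<integral>\<^sup>+ z. ennreal (\<integral>w. (\<psi> w - a)\<^sup>2 \<partial>k r T z) \<partial>k t r y)"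
  proof (intro nn_integral_mono)
    fix z
    interpret prob_space "path_law r z ts" using r by (intro prob_space_path_law) auto
    \<comment> \<open>The hypothesis is kept for every reference value: \<open>m r z\<close> is used
      after a reset at \<open>r\<close>, \<open>a\<close> otherwise.\<close>
    have IH: "(\<integral>\<^sup>+ \<omega>. ennreal (e\<^sup>2 * real (osc e b (map (\<lambda>r. m r (\<omega> r)) ts))) \<partial>path_law r z ts)
      \<le> ennreal (\<integral>w. (\<psi> w - b)\<^sup>2 \<partial>k r T z)" for b
      using r Cons.prems by (intro Cons.IH) auto
    show "(\<integral>\<^sup>+ \<omega>. ennreal (e\<^sup>2 * real (osc e a (m r z # map (\<lambda>q. m q (\<omega> q)) ts))) \<partial>path_law r z ts)
      \<le> ennreal (\<integral>w. (\<psi> w - a)\<^sup>2 \<partial>k r T z)"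
    proof (cases "e \<le> \<bar>m r z - a\<bar>")
      case True
      then have e2: "e\<^sup>2 \<le> (m r z - a)\<^sup>2"
        using power_mono[OF True, of 2] e by simp
      have F': "(\<lambda>\<omega>. ennreal (e\<^sup>2 * real (osc e (m r z) (map (\<lambda>q. m q (\<omega> q)) ts)))) \<in> borel_measurable (path_law r z ts)"
        using F[of ts "set ts" "m r z"] r by (auto simp: measurable_cong_sets[OF sets_path_law refl])
      have "(\<integral>\<^sup>+ \<omega>. ennreal (e\<^sup>2 * real (osc e a (m r z # map (\<lambda>q. m q (\<omega> q)) ts))) \<partial>path_law r z ts)
        = (\<integral>\<^sup>+ \<omega>. ennreal (e\<^sup>2) + ennreal (e\<^sup>2 * real (osc e (m r z) (map (\<lambda>q. m q (\<omega> q)) ts))) \<partial>path_law r z ts)"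
        using True by (intro nn_integral_cong) (simp add: algebra_simps flip: ennreal_plus)
      also have "\<dots> = ennreal (e\<^sup>2) + (\<integral>\<^sup>+ \<omega>. ennreal (e\<^sup>2 * real (osc e (m r z) (map (\<lambda>q. m q (\<omega> q)) ts))) \<partial>path_law r z ts)"
        using F' by (simp add: nn_integral_add emeasure_space_1)
      also have "\<dots> \<le> ennreal ((m r z - a)\<^sup>2) + ennreal (\<integral>w. (\<psi> w - m r z)\<^sup>2 \<partial>k r T z)"
        using e2 by (intro add_mono IH ennreal_leI)
      also have "\<dots> = ennreal ((m r z - a)\<^sup>2 + (\<integral>w. (\<psi> w - m r z)\<^sup>2 \<partial>k r T z))"
        by (intro ennreal_plus[symmetric]) auto
      also have "(m r z - a)\<^sup>2 + (\<integral>w. (\<psi> w - m r z)\<^sup>2 \<partial>k r T z) = (\<integral>w. (\<psi> w - a)\<^sup>2 \<partial>k r T z)"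
        using integral_k_square_decomp[of r T \<psi> B z a] r \<psi> by (simp add: m_def)
      finally show ?thesis .
    next
      case False
      then show ?thesis using IH by simp
    qed
  qed
  also have "\<dots> = (\<integral>\<^sup>+ z. \<integral>\<^sup>+ w. ennreal ((\<psi> w - a)\<^sup>2) \<partial>k r T z \<partial>k t r y)"
  proof (intro nn_integral_cong nn_integral_k_eq_integral[symmetric])
    show "(\<psi> w - a)\<^sup>2 \<le> (B + \<bar>a\<bar>)\<^sup>2" for w
      using power_mono[of "\<bar>\<psi> w - a\<bar>" "B + \<bar>a\<bar>" 2] \<psi>(2)[of w] by simp
  qed (use r \<psi> in auto)
  also have "\<dots> = (\<integral>\<^sup>+ w. ennreal ((\<psi> w - a)\<^sup>2) \<partial>k t T y)"
    using r \<psi> by (intro nn_integral_k_comp[symmetric]) auto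
  also have "\<dots> = ennreal (\<integral>w. (\<psi> w - a)\<^sup>2 \<partial>k t T y)"
  proof (intro nn_integral_k_eq_integral)
    show "(\<psi> w - a)\<^sup>2 \<le> (B + \<bar>a\<bar>)\<^sup>2" for w
      using power_mono[of "\<bar>\<psi> w - a\<bar>" "B + \<bar>a\<bar>" 2] \<psi>(2)[of w] by simp
  qed (use r \<psi> in auto)
  finally show ?case .
qed simp

lemma nn_integral_path_law_last:
  assumes f: "f \<in> borel_measurable borel" and "0 \<le> t" "sorted (t # ts @ [T])" "T \<notin> set ts"
  shows "(\<integral>\<^sup>+ \<omega>. f (\<omega> T) \<partial>path_law t y (ts @ [T])) = (\<integral>\<^sup>+ z. f z \<partial>k t T y)"
  using assms(2-)
proof (induction ts arbitrary: t y)
  case Nil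
  interpret P: prob_space "path_law T z []" for z using Nil by (intro prob_space_path_law) auto
  have "(\<integral>\<^sup>+ \<omega>. f (\<omega> T) \<partial>path_law t y [T]) = (\<integral>\<^sup>+ z. \<integral>\<^sup>+ \<omega>. f (fun_upd \<omega> T z T) \<partial>path_law T z [] \<partial>k t T y)"
    using Nil f by (intro nn_integral_path_law_Cons measurable_path_coord) auto
  also have "\<dots> = (\<integral>\<^sup>+ z. f z \<partial>k t T y)"
    by (simp add: P.emeasure_space_1 del: path_law.simps)
  finally show ?case by simp
next
  case (Cons r ts)
  have "(\<integral>\<^sup>+ \<omega>. f (\<omega> T) \<partial>path_law t y ((r # ts) @ [T]))
      = (\<integral>\<^sup>+ z. \<integral>\<^sup>+ \<omega>. f (fun_upd \<omega> r z T) \<partial>path_law r z (ts @ [T]) \<partial>k t r y)"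
    unfolding append_Cons using Cons.prems f
    by (intro nn_integral_path_law_Cons measurable_path_coord) auto
  also have "\<dots> = (\<integral>\<^sup>+ z. \<integral>\<^sup>+ w. f w \<partial>k r T z \<partial>k t r y)"
    using Cons by (intro nn_integral_cong) auto
  also have "\<dots> = (\<integral>\<^sup>+ w. f w \<partial>k t T y)"
    using Cons.prems f by (intro nn_integral_k_comp[symmetric]) auto
  finally show ?case .
qed

text \<open>
  A maximal inequality: stop at the first time at which the martingale \<open>m\<close> falls below \<open>d\<close>.
\<close>

lemma nn_integral_path_law_below:
  fixes \<psi> :: "ennreal \<Rightarrow> real" and T :: real
  assumes \<psi>: "\<psi> \<in> borel_measurable borel" "\<And>y. 0 \<le> \<psi> y" "\<And>y. \<psi> y \<le> B"
  defines "m \<equiv> \<lambda>r y. \<integral>z. \<psi> z \<partial>k r T y"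
  assumes "0 \<le> t" "sorted (t # ts @ [T])" "distinct (ts @ [T])"
  shows "(\<integral>\<^sup>+ \<omega>. ennreal (\<psi> (\<omega> T)) * indicator {\<omega>. \<exists>r\<in>set ts. m r (\<omega> r) < d} \<omega> \<partial>path_law t y (ts @ [T]))
    \<le> ennreal d"
  using assms(5-)
proof (induction ts arbitrary: t y)
  case (Cons r ts)
  have r: "0 \<le> t" "t \<le> r" "r \<le> T" "sorted (r # ts @ [T])" "distinct (ts @ [T])" "r \<notin> set ts" "r \<noteq> T"
    using Cons.prems by auto
  have m_meas: "m q \<in> borel_measurable borel" if "q \<in> set (r # ts)" for q
    unfolding m_def using that Cons.prems \<psi> by (intro borel_measurable_integral_k) (auto simp: sorted_append)
  have F: "(\<lambda>\<omega>. ennreal (\<psi> (\<omega> T)) * indicator {\<omega>. \<exists>q\<in>set (r # ts). m q (\<omega> q) < d} \<omega>)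
      \<in> borel_measurable (path_space (set (r # ts @ [T])))"
  proof -
    have mm: "(\<lambda>\<omega>. m q (\<omega> q)) \<in> borel_measurable (path_space (set (r # ts @ [T])))" if "q \<in> set (r # ts)" for q
      using that by (intro measurable_path_coord m_meas) auto
    have [measurable]: "(\<lambda>\<omega>. \<psi> (\<omega> T)) \<in> borel_measurable (path_space (set (r # ts @ [T])))"
      by (intro measurable_path_coord \<psi>) auto
    have [measurable]: "Measurable.pred (path_space (set (r # ts @ [T]))) (\<lambda>\<omega>. \<exists>q\<in>set (r # ts). m q (\<omega> q) < d)"
      using mm by (intro pred_intros_finite) (auto intro!: borel_measurable_pred_less)
    show ?thesis by measurable
  qed
  \<comment> \<open>If the martingale is below \<open>d\<close> already at \<open>r\<close>, the
    event is certain; otherwise only the later times count.\<close>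
  have upd: "ennreal (\<psi> (fun_upd \<omega> r z T)) * indicator {\<omega>. \<exists>q\<in>set (r # ts). m q (\<omega> q) < d} (fun_upd \<omega> r z)
     = ennreal (\<psi> (\<omega> T)) * (if m r z < d then 1 else indicator {\<omega>. \<exists>q\<in>set ts. m q (\<omega> q) < d} \<omega>)" for \<omega> z
    using r by (auto simp: indicator_def)
  have "(\<integral>\<^sup>+ \<omega>. ennreal (\<psi> (\<omega> T)) * indicator {\<omega>. \<exists>q\<in>set (r # ts). m q (\<omega> q) < d} \<omega> \<partial>path_law t y ((r # ts) @ [T]))
     = (\<integral>\<^sup>+ z. \<integral>\<^sup>+ \<omega>. ennreal (\<psi> (\<omega> T)) * (if m r z < d then 1 else indicator {\<omega>. \<exists>q\<in>set ts. m q (\<omega> q) < d} \<omega>)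
          \<partial>path_law r z (ts @ [T]) \<partial>k t r y)"
    unfolding append_Cons using Cons.prems
    by (subst nn_integral_path_law_Cons[OF _ _ F]) (simp_all only: upd append_Cons)
  also have "\<dots> \<le> (\<integral>\<^sup>+ z. ennreal d \<partial>k t r y)"
  proof (intro nn_integral_mono)
    fix z
    show "(\<integral>\<^sup>+ \<omega>. ennreal (\<psi> (\<omega> T)) * (if m r z < d then 1 else indicator {\<omega>. \<exists>q\<in>set ts. m q (\<omega> q) < d} \<omega>)
          \<partial>path_law r z (ts @ [T])) \<le> ennreal d"
    \<comment> \<open>Stopped at \<open>r\<close>: the remaining mean of the terminal value is
      \<open>m r z\<close>, hence below \<open>d\<close>. Not stopped: the induction hypothesis,
      started from \<open>z\<close> at time \<open>r\<close>, gives the bound.\<close>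
    proof (cases "m r z < d")
      case True
      have "(\<integral>\<^sup>+ \<omega>. ennreal (\<psi> (\<omega> T)) \<partial>path_law r z (ts @ [T])) = (\<integral>\<^sup>+ w. ennreal (\<psi> w) \<partial>k r T z)"
        using r \<psi> by (intro nn_integral_path_law_last) auto
      also have "\<dots> = ennreal (m r z)"
        unfolding m_def using r \<psi> by (intro nn_integral_k_eq_integral) auto
      finally show ?thesis using True by (simp add: ennreal_leI)
    next
      case False
      then show ?thesis using r Cons.IH[of r z] by simp
    qed
  qed
  also have "\<dots> = ennreal d"
    using prob_space.emeasure_space_1[OF prob_space_k[of t r y]] r by simp
  finally show ?case .
qed simp

end

section \<open>Almost sure behaviour of the process\<close>

locale branching_process = branching_family k + prob_space N
  for k :: "real \<Rightarrow> real \<Rightarrow> ennreal \<Rightarrow> ennreal measure" and N :: "'w measure" +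
  fixes s :: real and x :: ennreal and X :: "real \<Rightarrow> 'w \<Rightarrow> ennreal"
  assumes s_nonneg: "0 \<le> s"
    and X_measurable: "s \<le> t \<Longrightarrow> X t \<in> borel_measurable N"
    and X_law: "finite J \<Longrightarrow> J \<subseteq> {s..} \<Longrightarrow>
       distr N (PiM J (\<lambda>_. borel)) (\<lambda>\<omega>. \<lambda>j\<in>J. X j \<omega>) = path_law s x (sorted_list_of_set J)"
begin

lemma nn_integral_X:
  assumes "finite J" "J \<subseteq> {s..}" and F: "F \<in> borel_measurable (path_space J)"
  shows "(\<integral>\<^sup>+ \<omega>. F (\<lambda>j\<in>J. X j \<omega>) \<partial>N) = (\<integral>\<^sup>+ \<omega>. F \<omega> \<partial>path_law s x (sorted_list_of_set J))"
  unfolding X_law[OF assms(1,2), symmetric] using assms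
  by (intro nn_integral_distr[symmetric] measurable_restrict X_measurable F) auto

lemma nn_integral_X_prod:
  assumes J: "finite J" "J \<subseteq> {s..}" and \<phi>: "\<And>r. \<phi> r \<in> borel_measurable borel"
  shows "(\<integral>\<^sup>+ \<omega>. (\<Prod>r\<in>J. \<phi> r (X r \<omega>)) \<partial>N) = cyl \<phi> s x (sorted_list_of_set J)"
proof -
  have "(\<integral>\<^sup>+ \<omega>. (\<Prod>r\<in>J. \<phi> r (X r \<omega>)) \<partial>N) = (\<integral>\<^sup>+ \<omega>. (\<Prod>r\<in>J. \<phi> r ((\<lambda>j\<in>J. X j \<omega>) r)) \<partial>N)"
    by (intro nn_integral_cong prod.cong) auto
  also have "\<dots> = (\<integral>\<^sup>+ \<omega>. (\<Prod>r\<in>J. \<phi> r (\<omega> r)) \<partial>path_law s x (sorted_list_of_set J))"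
    using J by (intro nn_integral_X[of J "\<lambda>\<omega>. \<Prod>r\<in>J. \<phi> r (\<omega> r)"] borel_measurable_prod_ennreal measurable_path_coord \<phi>) auto
  also have "\<dots> = cyl \<phi> s x (sorted_list_of_set J)"
    using nn_integral_path_law_prod[of \<phi> s "sorted_list_of_set J" x] J \<phi> s_nonneg by auto
  finally show ?thesis .
qed

text \<open>Stated for a joint function because the squared increments to which it is applied are
  not products.\<close>

lemma nn_integral_X_pair:
  assumes "s \<le> t" "t < u" and F: "(\<lambda>(y, z). F y z) \<in> borel_measurable (borel \<Otimes>\<^sub>M borel)"
  shows "(\<integral>\<^sup>+ \<omega>. F (X t \<omega>) (X u \<omega>) \<partial>N) = (\<integral>\<^sup>+ y. \<integral>\<^sup>+ z. F y z \<partial>k t u y \<partial>k s t x)"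
proof -
  have tu: "sorted_list_of_set {t, u} = [t, u]"
    using assms by (simp add: insort_is_Cons)
  have s: "0 \<le> s" "0 \<le> t" "0 \<le> u" using s_nonneg assms by auto
  interpret P: prob_space "path_law u z []" for z using s by (intro prob_space_path_law) auto
  have Fm: "(\<lambda>\<omega>. F (\<omega> t) (\<omega> u)) \<in> borel_measurable (path_space {t, u})"
  proof -
    have "(\<lambda>\<omega>. (\<omega> t, \<omega> u)) \<in> path_space {t, u} \<rightarrow>\<^sub>M borel \<Otimes>\<^sub>M borel"
      by (intro measurable_Pair measurable_path_coord[where f="\<lambda>y. y"]) auto
    from measurable_compose[OF this F] show ?thesis by simp
  qed
  have Fm': "(\<lambda>\<omega>. F y (\<omega> u)) \<in> borel_measurable (path_space {u})" for y
    using measurable_path_coord[of u "{u}" "F y"] measurable_Pair2[OF F, of y] by simp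
  have "(\<integral>\<^sup>+ \<omega>. F (X t \<omega>) (X u \<omega>) \<partial>N) = (\<integral>\<^sup>+ \<omega>. F (\<omega> t) (\<omega> u) \<partial>path_law s x [t, u])"
    using nn_integral_X[of "{t, u}" "\<lambda>\<omega>. F (\<omega> t) (\<omega> u)"] assms Fm by (simp add: tu del: path_law.simps)
  also have "\<dots> = (\<integral>\<^sup>+ y. \<integral>\<^sup>+ \<omega>. F y (\<omega> u) \<partial>path_law t y [u] \<partial>k s t x)"
    using assms Fm s by (subst nn_integral_path_law_Cons) (auto simp del: path_law.simps)
  also have "\<dots> = (\<integral>\<^sup>+ y. \<integral>\<^sup>+ z. F y z \<partial>k t u y \<partial>k s t x)"
  proof (rule nn_integral_cong)
    fix y
    show "(\<integral>\<^sup>+ \<omega>. F y (\<omega> u) \<partial>path_law t y [u]) = (\<integral>\<^sup>+ z. F y z \<partial>k t u y)"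
      using assms Fm' s by (subst nn_integral_path_law_Cons)
        (auto simp: P.emeasure_space_1 simp del: path_law.simps)
  qed
  finally show ?thesis .
qed

lemma AE_X_initial: "AE \<omega> in N. X s \<omega> = x"
proof -
  have [measurable]: "X s \<in> borel_measurable N" by (rule X_measurable) simp
  have "(\<integral>\<^sup>+ \<omega>. (\<Prod>r\<in>{s}. indicator {y. y \<noteq> x} (X r \<omega>)) \<partial>N) = cyl (\<lambda>_. indicator {y. y \<noteq> x}) s x (sorted_list_of_set {s})"
    by (rule nn_integral_X_prod) auto
  also have "\<dots> = 0" using s_nonneg by (simp add: k_refl nn_integral_return)
  finally have "(\<integral>\<^sup>+ \<omega>. indicator {y. y \<noteq> x} (X s \<omega>) \<partial>N) = 0" by simp
  then have "AE \<omega> in N. indicator {y. y \<noteq> x} (X s \<omega>) = (0::ennreal)"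
    by (subst (asm) nn_integral_0_iff_AE) auto
  then show ?thesis by (auto simp: indicator_def split: if_splits)
qed

abbreviation Y :: "'w \<Rightarrow> real \<Rightarrow> real" where
  "Y \<omega> t \<equiv> expneg (X t \<omega>)"

text \<open>Given the value \<open>y\<close> at time \<open>t\<close>, the mean square increment is
  \<open>v n y\<close>. It tends to 0 for each \<open>y\<close> and is at most 1, so dominated
  convergence applies under the law at time \<open>t\<close>.\<close>

lemma stochastically_right_continuous:
  assumes t: "s \<le> t" and q: "\<And>n. t < q n" "q \<longlonglongrightarrow> t"
  shows "(\<lambda>n. \<integral>\<^sup>+ \<omega>. ennreal ((Y \<omega> (q n) - Y \<omega> t)\<^sup>2) \<partial>N) \<longlonglongrightarrow> 0"
proof -
  define v where "v n y = (\<integral>z. (expneg z - expneg y)\<^sup>2 \<partial>k t (q n) y)" for n y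
  have tq: "0 \<le> t" "\<And>n. t \<le> q n" using q(1) t s_nonneg by (auto simp: less_imp_le)
  have bd: "(expneg z - expneg y)\<^sup>2 \<le> 1" for y z
    by (intro abs_square_le_1[THEN iffD2]) (smt (verit) expneg_nonneg expneg_le_1)
  have v01: "0 \<le> v n y" "v n y \<le> 1" for n y
    using integral_k_bound[of t "q n" "\<lambda>z. (expneg z - expneg y)\<^sup>2" 1 y] bd tq
    by (auto simp: v_def)
  have v_nn: "(\<integral>\<^sup>+ z. ennreal ((expneg z - expneg y)\<^sup>2) \<partial>k t (q n) y) = ennreal (v n y)" for n y
    unfolding v_def using tq bd by (intro nn_integral_k_eq_integral[where B=1]) auto
  have v_lim: "(\<lambda>n. v n y) \<longlonglongrightarrow> 0" for y
  \<comment> \<open>K3 does not cover \<top>; there K6 makes the increment vanish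
    identically.\<close>
  proof (cases "y = \<top>")
    case True
    then show ?thesis unfolding v_def using tq by (simp add: k_top integral_return)
  next
    case False
    have "continuous_on {t..} (\<lambda>u. \<integral>z. (expneg z - expneg y)\<^sup>2 \<partial>k t u y)"
      using False tq by (intro continuous_on_integral_k continuous_intros continuous_on_expneg) auto
    from continuous_on_tendsto_compose[OF this q(2)] show ?thesis
      using tq by (simp add: v_def integral_k_refl)
  qed
  interpret K: prob_space "k s t x" using t s_nonneg by (intro prob_space_k)
  have v_meas: "v n \<in> borel_measurable (k s t x)" for n
  proof -
    have "(\<lambda>y. enn2real (\<integral>\<^sup>+ z. ennreal ((expneg z - expneg y)\<^sup>2) \<partial>k t (q n) y)) \<in> borel_measurable borel"
      using tq by (intro borel_measurable_enn2real
         nn_integral_measurable_subprob_algebra2[OF _ k_subprob_algebra]) auto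
    then show ?thesis using v01 t s_nonneg by (simp add: v_nn measurable_k)
  qed
  have "(\<lambda>n. \<integral>\<^sup>+ y. ennreal (v n y) \<partial>k s t x) \<longlonglongrightarrow> (\<integral>\<^sup>+ y. 0 \<partial>k s t x)"
  proof (rule nn_integral_dominated_convergence[where w="\<lambda>_. 1"])
    show "AE y in k s t x. (\<lambda>n. ennreal (v n y)) \<longlonglongrightarrow> 0"
      using tendsto_ennrealI[OF v_lim] by simp
  qed (use v_meas v01 in \<open>auto simp: K.emeasure_space_1\<close>)
  moreover have "(\<integral>\<^sup>+ \<omega>. ennreal ((Y \<omega> (q n) - Y \<omega> t)\<^sup>2) \<partial>N) = (\<integral>\<^sup>+ y. ennreal (v n y) \<partial>k s t x)" for n
    unfolding v_nn[symmetric] using q(1) t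
    by (intro nn_integral_X_pair[where F="\<lambda>y z. ennreal ((expneg z - expneg y)\<^sup>2)"]) auto
  ultimately show ?thesis by simp
qed

text \<open>By Fatou, mean square convergence to \<open>Y \<omega> t\<close> identifies any almost
  sure limit along the same sequence.\<close>

lemma AE_limit_eq_X:
  assumes t: "s \<le> t" and q: "\<And>n. t < q n" "q \<longlonglongrightarrow> t"
    and L: "AE \<omega> in N. (\<lambda>n. Y \<omega> (q n)) \<longlonglongrightarrow> L \<omega>"
  shows "AE \<omega> in N. L \<omega> = Y \<omega> t"
proof -
  have [measurable]: "X t \<in> borel_measurable N" "\<And>n. X (q n) \<in> borel_measurable N"
    using t q(1) by (auto intro!: X_measurable simp: less_imp_le order.trans[OF t])
  have "(\<integral>\<^sup>+ \<omega>. liminf (\<lambda>n. ennreal ((Y \<omega> (q n) - Y \<omega> t)\<^sup>2)) \<partial>N)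
     \<le> liminf (\<lambda>n. \<integral>\<^sup>+ \<omega>. ennreal ((Y \<omega> (q n) - Y \<omega> t)\<^sup>2) \<partial>N)"
    by (intro nn_integral_liminf) measurable
  also have "\<dots> = 0"
    using stochastically_right_continuous[OF t q] by (intro lim_imp_Liminf) auto
  finally have "AE \<omega> in N. liminf (\<lambda>n. ennreal ((Y \<omega> (q n) - Y \<omega> t)\<^sup>2)) = 0"
    by (subst (asm) le_zero_eq, subst (asm) nn_integral_0_iff_AE) auto
  then show ?thesis using L
  proof eventually_elim
    case (elim \<omega>)
    have "(\<lambda>n. ennreal ((Y \<omega> (q n) - Y \<omega> t)\<^sup>2)) \<longlonglongrightarrow> ennreal ((L \<omega> - Y \<omega> t)\<^sup>2)"
      by (intro tendsto_ennrealI tendsto_intros elim)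
    then have "liminf (\<lambda>n. ennreal ((Y \<omega> (q n) - Y \<omega> t)\<^sup>2)) = ennreal ((L \<omega> - Y \<omega> t)\<^sup>2)"
      by (intro lim_imp_Liminf) auto
    with elim(1) show ?case by simp
  qed
qed

text \<open>
  The greedy count is not monotone in the set of times, so Fatou's lemma only bounds it frequently.
\<close>

lemma AE_few_osc:
  assumes "s \<le> T" "exhaustion F Q" "Q \<subseteq> {s..T}"
  shows "AE \<omega> in N. \<forall>m. \<exists>K. \<exists>\<^sub>F n in sequentially.
     osc_set (1 / real (Suc m)) 0 (\<lambda>r. laplace r T (X r \<omega>)) (F n) \<le> K"
  unfolding AE_all_countable
proof
  fix m
  define e where "e = 1 / real (Suc m)"
  have e: "0 < e" by (simp add: e_def)
  interpret exhaustion F Q by fact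
  have FT: "F n \<subseteq> {s..T}" for n using F(3) assms(3) by auto
  define g where "g n \<omega> = osc_set e 0 (\<lambda>r. laplace r T (X r \<omega>)) (F n)" for n \<omega>
  have L: "laplace r T \<in> borel_measurable borel" if "r \<in> {s..T}" for r
    unfolding laplace_def using that s_nonneg by (intro borel_measurable_integral_k) auto
  have [measurable]: "g n \<in> N \<rightarrow>\<^sub>M count_space UNIV" for n
    unfolding g_def
  proof (rule measurable_osc)
    fix r assume "r \<in> set (sorted_list_of_set (F n))"
    then have "r \<in> {s..T}" using FT[of n] F(2)[of n] by auto
    then show "(\<lambda>\<omega>. laplace r T (X r \<omega>)) \<in> borel_measurable N"
      by (intro measurable_compose[OF X_measurable L]) auto
  qed simp
  have "(\<integral>\<^sup>+ \<omega>. ennreal (e\<^sup>2 * real (g n \<omega>)) \<partial>N) \<le> 1" for n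
  proof -
    have eq: "map (\<lambda>r. laplace r T (X r \<omega>)) (sorted_list_of_set (F n))
       = map (\<lambda>r. laplace r T ((\<lambda>j\<in>F n. X j \<omega>) r)) (sorted_list_of_set (F n))" for \<omega>
      using F(2) by simp
    have meas: "(\<lambda>\<omega>. ennreal (e\<^sup>2 * real (osc_set e 0 (\<lambda>r. laplace r T (\<omega> r)) (F n)))) \<in> borel_measurable (path_space (F n))"
    proof -
      have [measurable]: "(\<lambda>\<omega>. osc_set e 0 (\<lambda>r. laplace r T (\<omega> r)) (F n)) \<in> path_space (F n) \<rightarrow>\<^sub>M count_space UNIV"
      proof (rule measurable_osc)
        fix r assume "r \<in> set (sorted_list_of_set (F n))"
        then have "r \<in> F n" "r \<in> {s..T}" using FT[of n] F(2)[of n] by auto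
        then show "(\<lambda>\<omega>. laplace r T (\<omega> r)) \<in> borel_measurable (path_space (F n))"
          by (intro measurable_path_coord L)
      qed simp
      show ?thesis by measurable
    qed
    have "(\<integral>\<^sup>+ \<omega>. ennreal (e\<^sup>2 * real (g n \<omega>)) \<partial>N)
      = (\<integral>\<^sup>+ \<omega>. ennreal (e\<^sup>2 * real (osc_set e 0 (\<lambda>r. laplace r T (\<omega> r)) (F n))) \<partial>path_law s x (sorted_list_of_set (F n)))"
      unfolding g_def eq using FT F(2) by (intro nn_integral_X meas) fastforce+
    \<comment> \<open>The oscillation estimate with the initial reference value 0: the bound is a
      second moment at the horizon and does not depend on \<open>n\<close>.\<close>
    also have "\<dots> \<le> ennreal (\<integral>z. (expneg z - 0)\<^sup>2 \<partial>k s T x)"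
      unfolding laplace_def using FT[of n] F(2)[of n] s_nonneg assms(1) e
      by (intro nn_integral_osc_path_law[where B=1]) auto
    also have "\<dots> \<le> ennreal 1"
      using integral_k_bound[of s T "\<lambda>z. (expneg z)\<^sup>2" 1 x] s_nonneg assms(1)
      by (intro ennreal_leI) (auto simp: power_le_one)
    finally show ?thesis by simp
  qed
  then have "(\<integral>\<^sup>+ \<omega>. liminf (\<lambda>n. ennreal (e\<^sup>2 * real (g n \<omega>))) \<partial>N) \<le> 1"
    by (intro order.trans[OF nn_integral_liminf] order.trans[OF Liminf_le_Limsup] Limsup_bounded) auto
  then have "AE \<omega> in N. liminf (\<lambda>n. ennreal (e\<^sup>2 * real (g n \<omega>))) \<noteq> \<infinity>"
    by (intro nn_integral_noteq_infinite) (auto simp: top_unique)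
  then show "AE \<omega> in N. \<exists>K. \<exists>\<^sub>F n in sequentially. osc_set (1 / real (Suc m)) 0 (\<lambda>r. laplace r T (X r \<omega>)) (F n) \<le> K"
  proof eventually_elim
    case (elim \<omega>)
    then obtain c where c: "liminf (\<lambda>n. ennreal (e\<^sup>2 * real (g n \<omega>))) = ennreal c" "0 \<le> c"
      by (cases "liminf (\<lambda>n. ennreal (e\<^sup>2 * real (g n \<omega>)))") auto
    obtain K :: nat where K: "c / e\<^sup>2 < real K" using reals_Archimedean2 by blast
    have "\<exists>\<^sub>F n in sequentially. g n \<omega> \<le> K"
    proof (rule ccontr)
      assume "\<not> ?thesis"
      then have "\<forall>\<^sub>F n in sequentially. ennreal (e\<^sup>2 * real K) \<le> ennreal (e\<^sup>2 * real (g n \<omega>))"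
        unfolding not_frequently using e by (auto elim!: eventually_mono intro!: ennreal_leI mult_left_mono)
      then have "ennreal (e\<^sup>2 * real K) \<le> ennreal c" unfolding c(1)[symmetric] by (rule Liminf_bounded)
      then have "e\<^sup>2 * real K \<le> c" using c(2) by (simp add: ennreal_le_iff)
      with K e show False by (simp add: field_simps)
    qed
    then show ?case by (auto simp: g_def e_def)
  qed
qed

text \<open>The maximal inequality bounds the terminal mass on the event that the martingale falls
  below \<open>d\<close> by \<open>d\<close>, first along finite sets and then along
  \<open>Q\<close>. Letting \<open>d\<close> tend to 0 leaves no mass where it comes arbitrarily
  close to 0.\<close>

lemma AE_hits_zero:
  fixes \<psi> :: "ennreal \<Rightarrow> real"
  assumes \<psi>: "\<psi> \<in> borel_measurable borel" "\<And>y. 0 \<le> \<psi> y" "\<And>y. \<psi> y \<le> B"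
    and T: "s \<le> T" and Q: "countable Q" "Q \<subseteq> {s..<T}"
  shows "AE \<omega> in N. (\<forall>n. \<exists>q\<in>Q. (\<integral>z. \<psi> z \<partial>k q T (X q \<omega>)) < 1 / real (Suc n)) \<longrightarrow> \<psi> (X T \<omega>) = 0"
proof -
  define m where "m r y = (\<integral>z. \<psi> z \<partial>k r T y)" for r y
  obtain F where "exhaustion F Q" using countable_exhaustion[OF Q(1)] by blast
  then interpret exhaustion F Q .
  have FT: "F n \<subseteq> {s..<T}" for n using F(3) Q(2) by auto
  have m_meas: "m r \<in> borel_measurable borel" if "r \<in> {s..<T}" for r
    unfolding m_def using that s_nonneg \<psi> by (intro borel_measurable_integral_k) auto
  have [measurable]: "X T \<in> borel_measurable N" by (rule X_measurable) fact
  note \<psi>(1)[measurable]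
  have mX: "(\<lambda>\<omega>. m q (X q \<omega>)) \<in> borel_measurable N" if "q \<in> {s..<T}" for q
    using that by (intro measurable_compose[OF X_measurable m_meas]) auto
  define A where "A d n = {\<omega>\<in>space N. \<exists>q\<in>F n. m q (X q \<omega>) < d}" for d n
  have A [measurable]: "A d n \<in> sets N" for d n
  proof -
    have "A d n = (\<Union>q\<in>F n. {\<omega>\<in>space N. m q (X q \<omega>) < d})" by (auto simp: A_def)
    also have "\<dots> \<in> sets N"
      using FT[of n] F(2)[of n] by (intro sets.finite_UN borel_measurable_less mX borel_measurable_const) auto
    finally show ?thesis .
  qed
  \<comment> \<open>Weighting by the terminal value turns the maximal inequality into a bound on the
    measure of \<open>A d n\<close>, so continuity from below handles the union over
    \<open>n\<close>.\<close>
  let ?M = "density N (\<lambda>\<omega>. ennreal (\<psi> (X T \<omega>)))"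
  have bound: "emeasure ?M (A d n) \<le> ennreal d" for d n
  proof -
    have TF: "sorted_list_of_set (F n \<union> {T}) = sorted_list_of_set (F n) @ [T]"
      using F(2)[of n] FT[of n] by (subst sorted_list_of_set_Un_less) auto
    have so: "sorted (s # sorted_list_of_set (F n) @ [T])" "distinct (sorted_list_of_set (F n) @ [T])"
      using F(2)[of n] FT[of n] T by (auto simp: sorted_append)
    let ?G = "\<lambda>\<omega>. ennreal (\<psi> (\<omega> T)) * indicator {\<omega>. \<exists>r\<in>set (sorted_list_of_set (F n)). m r (\<omega> r) < d} \<omega>"
    have G: "?G \<in> borel_measurable (path_space (F n \<union> {T}))"
    proof -
      have mm: "(\<lambda>\<omega>. m q (\<omega> q)) \<in> borel_measurable (path_space (F n \<union> {T}))" if "q \<in> F n" for q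
        using that FT[of n] by (intro measurable_path_coord m_meas) auto
      have [measurable]: "(\<lambda>\<omega>. \<psi> (\<omega> T)) \<in> borel_measurable (path_space (F n \<union> {T}))"
        by (intro measurable_path_coord \<psi>) auto
      have [measurable]: "Measurable.pred (path_space (F n \<union> {T})) (\<lambda>\<omega>. \<exists>q\<in>set (sorted_list_of_set (F n)). m q (\<omega> q) < d)"
        using mm F(2)[of n] by (intro pred_intros_finite borel_measurable_pred_less) auto
      show ?thesis by measurable
    qed
    have "emeasure ?M (A d n) = (\<integral>\<^sup>+ \<omega>. ennreal (\<psi> (X T \<omega>)) * indicator (A d n) \<omega> \<partial>N)"
      by (rule emeasure_density) measurable
    also have "\<dots> = (\<integral>\<^sup>+ \<omega>. ?G (\<lambda>j\<in>F n \<union> {T}. X j \<omega>) \<partial>N)"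
      using F(2)[of n] by (intro nn_integral_cong) (auto simp: A_def indicator_def)
    also have "\<dots> = (\<integral>\<^sup>+ \<omega>. ?G \<omega> \<partial>path_law s x (sorted_list_of_set (F n \<union> {T})))"
      using F(2)[of n] FT[of n] T by (intro nn_integral_X G) auto
    also have "\<dots> \<le> ennreal d"
      unfolding TF m_def using s_nonneg \<psi> so by (intro nn_integral_path_law_below) auto
    finally show ?thesis .
  qed
  define C where "C d = (\<Union>n. A d n)" for d
  have C: "emeasure ?M (C d) \<le> ennreal d" for d
  proof -
    have "incseq (A d)" using F(1) unfolding incseq_def A_def by blast
    then have "emeasure ?M (C d) = (SUP n. emeasure ?M (A d n))"
      unfolding C_def by (intro SUP_emeasure_incseq[symmetric]) auto
    then show ?thesis using bound by (simp add: SUP_least)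
  qed
  have C_iff: "\<omega> \<in> C d \<longleftrightarrow> (\<exists>q\<in>Q. m q (X q \<omega>) < d)" if "\<omega> \<in> space N" for \<omega> d
    using that F(3) by (auto simp: C_def A_def)
  define D where "D = (\<Inter>n. C (1 / real (Suc n)))"
  have D [measurable]: "D \<in> sets N" unfolding D_def C_def by auto
  have "emeasure ?M D \<le> ennreal (1 / real (Suc n))" for n
    by (intro order.trans[OF emeasure_mono C]) (auto simp: D_def C_def)
  then have "(\<integral>\<^sup>+ \<omega>. ennreal (\<psi> (X T \<omega>)) * indicator D \<omega> \<partial>N) \<le> ennreal (1 / real (Suc n))" for n
    by (subst (asm) emeasure_density) auto
  moreover have "(\<lambda>n. ennreal (1 / real (Suc n))) \<longlonglongrightarrow> 0"
    using tendsto_ennrealI[OF LIMSEQ_Suc[OF lim_1_over_n]] by simp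
  ultimately have "(\<integral>\<^sup>+ \<omega>. ennreal (\<psi> (X T \<omega>)) * indicator D \<omega> \<partial>N) \<le> 0"
    by (intro LIMSEQ_le_const[where X="\<lambda>n. ennreal (1 / real (Suc n))"]) auto
  then have "AE \<omega> in N. ennreal (\<psi> (X T \<omega>)) * indicator D \<omega> = 0"
    by (subst (asm) le_zero_eq, subst (asm) nn_integral_0_iff_AE) auto
  then show ?thesis
    using AE_space
  proof eventually_elim
    case (elim \<omega>)
    then show ?case using \<psi>(2)[of "X T \<omega>"]
      by (auto simp: D_def C_iff m_def[symmetric] ennreal_eq_0_iff split: split_indicator_asm)
  qed
qed

end

section \<open>Regularisation into the path space\<close>

text \<open>What a path must satisfy along the rationals to be completed in \<open>Dpaths\<close>,
  in the coordinate \<open>expneg\<close>: the value 0 stands for \<infinity> and 1 for 0.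
  Absorption is required at rational \<open>q\<close> only, which is all that \<open>rlim\<close>
  sees, but after every real \<open>r\<close>. The last clause makes the path start in
  \<open>x\<close> at time \<open>s\<close>.\<close>

definition regular :: "real \<Rightarrow> ennreal \<Rightarrow> (real \<Rightarrow> real) \<Rightarrow> bool" where
  "regular s x f \<longleftrightarrow> (\<forall>q. 0 \<le> f q \<and> f q \<le> 1) \<and>
     (\<forall>t\<ge>s. \<exists>l. (f \<longlongrightarrow> l) (rat_right t)) \<and>
     (\<forall>t>s. \<exists>l. (f \<longlongrightarrow> l) (rat_left t)) \<and>
     (\<forall>r q v. q \<in> \<rat> \<and> v \<in> {0, 1} \<and> r < q \<and>
        (s \<le> r \<and> (f \<longlongrightarrow> v) (rat_right r) \<or> s < r \<and> (f \<longlongrightarrow> v) (rat_left r)) \<longrightarrow> f q = v) \<and>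
     rlim f s = expneg x"

text \<open>
  The values before time \<open>s\<close> are irrelevant for \<open>G {s..}\<close>; the constant \<open>x\<close> keeps the path in \<open>Dpaths\<close>.
\<close>

definition extend_path :: "real \<Rightarrow> ennreal \<Rightarrow> (real \<Rightarrow> real) \<Rightarrow> real \<Rightarrow> ennreal" where
  "extend_path s x f t = (if t < 0 then 0 else if t < s then x else neglog (rlim f t))"

lemma regular_const: "regular s x (\<lambda>_. expneg x)"
proof -
  have "v = expneg x" if "((\<lambda>_. expneg x) \<longlongrightarrow> v) (rat_right r) \<or> ((\<lambda>_. expneg x) \<longlongrightarrow> v) (rat_left r)" for r v
    using that by (simp add: tendsto_const_iff rat_right_ne_bot rat_left_ne_bot)
  moreover have "rlim (\<lambda>_. expneg x) s = expneg x" by (intro rlim_eq tendsto_const)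
  ultimately show ?thesis
    unfolding regular_def by (intro conjI allI impI) (simp, simp, blast, blast, metis, simp)
qed

lemma tendsto_neglog: "(f \<longlongrightarrow> l) F \<Longrightarrow> ((\<lambda>a. neglog (f a)) \<longlongrightarrow> neglog l) F"
  using continuous_on_tendsto_compose[OF continuous_on_neglog] by auto

lemma tendsto_unit_interval:
  assumes "(f \<longlongrightarrow> l) F" "F \<noteq> bot" "\<And>q. 0 \<le> f q \<and> f q \<le> (1::real)"
  shows "0 \<le> l" "l \<le> 1"
  using assms tendsto_lowerbound[OF assms(1), of 0] tendsto_upperbound[OF assms(1), of 1] by auto

text \<open>Right continuity and left limits come from \<open>rlim\<close>. Absorption holds because
  once \<open>f\<close> is constant at all later rationals, so is \<open>rlim f\<close>. The rest
  glues the constant piece before \<open>s\<close> to the regularised piece.\<close>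

lemma extend_path_in_Dpaths:
  assumes reg: "regular s x f" and s: "0 \<le> s"
  shows "extend_path s x f \<in> Dpaths"
proof -
  have f01: "\<And>q. 0 \<le> f q \<and> f q \<le> 1"
    and R: "\<And>t. s \<le> t \<Longrightarrow> \<exists>l. (f \<longlongrightarrow> l) (rat_right t)"
    and L: "\<And>t. s < t \<Longrightarrow> \<exists>l. (f \<longlongrightarrow> l) (rat_left t)"
    and abs_R: "\<And>r q v. q \<in> \<rat> \<Longrightarrow> v \<in> {0, 1} \<Longrightarrow> r < q \<Longrightarrow> s \<le> r \<Longrightarrow> (f \<longlongrightarrow> v) (rat_right r) \<Longrightarrow> f q = v"
    and abs_L: "\<And>r q v. q \<in> \<rat> \<Longrightarrow> v \<in> {0, 1} \<Longrightarrow> r < q \<Longrightarrow> s < r \<Longrightarrow> (f \<longlongrightarrow> v) (rat_left r) \<Longrightarrow> f q = v"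
    and init: "rlim f s = expneg x"
    using reg unfolding regular_def by blast+
  let ?p = "extend_path s x f"
  have rlim01: "0 \<le> rlim f t" "rlim f t \<le> 1" if "s \<le> t" for t
    using tendsto_unit_interval[OF tendsto_rlim[OF R[OF that]] rat_right_ne_bot f01] by auto
  have p_ge: "?p t = neglog (rlim f t)" if "s \<le> t" for t
    using that s by (simp add: extend_path_def)
  have p_lt: "?p t = x" if "0 \<le> t" "t < s" for t
    using that by (simp add: extend_path_def)
  have rlim_p: "rlim f t = expneg (?p t)" if "s \<le> t" for t
    using rlim01[OF that] by (simp add: p_ge that expneg_neglog)
  have rlim_const: "rlim f u = v" if "\<And>q. q \<in> \<rat> \<Longrightarrow> u < q \<Longrightarrow> f q = v" for u v
  proof (rule rlim_eq, rule tendsto_eventually)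
    show "\<forall>\<^sub>F q in rat_right u. f q = v"
      using that by (auto simp: eventually_at_filter)
  qed
  have expneg01: "expneg r \<in> {0, 1}" if "r \<in> {0, \<top>}" for r using that by auto
  have stay: "?p u = ?p t" if "s \<le> t" "t \<le> u" "?p t \<in> {0, \<top>}" for t u
  proof -
    have "f q = expneg (?p t)" if "q \<in> \<rat>" "u < q" for q
      using that \<open>t \<le> u\<close> \<open>s \<le> t\<close> \<open>?p t \<in> {0, \<top>}\<close> tendsto_rlim[OF R[OF \<open>s \<le> t\<close>]]
      by (intro abs_R[of q _ t] expneg01) (auto simp: rlim_p[symmetric])
    then have "rlim f u = expneg (?p t)" by (rule rlim_const)
    then show ?thesis using that by (simp add: p_ge)
  qed
  have init': "?p s = x" by (simp add: p_ge init)
  \<comment> \<open>Starting before \<open>s\<close>, the path stays at \<open>x\<close> up to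
    \<open>s\<close> and has the value \<open>x\<close> there by \<open>init'\<close>, where
    \<open>stay\<close> takes over.\<close>
  have absorbed: "?p u = ?p t" if "0 \<le> t" "t \<le> u" "?p t \<in> {0, \<top>}" for t u
  proof (cases "s \<le> t")
    case True
    then show ?thesis using stay that by blast
  next
    case False
    then have "?p t = x" using that by (simp add: p_lt)
    show ?thesis
    proof (cases "s \<le> u")
      case True
      have "?p u = ?p s" using \<open>?p t = x\<close> that(3) True init' by (intro stay) auto
      then show ?thesis using \<open>?p t = x\<close> init' by simp
    next
      case False
      then show ?thesis using that \<open>?p t = x\<close> by (simp add: p_lt)
    qed
  qed
  have right: "(?p \<longlongrightarrow> ?p t) (at_right t)" if "0 \<le> t" for t
  proof (cases "s \<le> t")
    case True
    have "((\<lambda>r. neglog (rlim f r)) \<longlongrightarrow> neglog (rlim f t)) (at_right t)"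
      using True by (intro tendsto_neglog rlim_right_continuous R) auto
    moreover have "\<forall>\<^sub>F r in at_right t. neglog (rlim f r) = ?p r"
      using True by (auto simp: eventually_at_filter p_ge)
    ultimately have "(?p \<longlongrightarrow> neglog (rlim f t)) (at_right t)"
      by (rule Lim_transform_eventually)
    then show ?thesis using True by (simp add: p_ge)
  next
    case False
    have "\<forall>\<^sub>F r in at_right t. ?p r = ?p t"
      using False that by (intro eventually_at_rightI[of t s]) (auto simp: p_lt)
    then show ?thesis by (rule tendsto_eventually)
  qed
  have left_const: "(?p \<longlongrightarrow> x) (at_left t)" if "0 < t" "t \<le> s" for t
  proof (rule tendsto_eventually)
    show "\<forall>\<^sub>F r in at_left t. ?p r = x"
      using that by (intro eventually_at_leftI[of 0 t]) (auto simp: p_lt)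
  qed
  have left_rlim: "(?p \<longlongrightarrow> neglog l) (at_left t)" if "s < t" "(f \<longlongrightarrow> l) (rat_left t)" for t l
  proof -
    have "((\<lambda>r. neglog (rlim f r)) \<longlongrightarrow> neglog l) (at_left t)"
      using that by (intro tendsto_neglog rlim_left_limit[of s] R) auto
    moreover have "\<forall>\<^sub>F r in at_left t. neglog (rlim f r) = ?p r"
      using that by (intro eventually_at_leftI[of s t]) (auto simp: p_ge)
    ultimately show ?thesis by (rule Lim_transform_eventually)
  qed
  have left: "\<exists>l. (?p \<longlongrightarrow> l) (at_left t)" if "0 < t" for t
    using left_const[OF that] left_rlim[of t] L[of t] by (cases "t \<le> s") auto
  \<comment> \<open>For \<open>t \<le> s\<close> the left limit is \<open>x\<close>, and the path
    has been absorbed since time 0. For \<open>t > s\<close> it is the left limit of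
    \<open>f\<close> along the rationals, and \<open>abs_L\<close> applies.\<close>
  have left_abs: "?p u = r" if "0 < t" "r \<in> {0, \<top>}" "(?p \<longlongrightarrow> r) (at_left t)" "t \<le> u" for t r u
  proof (cases "t \<le> s")
    case True
    then have "r = x"
      using tendsto_unique[OF _ that(3) left_const[OF that(1)]] by simp
    have "?p 0 = x" using True that(1) by (simp add: p_lt)
    then show ?thesis using absorbed[of 0 u] that \<open>r = x\<close> by simp
  next
    case False
    then obtain l where l: "(f \<longlongrightarrow> l) (rat_left t)" using L by fastforce
    then have "r = neglog l"
      using False tendsto_unique[OF _ that(3) left_rlim] by simp
    then have "l = expneg r"
      using tendsto_unit_interval[OF l rat_left_ne_bot f01] by (simp add: expneg_neglog)
    have "f q = l" if "q \<in> \<rat>" "u < q" for q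
      using that False \<open>t \<le> u\<close> l expneg01[OF \<open>r \<in> {0, \<top>}\<close>] by (intro abs_L[of q l t]) (auto simp: \<open>l = expneg r\<close>)
    then have "rlim f u = l" by (rule rlim_const)
    then show ?thesis using False that \<open>l = expneg r\<close> by (simp add: p_ge)
  qed
  show ?thesis
    unfolding Dpaths_def mem_Collect_eq
  proof (intro conjI allI impI ballI)
    show "?p t = 0" if "t < 0" for t using that by (simp add: extend_path_def)
  qed (fact right left | rule absorbed left_abs, assumption+)+
qed

section \<open>Measurability with respect to the coordinate sigma-algebras\<close>

lemma space_G [simp]: "space (G I) = Dpaths"
  unfolding G_def by (rule space_measure_of) auto

lemma sets_G: "sets (G I) = sigma_sets Dpaths {{\<omega> \<in> Dpaths. \<omega> t \<in> B} | t B. t \<in> I \<and> B \<in> sets borel}"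
  unfolding G_def by (rule sets_measure_of) auto

lemma measurable_G_coord: "t \<in> I \<Longrightarrow> (\<lambda>\<omega>. \<omega> t) \<in> borel_measurable (G I)"
proof (rule measurableI)
  fix B :: "ennreal set" assume "t \<in> I" "B \<in> sets borel"
  moreover have "(\<lambda>\<omega>. \<omega> t) -` B \<inter> space (G I) = {\<omega> \<in> Dpaths. \<omega> t \<in> B}" by auto
  ultimately show "(\<lambda>\<omega>. \<omega> t) -` B \<inter> space (G I) \<in> sets (G I)" unfolding sets_G by auto
qed simp

lemma measurable_G_comp:
  "t \<in> I \<Longrightarrow> f \<in> borel \<rightarrow>\<^sub>M L \<Longrightarrow> (\<lambda>\<omega>. f (\<omega> t)) \<in> G I \<rightarrow>\<^sub>M L"
  by (rule measurable_compose[OF measurable_G_coord])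

lemma measurable_into_G:
  assumes "\<And>\<omega>. \<omega> \<in> space M \<Longrightarrow> \<Phi> \<omega> \<in> Dpaths" "\<And>t. t \<in> I \<Longrightarrow> (\<lambda>\<omega>. \<Phi> \<omega> t) \<in> borel_measurable M"
  shows "\<Phi> \<in> M \<rightarrow>\<^sub>M G I"
  unfolding G_def
proof (rule measurable_measure_of)
  fix A assume "A \<in> {{\<omega> \<in> Dpaths. \<omega> t \<in> B} | t B. t \<in> I \<and> B \<in> sets borel}"
  then obtain t B where A: "A = {\<omega> \<in> Dpaths. \<omega> t \<in> B}" "t \<in> I" "B \<in> sets borel" by blast
  have "\<Phi> -` A \<inter> space M = (\<lambda>\<omega>. \<Phi> \<omega> t) -` B \<inter> space M" using assms(1) by (auto simp: A)
  then show "\<Phi> -` A \<inter> space M \<in> sets M" using measurable_sets[OF assms(2)] A by simp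
qed (use assms(1) in auto)

lemma rat_sequence:
  "\<exists>q. (\<forall>n. t < q n) \<and> q \<longlonglongrightarrow> t \<and> filterlim q (rat_right t) sequentially"
proof -
  have "\<exists>q. \<forall>n. q n \<in> \<rat> \<and> t < q n \<and> q n < t + 1 / real (Suc n)"
  proof (intro choice allI)
    fix n show "\<exists>q. q \<in> \<rat> \<and> t < q \<and> q < t + 1 / real (Suc n)"
      using Rats_dense_in_real[of t "t + 1 / real (Suc n)"] by auto
  qed
  then obtain q where q: "\<And>n. q n \<in> \<rat>" "\<And>n. t < q n" "\<And>n. q n < t + 1 / real (Suc n)" by blast
  have lim: "q \<longlonglongrightarrow> t"
  proof (rule tendsto_sandwich[of "\<lambda>_. t" q _ "\<lambda>n. t + 1 / real (Suc n)"])
    show "(\<lambda>n. t + 1 / real (Suc n)) \<longlonglongrightarrow> t"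
      using tendsto_add[OF tendsto_const LIMSEQ_Suc[OF lim_1_over_n], of t] by simp
  qed (use q(2,3) in \<open>auto simp: less_imp_le\<close>)
  moreover have "filterlim q (rat_right t) sequentially"
    unfolding filterlim_at using lim q(1,2) by (auto simp: less_imp_neq[symmetric])
  ultimately show ?thesis using q by blast
qed

text \<open>Finite-dimensional laws in functional rather than set form, so that the factor produced
  by \<open>cyl_append\<close>, which is not an indicator, is covered.\<close>

definition (in kernel_family) cylinder_law :: "real \<Rightarrow> ennreal \<Rightarrow> (real \<Rightarrow> ennreal) measure \<Rightarrow> bool" where
  "cylinder_law s x P \<longleftrightarrow> (\<forall>J \<phi>. finite J \<and> J \<subseteq> {s..} \<and> (\<forall>r. \<phi> r \<in> borel_measurable borel) \<longrightarrow>
     (\<integral>\<^sup>+ \<omega>. (\<Prod>r\<in>J. \<phi> r (\<omega> r)) \<partial>P) = cyl \<phi> s x (sorted_list_of_set J))"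

context branching_process
begin

text \<open>On each [s, n] the process is recovered as \<open>laplace\<close> to the power
  \<open>1 / cumulant\<close>, a continuous operation, from a martingale with one-sided limits along
  the rationals.\<close>

lemma AE_Y_limits:
  "AE \<omega> in N. (\<forall>t\<ge>s. \<exists>l. (Y \<omega> \<longlongrightarrow> l) (rat_right t)) \<and> (\<forall>t>s. \<exists>l. (Y \<omega> \<longlongrightarrow> l) (rat_left t))"
proof -
  have "AE \<omega> in N. \<forall>n::nat. s \<le> real n \<longrightarrow>
     (\<forall>t. (\<exists>l. ((\<lambda>r. laplace r (real n) (X r \<omega>)) \<longlongrightarrow> l) (at t within (\<rat> \<inter> {s..real n} \<inter> {..<t}))) \<and>
          (\<exists>l. ((\<lambda>r. laplace r (real n) (X r \<omega>)) \<longlongrightarrow> l) (at t within (\<rat> \<inter> {s..real n} \<inter> {t<..}))))"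
    unfolding AE_all_countable
  proof
    fix n :: nat
    show "AE \<omega> in N. s \<le> real n \<longrightarrow>
     (\<forall>t. (\<exists>l. ((\<lambda>r. laplace r (real n) (X r \<omega>)) \<longlongrightarrow> l) (at t within (\<rat> \<inter> {s..real n} \<inter> {..<t}))) \<and>
          (\<exists>l. ((\<lambda>r. laplace r (real n) (X r \<omega>)) \<longlongrightarrow> l) (at t within (\<rat> \<inter> {s..real n} \<inter> {t<..}))))"
    proof (cases "s \<le> real n")
      case True
      have "countable (\<rat> \<inter> {s..real n})" using countable_rat by (rule countable_subset[rotated]) auto
      then obtain F where ex: "exhaustion F (\<rat> \<inter> {s..real n})" by (rule countable_exhaustion)
      from AE_few_osc[OF True ex] have "AE \<omega> in N. \<forall>m. \<exists>K. \<exists>\<^sub>F j in sequentially.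
          osc_set (1 / real (Suc m)) 0 (\<lambda>r. laplace r (real n) (X r \<omega>)) (F j) \<le> K" by simp
      then show ?thesis
      proof eventually_elim
        case (elim \<omega>)
        then have K: "\<And>m. \<exists>K. \<exists>\<^sub>F j in sequentially.
          osc_set (1 / real (Suc m)) 0 (\<lambda>r. laplace r (real n) (X r \<omega>)) (F j) \<le> K" by blast
        show ?case by (intro impI allI conjI exhaustion.one_sided_limits[OF ex K])
      qed
    qed simp
  qed
  then show ?thesis
  proof eventually_elim
    case (elim \<omega>)
    have Y_eq: "Y \<omega> r = laplace r T (X r \<omega>) powr (1 / cumulant r T)" if "s \<le> r" "r \<le> T" for r T
      using that s_nonneg cumulant_pos[of r T] by (simp add: laplace_eq powr_powr)
    have transfer: "\<exists>l. (Y \<omega> \<longlongrightarrow> l) H"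
      if "((\<lambda>r. laplace r T (X r \<omega>)) \<longlongrightarrow> l) H" "\<forall>\<^sub>F r in H. r \<in> {s..T}" "t \<in> {s..T}" "H \<le> nhds t" for H t l T
    proof -
      have "(cumulant t T \<noteq> 0)" using cumulant_pos[of t T] that s_nonneg by auto
      have id: "((\<lambda>r. r) \<longlongrightarrow> t) H" using that(4) by (simp add: filterlim_def)
      have "((\<lambda>r. cumulant r T) \<longlongrightarrow> cumulant t T) H"
        using that s_nonneg by (intro continuous_on_tendsto_compose[OF continuous_on_cumulant id]) (auto elim!: eventually_mono)
      \<comment> \<open>The limit \<open>l\<close> may be 0; \<open>powr\<close> is still continuous
        there for nonnegative bases because the limiting exponent is positive.\<close>
      then have "((\<lambda>r. laplace r T (X r \<omega>) powr (1 / cumulant r T)) \<longlongrightarrow> l powr (1 / cumulant t T)) H"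
        using that s_nonneg cumulant_pos[of t T] laplace_nonneg
        by (intro tendsto_powr' tendsto_intros) auto
      moreover have "\<forall>\<^sub>F r in H. laplace r T (X r \<omega>) powr (1 / cumulant r T) = Y \<omega> r"
        using that(2) by eventually_elim (use Y_eq[of _ T] in simp)
      ultimately show ?thesis by (intro exI[of _ "l powr (1 / cumulant t T)"]) (rule Lim_transform_eventually)
    qed
    show ?case
    proof (intro conjI allI impI)
      fix t assume t: "s \<le> t"
      obtain n where n: "t < real n" using reals_Archimedean2 by blast
      \<comment> \<open>As \<open>n\<close> exceeds \<open>t\<close>, the cut-off at the horizon is
        invisible near \<open>t\<close>.\<close>
      have eq: "at t within (\<rat> \<inter> {s..real n} \<inter> {t<..}) = rat_right t"
        using t n by (intro at_within_nhd[of t "{..<real n}"]) auto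
      from elim[rule_format, of n t] obtain l where
        l: "((\<lambda>r. laplace r (real n) (X r \<omega>)) \<longlongrightarrow> l) (at t within (\<rat> \<inter> {s..real n} \<inter> {t<..}))"
        using t n by auto
      show "\<exists>l. (Y \<omega> \<longlongrightarrow> l) (rat_right t)"
        unfolding eq[symmetric]
      proof (rule transfer[OF l])
        show "\<forall>\<^sub>F r in at t within (\<rat> \<inter> {s..real n} \<inter> {t<..}). r \<in> {s..real n}"
          by (auto simp: eventually_at_filter)
        show "at t within (\<rat> \<inter> {s..real n} \<inter> {t<..}) \<le> nhds t" by (simp add: at_within_def)
      qed (use t n in auto)
    next
      fix t assume t: "s < t"
      obtain n where n: "t < real n" using reals_Archimedean2 by blast
      have eq: "at t within (\<rat> \<inter> {s..real n} \<inter> {..<t}) = rat_left t"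
        using t n by (intro at_within_nhd[of t "{s<..}"]) auto
      from elim[rule_format, of n t] obtain l where
        l: "((\<lambda>r. laplace r (real n) (X r \<omega>)) \<longlongrightarrow> l) (at t within (\<rat> \<inter> {s..real n} \<inter> {..<t}))"
        using t n by auto
      show "\<exists>l. (Y \<omega> \<longlongrightarrow> l) (rat_left t)"
        unfolding eq[symmetric]
      proof (rule transfer[OF l])
        show "\<forall>\<^sub>F r in at t within (\<rat> \<inter> {s..real n} \<inter> {..<t}). r \<in> {s..real n}"
          by (auto simp: eventually_at_filter)
        show "at t within (\<rat> \<inter> {s..real n} \<inter> {..<t}) \<le> nhds t" by (simp add: at_within_def)
      qed (use t n in auto)
    qed
  qed
qed

text \<open>With a rational \<open>q\<close> as horizon, \<open>AE_hits_zero\<close> is applied to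
  \<open>expneg\<close> for absorption at \<infinity> and to \<open>1 - expneg\<close> for
  absorption at 0. The exceptional sets are indexed by \<open>q\<close> alone, so one null set
  serves all real \<open>r\<close>.\<close>

lemma AE_Y_absorbed:
  "AE \<omega> in N. \<forall>r q v. q \<in> \<rat> \<and> v \<in> {0, 1} \<and> r < q \<and>
        (s \<le> r \<and> (Y \<omega> \<longlongrightarrow> v) (rat_right r) \<or> s < r \<and> (Y \<omega> \<longlongrightarrow> v) (rat_left r)) \<longrightarrow> Y \<omega> q = v"
proof -
  have cnt: "countable (\<rat> \<inter> {s<..})" "\<And>q. countable (\<rat> \<inter> {s..<q})" using countable_rat by auto
  have "AE \<omega> in N. \<forall>q\<in>\<rat> \<inter> {s<..}.
      ((\<forall>n. \<exists>r\<in>\<rat> \<inter> {s..<q}. (\<integral>z. expneg z \<partial>k r q (X r \<omega>)) < 1 / real (Suc n)) \<longrightarrow> Y \<omega> q = 0) \<and>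
      ((\<forall>n. \<exists>r\<in>\<rat> \<inter> {s..<q}. (\<integral>z. 1 - expneg z \<partial>k r q (X r \<omega>)) < 1 / real (Suc n)) \<longrightarrow> 1 - Y \<omega> q = 0)"
    unfolding AE_ball_countable[OF cnt(1)] AE_conj_iff
    using cnt(2) by (intro ballI conjI AE_hits_zero[where B=1]) auto
  then show ?thesis
  proof eventually_elim
    case (elim \<omega>)
    show ?case
    proof (intro allI impI)
      fix r q v
      assume H: "q \<in> \<rat> \<and> v \<in> {0, 1} \<and> r < q \<and>
        (s \<le> r \<and> (Y \<omega> \<longlongrightarrow> v) (rat_right r) \<or> s < r \<and> (Y \<omega> \<longlongrightarrow> v) (rat_left r))"
      \<comment> \<open>A single filter covers both cases: approach to \<open>r\<close> from the
        right or from the left through rationals below \<open>q\<close>.\<close>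
      have "\<exists>U. U \<noteq> bot \<and> U \<le> nhds r \<and> (Y \<omega> \<longlongrightarrow> v) U \<and> (\<forall>\<^sub>F p in U. p \<in> \<rat> \<inter> {s..<q})"
        using H
      proof (elim conjE disjE)
        assume "s \<le> r" "r < q" "(Y \<omega> \<longlongrightarrow> v) (rat_right r)"
        moreover have "\<forall>\<^sub>F p in rat_right r. p \<in> \<rat> \<inter> {s..<q}"
          unfolding eventually_at_topological using \<open>s \<le> r\<close> \<open>r < q\<close> by (intro exI[of _ "{..<q}"]) auto
        ultimately show ?thesis
          using rat_right_ne_bot by (intro exI[of _ "rat_right r"]) (auto simp: at_within_def)
      next
        assume "s < r" "r < q" "(Y \<omega> \<longlongrightarrow> v) (rat_left r)"
        moreover have "\<forall>\<^sub>F p in rat_left r. p \<in> \<rat> \<inter> {s..<q}"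
          unfolding eventually_at_topological using \<open>s < r\<close> \<open>r < q\<close> by (intro exI[of _ "{s<..}"]) auto
        ultimately show ?thesis
          using rat_left_ne_bot by (intro exI[of _ "rat_left r"]) (auto simp: at_within_def)
      qed
      then obtain U where U: "U \<noteq> bot" "U \<le> nhds r" "(Y \<omega> \<longlongrightarrow> v) U" "\<forall>\<^sub>F p in U. p \<in> \<rat> \<inter> {s..<q}"
        by blast
      have r: "0 \<le> r" "s \<le> r" "r < q" using H s_nonneg by auto
      have id: "((\<lambda>r. r) \<longlongrightarrow> r) U" using U(2) by (simp add: filterlim_def)
      have cum: "((\<lambda>p. cumulant p q) \<longlongrightarrow> cumulant r q) U"
        using r s_nonneg
        by (intro continuous_on_tendsto_compose[OF continuous_on_cumulant id]) (auto intro: eventually_mono[OF U(4)])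
      have "((\<lambda>p. Y \<omega> p powr cumulant p q) \<longlongrightarrow> v powr cumulant r q) U"
        using cumulant_pos[of r q] r by (intro tendsto_powr' U(3) cum) auto
      \<comment> \<open>0 and 1 are unchanged by the power, so the martingale has the same limit
        \<open>v\<close> as \<open>Y\<close>.\<close>
      moreover have "v powr cumulant r q = v" using H by auto
      moreover have lap: "\<forall>\<^sub>F p in U. Y \<omega> p powr cumulant p q = laplace p q (X p \<omega>)"
        using U(4) s_nonneg by (auto elim!: eventually_mono simp: laplace_eq)
      ultimately have lim: "((\<lambda>p. laplace p q (X p \<omega>)) \<longlongrightarrow> v) U"
        by (intro Lim_transform_eventually[OF _ lap]) simp
      have ex: "\<exists>p\<in>\<rat> \<inter> {s..<q}. g p < 1 / real (Suc n)" if "(g \<longlongrightarrow> 0) U" for g :: "real \<Rightarrow> real" and n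
      proof -
        have "\<forall>\<^sub>F p in U. g p < 1 / real (Suc n)" by (intro order_tendstoD(2)[OF that]) simp
        from eventually_happens'[OF U(1) eventually_conj[OF this U(4)]] show ?thesis by blast
      qed
      have one: "(\<integral>z. 1 - expneg z \<partial>k p q (X p \<omega>)) = 1 - laplace p q (X p \<omega>)" if "p \<in> \<rat> \<inter> {s..<q}" for p
      proof -
        interpret K: prob_space "k p q (X p \<omega>)" using that s_nonneg by (intro prob_space_k) auto
        have "integrable (k p q (X p \<omega>)) expneg" using that s_nonneg by (intro integrable_k[where B=1]) auto
        then show ?thesis by (simp add: laplace_def K.prob_space)
      qed
      have q: "q \<in> \<rat> \<inter> {s<..}" using H by auto
      show "Y \<omega> q = v"
      proof (cases "v = 0")
        case True
        then have "((\<lambda>p. \<integral>z. expneg z \<partial>k p q (X p \<omega>)) \<longlongrightarrow> 0) U" using lim by (simp add: laplace_def)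
        from ex[OF this] elim[rule_format, OF q] True show ?thesis by blast
      next
        case False
        then have "v = 1" using H by auto
        then have "((\<lambda>p. 1 - laplace p q (X p \<omega>)) \<longlongrightarrow> 0) U"
          using tendsto_diff[OF tendsto_const lim, of 1] by simp
        from ex[OF this] have "\<forall>n. \<exists>p\<in>\<rat> \<inter> {s..<q}. (\<integral>z. 1 - expneg z \<partial>k p q (X p \<omega>)) < 1 / real (Suc n)"
          using one by metis
        with elim[rule_format, OF q] \<open>v = 1\<close> show ?thesis by simp
      qed
    qed
  qed
qed

text \<open>The exceptional set depends on \<open>t\<close>. This is enough, since only
  finite-dimensional laws are compared.\<close>

lemma AE_rlim_Y:
  assumes "s \<le> t"
  shows "AE \<omega> in N. rlim (Y \<omega>) t = Y \<omega> t"
proof -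
  obtain q where q: "\<And>n. t < q n" "q \<longlonglongrightarrow> t" "filterlim q (rat_right t) sequentially"
    using rat_sequence[of t] by blast
  have "AE \<omega> in N. (\<lambda>n. Y \<omega> (q n)) \<longlonglongrightarrow> rlim (Y \<omega>) t"
    using AE_Y_limits by eventually_elim (use assms in \<open>auto intro!: filterlim_compose[OF tendsto_rlim q(3)]\<close>)
  from AE_limit_eq_X[OF assms q(1,2) this] show ?thesis .
qed

lemma AE_regular_Y: "AE \<omega> in N. regular s x (Y \<omega>)"
  using AE_Y_limits AE_Y_absorbed AE_rlim_Y[OF order.refl] AE_X_initial
proof eventually_elim
  case (elim \<omega>)
  show ?case
    unfolding regular_def
  proof (intro conjI)
    show "rlim (Y \<omega>) s = expneg x" using elim(3,4) by simp
  qed (simp, rule conjunct1[OF elim(1)], rule conjunct2[OF elim(1)], rule elim(2))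
qed

lemma path_measure_exists:
  "\<exists>P. prob_space P \<and> space P = Dpaths \<and> sets P = sets (G {s..}) \<and> cylinder_law s x P"
proof -
  \<comment> \<open>The set of irregular paths need not be measurable. It is covered by a measurable
    null set \<open>Z\<close>, on which the path is replaced by a constant one.\<close>
  obtain Z where Z: "Z \<in> null_sets N" "{\<omega>\<in>space N. \<not> regular s x (Y \<omega>)} \<subseteq> Z"
    using AE_regular_Y unfolding eventually_ae_filter by blast
  have [measurable]: "Z \<in> sets N" using Z by auto
  define f where "f \<omega> = (if \<omega> \<in> Z then (\<lambda>_. expneg x) else Y \<omega>)" for \<omega>
  define \<Phi> where "\<Phi> \<omega> = extend_path s x (f \<omega>)" for \<omega>
  have reg: "regular s x (f \<omega>)" if "\<omega> \<in> space N" for \<omega>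
    using that Z(2) regular_const by (auto simp: f_def)
  have \<Phi>_meas: "\<Phi> \<in> N \<rightarrow>\<^sub>M G {s..}"
  proof (rule measurable_into_G)
    show "\<Phi> \<omega> \<in> Dpaths" if "\<omega> \<in> space N" for \<omega>
      unfolding \<Phi>_def using reg[OF that] s_nonneg by (rule extend_path_in_Dpaths)
    fix t assume "t \<in> {s..}"
    then have t: "s \<le> t" "0 \<le> t" using s_nonneg by auto
    \<comment> \<open>One rational sequence serves all paths, so \<open>rlim\<close> at time
      \<open>t\<close> is a pointwise limit of measurable functions.\<close>
    obtain q where q: "\<And>n. t < q n" "q \<longlonglongrightarrow> t" "filterlim q (rat_right t) sequentially"
      using rat_sequence[of t] by blast
    have [measurable]: "X (q n) \<in> borel_measurable N" for n
      using t q(1)[of n] by (intro X_measurable) simp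
    have "(\<lambda>\<omega>. rlim (f \<omega>) t) \<in> borel_measurable N"
    proof (rule borel_measurable_LIMSEQ_real)
      show "(\<lambda>n. f \<omega> (q n)) \<longlonglongrightarrow> rlim (f \<omega>) t" if "\<omega> \<in> space N" for \<omega>
        using reg[OF that] t by (intro filterlim_compose[OF tendsto_rlim q(3)]) (auto simp: regular_def)
      show "(\<lambda>\<omega>. f \<omega> (q n)) \<in> borel_measurable N" for n
        unfolding f_def if_distribR by measurable
    qed
    then have "(\<lambda>\<omega>. neglog (rlim (f \<omega>) t)) \<in> borel_measurable N" by measurable
    then show "(\<lambda>\<omega>. \<Phi> \<omega> t) \<in> borel_measurable N" using t by (simp add: \<Phi>_def extend_path_def)
  qed
  have \<Phi>_X: "AE \<omega> in N. \<Phi> \<omega> t = X t \<omega>" if "s \<le> t" for t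
    using AE_rlim_Y[OF that] AE_not_in[OF Z(1)]
    by eventually_elim (use that s_nonneg in \<open>simp add: \<Phi>_def extend_path_def f_def\<close>)
  have "cylinder_law s x (distr N (G {s..}) \<Phi>)"
    unfolding cylinder_law_def
  proof (intro allI impI, elim conjE)
    fix J and \<phi> :: "real \<Rightarrow> ennreal \<Rightarrow> ennreal"
    assume J: "finite J" "J \<subseteq> {s..}" and "\<forall>r. \<phi> r \<in> borel_measurable borel"
    then have \<phi>: "\<And>r. \<phi> r \<in> borel_measurable borel" by blast
    have "(\<lambda>\<omega>. \<phi> r (\<omega> r)) \<in> borel_measurable (G {s..})" if "r \<in> J" for r
      using that J \<phi> by (intro measurable_G_comp[of r "{s..}" "\<phi> r"]) auto
    then have "(\<integral>\<^sup>+ \<omega>. (\<Prod>r\<in>J. \<phi> r (\<omega> r)) \<partial>distr N (G {s..}) \<Phi>) = (\<integral>\<^sup>+ \<omega>. (\<Prod>r\<in>J. \<phi> r (\<Phi> \<omega> r)) \<partial>N)"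
      by (intro nn_integral_distr[OF \<Phi>_meas] borel_measurable_prod_ennreal) simp
    also have "\<dots> = (\<integral>\<^sup>+ \<omega>. (\<Prod>r\<in>J. \<phi> r (X r \<omega>)) \<partial>N)"
    proof (rule nn_integral_cong_AE)
      have "AE \<omega> in N. \<forall>r\<in>J. \<Phi> \<omega> r = X r \<omega>"
        using J \<Phi>_X by (intro AE_finite_allI) auto
      then show "AE \<omega> in N. (\<Prod>r\<in>J. \<phi> r (\<Phi> \<omega> r)) = (\<Prod>r\<in>J. \<phi> r (X r \<omega>))"
        by eventually_elim (auto intro: prod.cong)
    qed
    also have "\<dots> = cyl \<phi> s x (sorted_list_of_set J)" by (rule nn_integral_X_prod[OF J \<phi>])
    finally show "(\<integral>\<^sup>+ \<omega>. (\<Prod>r\<in>J. \<phi> r (\<omega> r)) \<partial>distr N (G {s..}) \<Phi>) = cyl \<phi> s x (sorted_list_of_set J)" .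
  qed
  then show ?thesis
    using prob_space_distr[OF \<Phi>_meas] by (intro exI[of _ "distr N (G {s..}) \<Phi>"]) simp
qed

end

section \<open>Markov property and uniqueness\<close>

text \<open>The generators in \<open>G\<close> constrain one time each and are not stable under
  intersection; these sets are.\<close>

definition cylinders :: "real set \<Rightarrow> (real \<Rightarrow> ennreal) set set" where
  "cylinders I = {{\<omega> \<in> Dpaths. \<forall>r\<in>J. \<omega> r \<in> A r} | J A. finite J \<and> J \<subseteq> I \<and> (\<forall>r. A r \<in> sets borel)}"

lemma sets_G_cylinders: "sets (G I) = sigma_sets Dpaths (cylinders I)"
proof (intro antisym)
  show "sets (G I) \<subseteq> sigma_sets Dpaths (cylinders I)"
    unfolding sets_G
  proof (intro sigma_sets_mono', safe)
    fix t and B :: "ennreal set" assume "t \<in> I" "B \<in> sets borel"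
    then show "{\<omega> \<in> Dpaths. \<omega> t \<in> B} \<in> cylinders I"
      unfolding cylinders_def by (intro CollectI exI[of _ "{t}"] exI[of _ "\<lambda>_. B"]) auto
  qed
  have "cylinders I \<subseteq> sets (G I)"
  proof (unfold cylinders_def, safe)
    fix J and A :: "real \<Rightarrow> ennreal set" assume J: "finite J" "J \<subseteq> I" and A: "\<forall>r. A r \<in> sets borel"
    have "Measurable.pred (G I) (\<lambda>\<omega>. \<forall>r\<in>J. \<omega> r \<in> A r)"
    proof (intro pred_intros_finite J(1))
      fix r assume "r \<in> J"
      then have "(\<lambda>\<omega>. \<omega> r) \<in> borel_measurable (G I)" using J by (intro measurable_G_coord) auto
      then show "Measurable.pred (G I) (\<lambda>\<omega>. \<omega> r \<in> A r)"
        using A by (intro pred_sets2[where N=borel]) auto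
    qed
    then have "{\<omega> \<in> space (G I). \<forall>r\<in>J. \<omega> r \<in> A r} \<in> sets (G I)" by (simp add: pred_def)
    then show "{\<omega> \<in> Dpaths. \<forall>r\<in>J. \<omega> r \<in> A r} \<in> sets (G I)" by simp
  qed
  then show "sigma_sets Dpaths (cylinders I) \<subseteq> sets (G I)"
    using sets.sigma_sets_subset[of _ "G I"] by simp
qed

lemma Int_stable_cylinders: "Int_stable (cylinders I)"
proof (rule Int_stableI)
  fix a b assume "a \<in> cylinders I" "b \<in> cylinders I"
  then obtain J A K B where a: "a = {\<omega> \<in> Dpaths. \<forall>r\<in>J. \<omega> r \<in> A r}" "finite J" "J \<subseteq> I" "\<forall>r. A r \<in> sets borel"
    and b: "b = {\<omega> \<in> Dpaths. \<forall>r\<in>K. \<omega> r \<in> B r}" "finite K" "K \<subseteq> I" "\<forall>r. B r \<in> sets borel"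
    unfolding cylinders_def by blast
  define C where "C r = (if r \<in> J then A r else UNIV) \<inter> (if r \<in> K then B r else UNIV)" for r
  have "a \<inter> b = {\<omega> \<in> Dpaths. \<forall>r\<in>J \<union> K. \<omega> r \<in> C r}" by (auto simp: a b C_def)
  moreover have "\<forall>r. C r \<in> sets borel" using a b by (auto simp: C_def)
  ultimately show "a \<inter> b \<in> cylinders I"
    unfolding cylinders_def using a b by (intro CollectI exI[of _ "J \<union> K"] exI[of _ C]) auto
qed

lemma measure_eqI_cylinders:
  assumes "sets M = sets (G I)" "sets M' = sets (G I)" "emeasure M Dpaths \<noteq> \<infinity>"
    and "\<And>C. C \<in> cylinders I \<Longrightarrow> emeasure M C = emeasure M' C"
  shows "M = M'"
proof (rule measure_eqI_generator_eq[OF Int_stable_cylinders[of I]])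
  show "range (\<lambda>_::nat. Dpaths) \<subseteq> cylinders I"
    unfolding cylinders_def by (auto intro!: exI[of _ "{}"] exI[of _ "\<lambda>_. UNIV"])
  show "cylinders I \<subseteq> Pow Dpaths" by (auto simp: cylinders_def)
qed (use assms sets_G_cylinders in auto)

lemma indicator_cylinder:
  "finite J \<Longrightarrow> \<omega> \<in> Dpaths \<Longrightarrow>
    indicator {\<omega> \<in> Dpaths. \<forall>r\<in>J. \<omega> r \<in> A r} \<omega> = (\<Prod>r\<in>J. indicator (A r) (\<omega> r) :: ennreal)"
  by (cases "\<forall>r\<in>J. \<omega> r \<in> A r") (simp, simp add: prod_zero_iff, metis indicator_simps(2))

lemma subalgebra_G:
  assumes "sets P = sets (G J)" "I \<subseteq> J"
  shows "subalgebra P (G I)"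
proof -
  have "space P = Dpaths" using sets_eq_imp_space_eq[OF assms(1)] by simp
  moreover have "sets (G I) \<subseteq> sets P"
    unfolding assms(1) sets_G using assms(2) by (intro sigma_sets_mono') auto
  ultimately show ?thesis by (simp add: subalgebra_def)
qed

context kernel_family
begin

text \<open>Both sides are measures in \<open>A\<close> on \<open>G {s..t}\<close>, finite because
  \<open>g\<close> is bounded. They agree on cylinders by \<open>cyl_append\<close>, hence
  everywhere.\<close>

lemma cylinder_law_markov:
  assumes P: "sets P = sets (G {s..})" "cylinder_law s x P" and t: "0 \<le> s" "s \<le> t" "t \<le> u"
    and g: "g \<in> borel_measurable borel" "\<And>y. g y \<le> ennreal B"
    and fin: "finite_measure P" and A: "A \<in> sets (G {s..t})"
  shows "(\<integral>\<^sup>+ \<omega>. g (\<omega> u) * indicator A \<omega> \<partial>P) = (\<integral>\<^sup>+ \<omega>. (\<integral>\<^sup>+ y. g y \<partial>k t u (\<omega> t)) * indicator A \<omega> \<partial>P)"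
proof -
  interpret finite_measure P by (rule fin)
  have sp: "space P = Dpaths" using sets_eq_imp_space_eq[OF P(1)] by simp
  have sub: "subalgebra P (G {s..t})" using P(1) by (rule subalgebra_G) auto
  have coord: "(\<lambda>\<omega>. \<omega> r) \<in> borel_measurable P" if "s \<le> r" for r
    using measurable_G_coord[of r "{s..}"] that by (simp add: measurable_cong_sets[OF P(1) refl])
  have h1: "(\<lambda>\<omega>. g (\<omega> u)) \<in> borel_measurable P"
    using t by (intro measurable_compose[OF coord g(1)]) auto
  have h2: "(\<lambda>\<omega>. \<integral>\<^sup>+ y. g y \<partial>k t u (\<omega> t)) \<in> borel_measurable P"
    using t by (intro measurable_compose[OF coord borel_measurable_nn_integral_k] g) auto
  have id: "(\<lambda>\<omega>. \<omega>) \<in> density P h \<rightarrow>\<^sub>M G {s..t}" for h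
    using sub by (auto simp: measurable_def subalgebra_def)
  \<comment> \<open>\<open>distr\<close> along the identity restricts the weighted measure to the
    smaller sigma-algebra.\<close>
  define M1 where "M1 = distr (density P (\<lambda>\<omega>. g (\<omega> u))) (G {s..t}) (\<lambda>\<omega>. \<omega>)"
  define M2 where "M2 = distr (density P (\<lambda>\<omega>. \<integral>\<^sup>+ y. g y \<partial>k t u (\<omega> t))) (G {s..t}) (\<lambda>\<omega>. \<omega>)"
  have e1: "emeasure M1 C = (\<integral>\<^sup>+ \<omega>. g (\<omega> u) * indicator C \<omega> \<partial>P)"
    and e2: "emeasure M2 C = (\<integral>\<^sup>+ \<omega>. (\<integral>\<^sup>+ y. g y \<partial>k t u (\<omega> t)) * indicator C \<omega> \<partial>P)"
    if C: "C \<in> sets (G {s..t})" for C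
  proof -
    have CP: "C \<in> sets P" using sub C by (auto simp: subalgebra_def)
    then have "C \<inter> space P = C" using sets.sets_into_space by blast
    then show "emeasure M1 C = (\<integral>\<^sup>+ \<omega>. g (\<omega> u) * indicator C \<omega> \<partial>P)"
      "emeasure M2 C = (\<integral>\<^sup>+ \<omega>. (\<integral>\<^sup>+ y. g y \<partial>k t u (\<omega> t)) * indicator C \<omega> \<partial>P)"
      unfolding M1_def M2_def using C CP h1 h2 by (simp_all add: emeasure_distr[OF id] emeasure_density)
  qed
  have "M1 = M2"
  proof (rule measure_eqI_cylinders[where I="{s..t}"])
    show "sets M1 = sets (G {s..t})" "sets M2 = sets (G {s..t})" by (simp_all add: M1_def M2_def)
    have "emeasure M1 Dpaths = (\<integral>\<^sup>+ \<omega>. g (\<omega> u) * indicator Dpaths \<omega> \<partial>P)"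
      using sets.top[of "G {s..t}"] by (intro e1) simp
    also have "\<dots> \<le> (\<integral>\<^sup>+ \<omega>. ennreal B \<partial>P)"
      using g(2) by (intro nn_integral_mono) (auto simp: indicator_def)
    also have "\<dots> < \<infinity>" by (simp add: emeasure_eq_measure ennreal_mult_eq_top_iff less_top[symmetric])
    finally show "emeasure M1 Dpaths \<noteq> \<infinity>" by simp
    fix C assume C: "C \<in> cylinders {s..t}"
    then have CG: "C \<in> sets (G {s..t})" unfolding sets_G_cylinders by auto
    from C obtain J A where J: "C = {\<omega> \<in> Dpaths. \<forall>r\<in>J. \<omega> r \<in> A r}" "finite J" "J \<subseteq> {s..t}" "\<forall>r. A r \<in> sets borel"
      unfolding cylinders_def by blast
    \<comment> \<open>The time \<open>t\<close> is put among the constrained times, with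
      \<open>UNIV\<close> if \<open>C\<close> does not mention it, so that it directly precedes
      \<open>u\<close> as \<open>cyl_append\<close> requires.\<close>
    define J0 where "J0 = J - {t}"
    define A' where "A' r = (if r \<in> J then A r else UNIV)" for r
    have A': "A' r \<in> sets borel" for r using J by (auto simp: A'_def)
    have J0: "finite J0" "J0 \<subseteq> {s..<t}" "t \<notin> J0" using J by (auto simp: J0_def)
    have C': "C = {\<omega> \<in> Dpaths. \<forall>r\<in>insert t J0. \<omega> r \<in> A' r}"
      unfolding J(1) by (auto simp: J0_def A'_def)
    have ind: "indicator C \<omega> = (\<Prod>r\<in>insert t J0. indicator (A' r) (\<omega> r) :: ennreal)" if "\<omega> \<in> space P" for \<omega>
      unfolding C' using that J0 by (intro indicator_cylinder) (auto simp: sp)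
    show "emeasure M1 C = emeasure M2 C"
    \<comment> \<open>Equal times would break the strict ordering of the list; there
      \<open>k t t\<close> is a point mass and both sides coincide.\<close>
    proof (cases "t = u")
      case True
      then show ?thesis unfolding e1[OF CG] e2[OF CG] using t g(1)
        by (simp add: k_refl nn_integral_return)
    next
      case False
      then have "t < u" using t by simp
      define \<phi> where "\<phi> = (\<lambda>r. indicator (A' r) :: ennreal \<Rightarrow> ennreal)(u := g)"
      have \<phi>: "\<phi> r \<in> borel_measurable borel" for r using g(1) A' by (auto simp: \<phi>_def)
      define \<phi>' where "\<phi>' = \<phi>(t := \<lambda>z. \<phi> t z * (\<integral>\<^sup>+ w. \<phi> u w \<partial>k t u z))"
      have \<phi>': "\<phi>' r \<in> borel_measurable borel" for r
        using \<phi> borel_measurable_nn_integral_k[of t u "\<phi> u"] t by (auto simp: \<phi>'_def)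
      have so1: "sorted_list_of_set (insert t J0) = sorted_list_of_set J0 @ [t]"
      proof -
        have "sorted_list_of_set (J0 \<union> {t}) = sorted_list_of_set J0 @ sorted_list_of_set {t}"
          using J0 by (intro sorted_list_of_set_Un_less) auto
        then show ?thesis by simp
      qed
      have so2: "sorted_list_of_set (insert u (insert t J0)) = sorted_list_of_set J0 @ [t, u]"
      proof -
        have "sorted_list_of_set (insert t J0 \<union> {u}) = sorted_list_of_set (insert t J0) @ sorted_list_of_set {u}"
          using J0 \<open>t < u\<close> by (intro sorted_list_of_set_Un_less) auto
        then show ?thesis by (simp add: so1)
      qed
      have nu: "u \<notin> insert t J0" using J0 \<open>t < u\<close> by auto
      have "emeasure M1 C = (\<integral>\<^sup>+ \<omega>. (\<Prod>r\<in>insert u (insert t J0). \<phi> r (\<omega> r)) \<partial>P)"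
        unfolding e1[OF CG]
      proof (rule nn_integral_cong)
        fix \<omega> assume w: "\<omega> \<in> space P"
        have "(\<Prod>r\<in>insert u (insert t J0). \<phi> r (\<omega> r)) = \<phi> u (\<omega> u) * (\<Prod>r\<in>insert t J0. \<phi> r (\<omega> r))"
          using J0 nu by (intro prod.insert) auto
        also have "(\<Prod>r\<in>insert t J0. \<phi> r (\<omega> r)) = (\<Prod>r\<in>insert t J0. indicator (A' r) (\<omega> r))"
          using nu by (intro prod.cong) (auto simp: \<phi>_def)
        finally show "g (\<omega> u) * indicator C \<omega> = (\<Prod>r\<in>insert u (insert t J0). \<phi> r (\<omega> r))"
          by (simp only: ind[OF w]) (simp add: \<phi>_def)
      qed
      also have "\<dots> = cyl \<phi> s x (sorted_list_of_set J0 @ [t, u])"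
        unfolding so2[symmetric] using J0 t \<phi> by (intro P(2)[unfolded cylinder_law_def, rule_format]) auto
      also have "\<dots> = cyl \<phi>' s x (sorted_list_of_set (insert t J0))"
        unfolding so1 \<phi>'_def using J0 nu by (intro cyl_append) auto
      also have "\<dots> = (\<integral>\<^sup>+ \<omega>. (\<Prod>r\<in>insert t J0. \<phi>' r (\<omega> r)) \<partial>P)"
        using J0 t \<phi>' by (intro P(2)[unfolded cylinder_law_def, rule_format, symmetric]) auto
      also have "\<dots> = emeasure M2 C"
        unfolding e2[OF CG]
      proof (rule nn_integral_cong)
        fix \<omega> assume w: "\<omega> \<in> space P"
        have eq: "(\<Prod>r\<in>J0. \<phi>' r (\<omega> r)) = (\<Prod>r\<in>J0. indicator (A' r) (\<omega> r))"
          using nu J0 by (intro prod.cong) (auto simp: \<phi>_def \<phi>'_def)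
        show "(\<Prod>r\<in>insert t J0. \<phi>' r (\<omega> r)) = (\<integral>\<^sup>+ y. g y \<partial>k t u (\<omega> t)) * indicator C \<omega>"
          unfolding ind[OF w] using J0 nu by (simp add: eq) (simp add: \<phi>_def \<phi>'_def ac_simps)
      qed
      finally show ?thesis .
    qed
  qed
  then show ?thesis using e1[OF A] e2[OF A] by simp
qed

text \<open>Adding the bound \<open>B\<close> makes \<open>f\<close> nonnegative, so that
  \<open>cylinder_law_markov\<close> applies; the common term \<open>B\<close> is subtracted
  afterwards.\<close>

lemma cylinder_law_cond_exp:
  fixes f :: "ennreal \<Rightarrow> real"
  assumes P: "prob_space P" "sets P = sets (G {s..})" "cylinder_law s x P" and t: "0 \<le> s" "s \<le> t" "t \<le> u"
    and f: "f \<in> borel_measurable borel" "\<And>y. \<bar>f y\<bar> \<le> B"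
  shows "AE \<omega> in P. real_cond_exp P (G {s..t}) (\<lambda>\<omega>. f (\<omega> u)) \<omega> = (\<integral>y. f y \<partial>k t u (\<omega> t))"
proof -
  interpret prob_space P by fact
  have sub: "subalgebra P (G {s..t})" using P(2) by (rule subalgebra_G) auto
  interpret finite_measure_subalgebra P "G {s..t}" by unfold_locales (rule sub)
  define h where "h y = (\<integral>z. f z \<partial>k t u y)" for y
  have tu: "0 \<le> t" "t \<le> u" using t by auto
  have h: "h \<in> borel_measurable borel" "\<And>y. \<bar>h y\<bar> \<le> B"
    unfolding h_def using tu f by (auto intro!: borel_measurable_integral_k integral_k_bound)
  have B: "0 \<le> B" using f(2)[of 0] by simp
  have coord: "(\<lambda>\<omega>. \<omega> r) \<in> borel_measurable P" if "s \<le> r" for r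
    using measurable_G_coord[of r "{s..}"] that by (simp add: measurable_cong_sets[OF P(2) refl])
  have m1: "(\<lambda>\<omega>. f (\<omega> u)) \<in> borel_measurable P"
    using t by (intro measurable_compose[OF coord f(1)]) auto
  have m2: "(\<lambda>\<omega>. h (\<omega> t)) \<in> borel_measurable P"
    using t by (intro measurable_compose[OF coord h(1)]) auto
  have i1: "integrable P (\<lambda>\<omega>. f (\<omega> u))" using m1 f(2) by (intro integrable_const_bound[where B=B]) auto
  have i2: "integrable P (\<lambda>\<omega>. h (\<omega> t))" using m2 h(2) by (intro integrable_const_bound[where B=B]) auto
  have "AE \<omega> in P. real_cond_exp P (G {s..t}) (\<lambda>\<omega>. f (\<omega> u)) \<omega> = h (\<omega> t)"
  proof (rule real_cond_exp_charact[OF _ i1 i2])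
    show "(\<lambda>\<omega>. h (\<omega> t)) \<in> borel_measurable (G {s..t})"
      using t by (intro measurable_compose[OF measurable_G_coord h(1)]) auto
    fix A assume A: "A \<in> sets (G {s..t})"
    have AP: "A \<in> sets P" using A sub by (auto simp: subalgebra_def)
    have kB: "(\<integral>\<^sup>+ y. ennreal (f y + B) \<partial>k t u z) = ennreal (h z + B)" for z
    proof -
      interpret K: prob_space "k t u z" using tu by (rule prob_space_k)
      have fB: "0 \<le> f y + B" "f y + B \<le> 2 * B" for y using f(2)[of y] by auto
      have "(\<integral>\<^sup>+ y. ennreal (f y + B) \<partial>k t u z) = ennreal (\<integral>y. f y + B \<partial>k t u z)"
        using tu f fB by (intro nn_integral_k_eq_integral[where B="2 * B"]) auto
      also have "(\<integral>y. f y + B \<partial>k t u z) = h z + B"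
        using integrable_k[OF tu f] by (simp add: h_def K.prob_space)
      finally show ?thesis .
    qed
    have pos: "0 \<le> f y + B" "0 \<le> h y + B" for y using f(2)[of y] h(2)[of y] by auto
    have int: "integrable P (\<lambda>\<omega>. (f (\<omega> u) + B) * indicator A \<omega>)" "integrable P (\<lambda>\<omega>. (h (\<omega> t) + B) * indicator A \<omega>)"
      using AP i1 i2 by (auto intro!: integrable_real_mult_indicator)
    have "ennreal (\<integral>\<omega>. (f (\<omega> u) + B) * indicator A \<omega> \<partial>P) = (\<integral>\<^sup>+ \<omega>. ennreal ((f (\<omega> u) + B) * indicator A \<omega>) \<partial>P)"
      using pos int by (intro nn_integral_eq_integral[symmetric]) auto
    also have "\<dots> = (\<integral>\<^sup>+ \<omega>. ennreal (f (\<omega> u) + B) * indicator A \<omega> \<partial>P)"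
      by (intro nn_integral_cong) (auto simp: indicator_def)
    also have "\<dots> = (\<integral>\<^sup>+ \<omega>. ennreal (h (\<omega> t) + B) * indicator A \<omega> \<partial>P)"
      unfolding kB[symmetric] using P t f A
    proof (intro cylinder_law_markov[where g="\<lambda>y. ennreal (f y + B)" and B="2 * B"])
      show "ennreal (f y + B) \<le> ennreal (2 * B)" for y using f(2)[of y] by (intro ennreal_leI) auto
    qed (auto intro: finite_measure_axioms)
    also have "\<dots> = (\<integral>\<^sup>+ \<omega>. ennreal ((h (\<omega> t) + B) * indicator A \<omega>) \<partial>P)"
      by (intro nn_integral_cong) (auto simp: indicator_def)
    also have "\<dots> = ennreal (\<integral>\<omega>. (h (\<omega> t) + B) * indicator A \<omega> \<partial>P)"
      using pos int by (intro nn_integral_eq_integral) auto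
    finally have "(\<integral>\<omega>. (f (\<omega> u) + B) * indicator A \<omega> \<partial>P) = (\<integral>\<omega>. (h (\<omega> t) + B) * indicator A \<omega> \<partial>P)"
      using pos by (subst (asm) ennreal_inj) (auto intro!: integral_nonneg_AE)
    moreover have "(\<integral>\<omega>. (\<xi> \<omega> + B) * indicator A \<omega> \<partial>P) = (\<integral>\<omega>. \<xi> \<omega> * indicator A \<omega> \<partial>P) + (\<integral>\<omega>. B * indicator A \<omega> \<partial>P)"
      if "integrable P \<xi>" for \<xi>
      unfolding distrib_right using AP that
      by (intro Bochner_Integration.integral_add integrable_real_mult_indicator) auto
    note this[OF i1] this[OF i2]
    ultimately show "(\<integral>\<omega>\<in>A. f (\<omega> u) \<partial>P) = (\<integral>\<omega>\<in>A. h (\<omega> t) \<partial>P)"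
      by (simp add: set_lebesgue_integral_def mult.commute)
  qed
  then show ?thesis by (simp add: h_def)
qed

lemma cylinder_law_initial:
  assumes P: "sets P = sets (G {s..})" "cylinder_law s x P" and s: "0 \<le> s"
  shows "emeasure P {\<omega> \<in> Dpaths. \<omega> s = x} = 1"
proof -
  have sp: "space P = Dpaths" using sets_eq_imp_space_eq[OF P(1)] by simp
  have coord: "(\<lambda>\<omega>. \<omega> s) \<in> borel_measurable P"
    using measurable_G_coord[of s "{s..}"] by (simp add: measurable_cong_sets[OF P(1) refl])
  have set: "{\<omega> \<in> Dpaths. \<omega> s = x} \<in> sets P"
    using measurable_sets[OF coord, of "{x}"] by (simp add: vimage_def Int_def sp conj_commute)
  have "emeasure P {\<omega> \<in> Dpaths. \<omega> s = x} = (\<integral>\<^sup>+ \<omega>. indicator {\<omega> \<in> Dpaths. \<omega> s = x} \<omega> \<partial>P)"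
    using set by simp
  also have "\<dots> = (\<integral>\<^sup>+ \<omega>. (\<Prod>r\<in>{s}. indicator {x} (\<omega> r)) \<partial>P)"
    by (intro nn_integral_cong) (auto simp: sp indicator_def)
  also have "\<dots> = cyl (\<lambda>_. indicator {x}) s x (sorted_list_of_set {s})"
    using P(2)[unfolded cylinder_law_def, rule_format, of "{s}" "\<lambda>_. indicator {x}"] by simp
  also have "\<dots> = 1" using s by (simp add: k_refl nn_integral_return)
  finally show ?thesis .
qed

text \<open>Induction from the last time: conditioning on the past up to the last but one time
  \<open>r\<close> replaces the factor at \<open>u\<close> by a function of the value at
  \<open>r\<close>. Factors bounded by 1 keep all integrals finite, and the bound survives the
  merging. The list starts with \<open>s\<close>, so the base case is the initial condition.\<close>

lemma markov_imp_cyl: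
  assumes P: "prob_space P" "sets P = sets (G {s..})" and s: "0 \<le> s"
    and init: "AE \<omega> in P. \<omega> s = x"
    and markov: "\<And>t u (f :: ennreal \<Rightarrow> real). s \<le> t \<Longrightarrow> t \<le> u \<Longrightarrow> f \<in> borel_measurable borel \<Longrightarrow>
       (\<exists>B. \<forall>y. \<bar>f y\<bar> \<le> B) \<Longrightarrow>
       AE \<omega> in P. real_cond_exp P (G {s..t}) (\<lambda>\<omega>. f (\<omega> u)) \<omega> = (\<integral>y. f y \<partial>k t u (\<omega> t))"
    and \<phi>: "\<And>r. \<phi> r \<in> borel_measurable borel" "\<And>r y. \<phi> r y \<le> 1"
    and ts: "sorted (s # ts)" "distinct (s # ts)"
  shows "(\<integral>\<^sup>+ \<omega>. (\<Prod>r\<in>set (s # ts). \<phi> r (\<omega> r)) \<partial>P) = cyl \<phi> s x (s # ts)"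
  using \<phi> ts
proof (induction ts arbitrary: \<phi> rule: rev_induct)
  case Nil
  interpret prob_space P by fact
  have "(\<integral>\<^sup>+ \<omega>. \<phi> s (\<omega> s) \<partial>P) = (\<integral>\<^sup>+ \<omega>. \<phi> s x \<partial>P)"
    using init by (intro nn_integral_cong_AE) (auto elim!: eventually_mono)
  then show ?case using s Nil by (simp add: k_refl nn_integral_return emeasure_space_1)
next
  case (snoc u ts)
  interpret prob_space P by fact
  note \<phi> = snoc.prems(1,2)
  define r where "r = last (s # ts)"
  define us where "us = butlast (s # ts)"
  have us: "s # ts = us @ [r]" unfolding r_def us_def by (rule append_butlast_last_id[symmetric]) simp
  have r: "s \<le> r" "r < u" "\<And>q. q \<in> set (s # ts) \<Longrightarrow> s \<le> q \<and> q \<le> r"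
  proof -
    have "sorted ((us @ [r]) @ [u])" "distinct ((us @ [r]) @ [u])"
      using snoc.prems(3,4) unfolding us[symmetric] by auto
    then have "r < u" "\<And>q. q \<in> set (us @ [r]) \<Longrightarrow> q \<le> r" by (auto simp: sorted_append less_le)
    then show "r < u" "\<And>q. q \<in> set (s # ts) \<Longrightarrow> s \<le> q \<and> q \<le> r"
      using snoc.prems(3) unfolding us[symmetric] by auto
    then show "s \<le> r" by simp
  qed
  have ru: "0 \<le> r" "r \<le> u" using r(1,2) s by auto
  have sub: "subalgebra P (G {s..r})" using P(2) by (rule subalgebra_G) auto
  interpret finite_measure_subalgebra P "G {s..r}" by unfold_locales (rule sub)
  have coord: "(\<lambda>\<omega>. \<omega> q) \<in> borel_measurable P" if "s \<le> q" for q
    using measurable_G_coord[of q "{s..}"] that by (simp add: measurable_cong_sets[OF P(2) refl])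
  define Z where "Z \<omega> = (\<Prod>q\<in>set (s # ts). \<phi> q (\<omega> q))" for \<omega>
  have Z1: "Z \<omega> \<le> 1" for \<omega> unfolding Z_def using \<phi>(2) by (intro prod_le_1) auto
  have Zm: "Z \<in> borel_measurable (G {s..r})"
    unfolding Z_def
  proof (rule borel_measurable_prod_ennreal)
    fix q assume "q \<in> set (s # ts)"
    then show "(\<lambda>\<omega>. \<phi> q (\<omega> q)) \<in> borel_measurable (G {s..r})"
      using r by (intro measurable_G_comp[of q "{s..r}" "\<phi> q"] \<phi>(1)) auto
  qed
  define f where "f y = enn2real (\<phi> u y)" for y
  have f: "f \<in> borel_measurable borel" "\<And>y. 0 \<le> f y" "\<And>y. f y \<le> 1"
    unfolding f_def using \<phi> by (auto intro!: enn2real_leI)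
  have f_eq: "ennreal (f y) = \<phi> u y" for y
    unfolding f_def using \<phi>(2)[of u y] by (intro ennreal_enn2real) (auto simp: less_top[symmetric] top_unique)
  have Z_eq: "ennreal (enn2real (Z \<omega>)) = Z \<omega>" for \<omega>
    using Z1[of \<omega>] by (intro ennreal_enn2real) (auto simp: less_top[symmetric] top_unique)
  define h where "h y = (\<integral>z. f z \<partial>k r u y)" for y
  have h: "h \<in> borel_measurable borel" "\<And>y. 0 \<le> h y" "\<And>y. h y \<le> 1"
    unfolding h_def using ru f integral_k_bound[of r u f 1]
    by (auto intro!: borel_measurable_integral_k integral_nonneg_AE)
  have h_eq: "(\<integral>\<^sup>+ z. \<phi> u z \<partial>k r u y) = ennreal (h y)" for y
    unfolding h_def f_eq[symmetric] using ru f by (intro nn_integral_k_eq_integral[where B=1]) auto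
  have m1: "(\<lambda>\<omega>. f (\<omega> u)) \<in> borel_measurable P"
    using r(1,2) by (intro measurable_compose[OF coord f(1)]) auto
  have m2: "(\<lambda>\<omega>. h (\<omega> r)) \<in> borel_measurable P"
    using r(1,2) by (intro measurable_compose[OF coord h(1)]) auto
  have m3: "(\<lambda>\<omega>. enn2real (Z \<omega>)) \<in> borel_measurable (G {s..r})" using Zm by measurable
  have m3': "(\<lambda>\<omega>. enn2real (Z \<omega>)) \<in> borel_measurable P" by (rule measurable_from_subalg[OF sub m3])
  have Zb: "0 \<le> enn2real (Z \<omega>)" "enn2real (Z \<omega>) \<le> 1" for \<omega>
    using Z1[of \<omega>] by (auto intro!: enn2real_leI)
  have i1: "integrable P (\<lambda>\<omega>. enn2real (Z \<omega>) * f (\<omega> u))"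
    using m1 m3' Zb f by (intro integrable_const_bound[where B=1]) (auto simp: abs_mult intro!: mult_le_one)
  have i2: "integrable P (\<lambda>\<omega>. enn2real (Z \<omega>) * h (\<omega> r))"
    using m2 m3' Zb h by (intro integrable_const_bound[where B=1]) (auto simp: abs_mult intro!: mult_le_one)
  have ae: "AE \<omega> in P. real_cond_exp P (G {s..r}) (\<lambda>\<omega>. f (\<omega> u)) \<omega> = h (\<omega> r)"
    unfolding h_def using r f by (intro markov) (auto intro!: exI[of _ 1])
  have "(\<integral>\<omega>. enn2real (Z \<omega>) * f (\<omega> u) \<partial>P)
      = (\<integral>\<omega>. enn2real (Z \<omega>) * real_cond_exp P (G {s..r}) (\<lambda>\<omega>. f (\<omega> u)) \<omega> \<partial>P)"
    by (rule real_cond_exp_intg(2)[OF i1 m3 m1, symmetric])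
  also have "\<dots> = (\<integral>\<omega>. enn2real (Z \<omega>) * h (\<omega> r) \<partial>P)"
    using ae m2 m3' by (intro integral_cong_AE) (auto elim!: eventually_mono)
  finally have key: "(\<integral>\<^sup>+ \<omega>. ennreal (enn2real (Z \<omega>) * f (\<omega> u)) \<partial>P) = (\<integral>\<^sup>+ \<omega>. ennreal (enn2real (Z \<omega>) * h (\<omega> r)) \<partial>P)"
    using i1 i2 f h Zb by (simp add: nn_integral_eq_integral)
  \<comment> \<open>The modified family of \<open>cyl_append\<close>; the induction hypothesis is
    applied to it, which is why \<open>\<phi>\<close> is generalised.\<close>
  define \<phi>' where "\<phi>' = \<phi>(r := \<lambda>z. \<phi> r z * (\<integral>\<^sup>+ w. \<phi> u w \<partial>k r u z))"
  have \<phi>': "\<phi>' q \<in> borel_measurable borel" "\<phi>' q y \<le> 1" for q y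
    using \<phi> h unfolding \<phi>'_def h_eq by (auto intro!: mult_le_one simp: ennreal_le_1)
  have nin: "u \<notin> set (s # ts)" "r \<in> set (s # ts)" using r us by (fastforce, metis in_set_conv_decomp)
  have nr: "r \<notin> set us" "u \<notin> set us"
    using snoc.prems(4) nin us by (metis distinct_append append_Cons not_distinct_conv_prefix, metis Un_iff set_append)
  have "(\<integral>\<^sup>+ \<omega>. (\<Prod>q\<in>set (s # ts @ [u]). \<phi> q (\<omega> q)) \<partial>P) = (\<integral>\<^sup>+ \<omega>. ennreal (enn2real (Z \<omega>) * f (\<omega> u)) \<partial>P)"
  proof (rule nn_integral_cong)
    fix \<omega>
    have "(\<Prod>q\<in>set (s # ts @ [u]). \<phi> q (\<omega> q)) = (\<Prod>q\<in>insert u (set (s # ts)). \<phi> q (\<omega> q))"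
      by (intro prod.cong) auto
    also have "\<dots> = \<phi> u (\<omega> u) * Z \<omega>"
      unfolding Z_def using nin by (intro prod.insert) auto
    finally show "(\<Prod>q\<in>set (s # ts @ [u]). \<phi> q (\<omega> q)) = ennreal (enn2real (Z \<omega>) * f (\<omega> u))"
      using f Zb by (simp add: ennreal_mult Z_eq f_eq mult.commute)
  qed
  also have "\<dots> = (\<integral>\<^sup>+ \<omega>. (\<Prod>q\<in>set (s # ts). \<phi>' q (\<omega> q)) \<partial>P)"
    unfolding key
  proof (rule nn_integral_cong)
    fix \<omega>
    have "Z \<omega> = \<phi> r (\<omega> r) * (\<Prod>q\<in>set (s # ts) - {r}. \<phi> q (\<omega> q))"
      unfolding Z_def using nin(2) by (intro prod.remove) auto
    moreover have "(\<Prod>q\<in>set (s # ts). \<phi>' q (\<omega> q)) = \<phi>' r (\<omega> r) * (\<Prod>q\<in>set (s # ts) - {r}. \<phi>' q (\<omega> q))"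
      using nin(2) by (intro prod.remove) auto
    moreover have "(\<Prod>q\<in>set (s # ts) - {r}. \<phi>' q (\<omega> q)) = (\<Prod>q\<in>set (s # ts) - {r}. \<phi> q (\<omega> q))"
      by (intro prod.cong) (auto simp: \<phi>'_def)
    ultimately have "(\<Prod>q\<in>set (s # ts). \<phi>' q (\<omega> q)) = Z \<omega> * ennreal (h (\<omega> r))"
      by (simp only:) (simp add: \<phi>'_def h_eq ac_simps)
    then show "ennreal (enn2real (Z \<omega>) * h (\<omega> r)) = (\<Prod>q\<in>set (s # ts). \<phi>' q (\<omega> q))"
      using h Zb by (simp only: ennreal_mult Z_eq)
  qed
  also have "\<dots> = cyl \<phi>' s x (s # ts)"
    using snoc.prems(3,4) by (intro snoc.IH \<phi>') (auto simp: sorted_append)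
  also have "\<dots> = cyl \<phi> s x (us @ [r, u])"
    unfolding us \<phi>'_def using nr by (intro cyl_append[symmetric])
  also have "us @ [r, u] = s # ts @ [u]" using us by (metis append_Cons append_assoc append_Nil)
  finally show ?case .
qed

text \<open>The value assigned to a cylinder does not mention \<open>Q\<close>, and cylinders form a
  generator stable under intersection.\<close>

lemma coord_markov_family_unique:
  assumes Q: "coord_markov_family k Q" and Q': "coord_markov_family k Q'" and s: "0 \<le> s"
  shows "Q' s x = Q s x"
proof -
  have *: "emeasure (Q s x) {\<omega> \<in> Dpaths. \<forall>r\<in>J. \<omega> r \<in> A r} =
      cyl (\<lambda>r. indicator (if r \<in> J then A r else UNIV)) s x (s # sorted_list_of_set (J - {s}))"
    if Q: "coord_markov_family k Q" and J: "finite J" "J \<subseteq> {s..}" "\<forall>r. A r \<in> sets borel" for Q J A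
  proof -
    have P: "prob_space (Q s x)" "space (Q s x) = Dpaths" "sets (Q s x) = sets (G {s..})"
      and i: "emeasure (Q s x) {\<omega> \<in> Dpaths. \<omega> s = x} = 1"
      and markov: "\<And>t u (f :: ennreal \<Rightarrow> real). s \<le> t \<Longrightarrow> t \<le> u \<Longrightarrow> f \<in> borel_measurable borel \<Longrightarrow>
       (\<exists>B. \<forall>y. \<bar>f y\<bar> \<le> B) \<Longrightarrow>
       AE \<omega> in Q s x. real_cond_exp (Q s x) (G {s..t}) (\<lambda>\<omega>. f (\<omega> u)) \<omega> = (\<integral>y. f y \<partial>k t u (\<omega> t))"
      using Q s unfolding coord_markov_family_def by auto
    interpret prob_space "Q s x" by (rule P)
    have init: "AE \<omega> in Q s x. \<omega> s = x"
    proof (rule AE_prob_1[THEN AE_mp])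
      show "prob {\<omega> \<in> Dpaths. \<omega> s = x} = 1" using i by (simp add: measure_def)
    qed auto
    let ?A = "\<lambda>r. if r \<in> J then A r else UNIV"
    have so: "sorted (s # sorted_list_of_set (J - {s}))" "distinct (s # sorted_list_of_set (J - {s}))"
      using J by auto
    have set: "set (s # sorted_list_of_set (J - {s})) = insert s J" using J by auto
    have meas: "{\<omega> \<in> Dpaths. \<forall>r\<in>J. \<omega> r \<in> A r} \<in> sets (Q s x)"
      unfolding P(3) sets_G_cylinders cylinders_def using J by (intro sigma_sets.Basic) auto
    \<comment> \<open>The start time \<open>s\<close> is added to the constrained times with the
      trivial condition \<open>UNIV\<close> when \<open>J\<close> lacks it, because
      \<open>markov_imp_cyl\<close> needs a list beginning with \<open>s\<close>.\<close>
    have eq: "{\<omega> \<in> Dpaths. \<forall>r\<in>J. \<omega> r \<in> A r} = {\<omega> \<in> Dpaths. \<forall>r\<in>insert s J. \<omega> r \<in> ?A r}" by auto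
    have "emeasure (Q s x) {\<omega> \<in> Dpaths. \<forall>r\<in>J. \<omega> r \<in> A r} = (\<integral>\<^sup>+ \<omega>. indicator {\<omega> \<in> Dpaths. \<forall>r\<in>insert s J. \<omega> r \<in> ?A r} \<omega> \<partial>Q s x)"
      using meas unfolding eq by (rule nn_integral_indicator[symmetric])
    also have "\<dots> = (\<integral>\<^sup>+ \<omega>. (\<Prod>r\<in>insert s J. indicator (?A r) (\<omega> r)) \<partial>Q s x)"
      using J by (intro nn_integral_cong indicator_cylinder) (auto simp: P(2))
    also have "\<dots> = cyl (\<lambda>r. indicator (?A r)) s x (s # sorted_list_of_set (J - {s}))"
      unfolding set[symmetric] using J by (intro markov_imp_cyl P s init markov so) (auto simp: indicator_def)
    finally show ?thesis .
  qed
  show ?thesis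
  proof (rule measure_eqI_cylinders[where I="{s..}"])
    show "sets (Q' s x) = sets (G {s..})" "sets (Q s x) = sets (G {s..})"
      using Q Q' s by (auto simp: coord_markov_family_def)
    interpret prob_space "Q' s x" using Q' s by (auto simp: coord_markov_family_def)
    show "emeasure (Q' s x) Dpaths \<noteq> \<infinity>" by simp
    fix C assume "C \<in> cylinders {s..}"
    then obtain J A where "C = {\<omega> \<in> Dpaths. \<forall>r\<in>J. \<omega> r \<in> A r}" "finite J" "J \<subseteq> {s..}" "\<forall>r. A r \<in> sets borel"
      unfolding cylinders_def by blast
    then show "emeasure (Q' s x) C = emeasure (Q s x) C" using *[OF Q] *[OF Q'] by simp
  qed
qed

end

context branching_family
begin

lemma cylinder_law_exists:
  assumes "0 \<le> s"
  shows "\<exists>P. prob_space P \<and> space P = Dpaths \<and> sets P = sets (G {s..}) \<and> cylinder_law s x P"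
proof -
  obtain N :: "(real \<Rightarrow> real) measure" and X where N: "prob_space N" "\<And>t. s \<le> t \<Longrightarrow> X t \<in> borel_measurable N"
    "\<And>J. finite J \<Longrightarrow> J \<subseteq> {s..} \<Longrightarrow>
       distr N (path_space J) (\<lambda>\<omega>. \<lambda>j\<in>J. X j \<omega>) = path_law s x (sorted_list_of_set J)"
    using kolmogorov_process[OF assms] by blast
  interpret branching_process k N s x X
    using N assms branching_family_axioms by (intro branching_process.intro branching_process_axioms.intro)
  show ?thesis by (rule path_measure_exists)
qed

lemma coord_markov_family_exists: "\<exists>Q. coord_markov_family k Q"
proof -
  \<comment> \<open>The requirements on \<open>Q s x\<close> for different pairs do not interact, so
    each measure may be chosen separately.\<close>
  define Q where "Q s x = (SOME P. prob_space P \<and> space P = Dpaths \<and> sets P = sets (G {s..}) \<and> cylinder_law s x P)" for s x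
  have Q: "prob_space (Q s x) \<and> space (Q s x) = Dpaths \<and> sets (Q s x) = sets (G {s..}) \<and> cylinder_law s x (Q s x)"
    if "0 \<le> s" for s x
    unfolding Q_def by (rule someI_ex[OF cylinder_law_exists[OF that]])
  have "coord_markov_family k Q"
    unfolding coord_markov_family_def
    using Q by (auto intro!: cylinder_law_initial cylinder_law_cond_exp)
  then show ?thesis by blast
qed

end

theorem mainTheorem2:
  fixes k :: "real \<Rightarrow> real \<Rightarrow> ennreal \<Rightarrow> ennreal measure"
  assumes "branching_kernels k"
  shows "\<exists>Q. coord_markov_family k Q \<and>
           (\<forall>Q'. coord_markov_family k Q' \<longrightarrow> (\<forall>s\<ge>0. \<forall>x. Q' s x = Q s x))"
proof -
  interpret branching_family k using assms by unfold_locales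
  show ?thesis using coord_markov_family_exists coord_markov_family_unique by blast
qed

end
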